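(* Let $d\ge1$, $n\ge1$, $p\ge2$, and let $P=(P_1,\dots,P_d):\mathbb R^d\to\mathbb R^d$, where each $P_i$ is a polynomial of degree at most $n$. Then $$\|\delta P\|_{L^p(\gamma_d)}\le\sqrt p\,|\mathbb E P|+96\sqrt{2e}\,p\sqrt n\,\|P-\mathbb E P\|_{L^p(\gamma_d;\mathbb R^d)}.$$ In particular, $$\|\delta P\|_{L^p(\gamma_d)}\le(1+192\sqrt{2e})\,p\sqrt n\,\|P\|_{L^p(\gamma_d;\mathbb R^d)}.$$ For $n=0$ (that is, $P$ constant), one has $\|\delta P\|_{L^p(\gamma_d)}=m_p|P|\le\sqrt p\,|P|$.
   Context: $\gamma_d$ is the standard Gaussian measure on $\mathbb R^d$, $\mathbb E$ is integration against $\gamma_d$, $|\cdot|$ is the Euclidean norm, and $\|F\|_{L^p(\gamma_d;\mathbb R^d)}=(\mathbb E|F|^p)^{1/p}$. The Gaussian divergence of a smooth vector field $V$ is $\delta V(x)=x\cdot V(x)-\sum_{i=1}^d\partial_iV_i(x)$. $m_p=(\mathbb E|g|^p)^{1/p}$ for a standard real Gaussian $g$. *)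

theory Defs
  imports "HOL-Probability.Probability"
begin

definition std_gaussian :: "(real ^ 'd) measure" where
  "std_gaussian = density lborel (\<lambda>x. ennreal (\<Prod>i\<in>UNIV. std_normal_density (x $ i)))"

text \<open>The Bochner integral is 0 for non-integrable functions, so this is the usual norm only if
  the \<open>p\<close>-th power of the norm is integrable. That is the case for polynomials under a Gaussian
  measure.\<close>
definition Lp_norm :: "'a measure \<Rightarrow> real \<Rightarrow> ('a \<Rightarrow> 'b::real_normed_vector) \<Rightarrow> real" where
  "Lp_norm M p F = (\<integral>x. norm (F x) powr p \<partial>M) powr (1 / p)"

definition gaussian_moment :: "real \<Rightarrow> real" where
  "gaussian_moment p = Lp_norm (density lborel std_normal_density) p (\<lambda>g. g)"

text \<open>Real polynomial functions of total degree at most \<open>n\<close>; \<open>\<alpha>\<close> ranges over the finite set of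
  multi-indices of order at most \<open>n\<close>.\<close>
definition polynomial_degree_le :: "nat \<Rightarrow> (real ^ 'd \<Rightarrow> real) \<Rightarrow> bool" where
  "polynomial_degree_le n f \<longleftrightarrow>
     (\<exists>c :: ('d \<Rightarrow> nat) \<Rightarrow> real. \<forall>x.
        f x = (\<Sum>\<alpha> | (\<Sum>i\<in>UNIV. \<alpha> i) \<le> n. c \<alpha> * (\<Prod>i\<in>UNIV. x $ i ^ \<alpha> i)))"

definition partial_deriv :: "'d \<Rightarrow> (real ^ 'd \<Rightarrow> real) \<Rightarrow> real ^ 'd \<Rightarrow> real" where
  "partial_deriv i f x = deriv (\<lambda>t. f (x + t *\<^sub>R axis i 1)) 0"

definition gaussian_divergence :: "(real ^ 'd \<Rightarrow> real ^ 'd) \<Rightarrow> real ^ 'd \<Rightarrow> real" where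
  "gaussian_divergence V x = x \<bullet> V x - (\<Sum>i\<in>UNIV. partial_deriv i (\<lambda>y. V y $ i) x)"

end

theory Submission
  imports Defs
begin

text \<open>
  Put \<open>s = p / 2\<close> and let \<open>f\<close> be the Gaussian divergence of \<open>P\<close>, a polynomial of degree at most \<open>N = n + 1\<close>. For independent
  standard Gaussian vectors \<open>X, Y\<close> and \<open>c = exp t\<close> let \<open>Z = sqrt ((c + 1) / 2) X + \<i> sqrt ((c - 1) / 2) Y\<close>,
  so that \<open>E Z\<^sub>j\<^sup>2 = 1\<close> and \<open>E \<bar>Z\<^sub>j\<bar>\<^sup>2 = c\<close>. With \<open>L = z \<bullet> \<partial> - \<partial> \<bullet> \<partial>\<close> acting on the holomorphic variables only,
  \<open>d/dt E \<psi>(Z) = E (L \<psi>)(Z)\<close>. If \<open>u\<close> is holomorphic this yields \<open>d/dt E \<bar>u\<bar>\<^sup>2 = E (L u) cnj u\<close> and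
  \<open>(d/dt)\<^sup>2 E \<bar>u\<bar>\<^sup>2 = E \<bar>L u\<bar>\<^sup>2\<close>, hence by Cauchy-Schwarz \<open>E \<bar>u(Z)\<bar>\<^sup>2\<close> is logarithmically convex in \<open>t\<close>.
  Formally this applies to \<open>u = f powr s\<close>; \<open>(\<bar>f\<bar>\<^sup>2 + \<delta>) powr s\<close> satisfies the same inequality
  and is smooth. As it grows at most like \<open>exp (N s t)\<close>, its logarithmic derivative at \<open>t = 0\<close> is at most \<open>N s\<close>,
  which implies \<open>E \<bar>f\<bar> powr (p - 2) \<bar>\<nabla>f\<bar>\<^sup>2 \<le> N E \<bar>f\<bar> powr p\<close>. Integration by parts gives
  \<open>E \<bar>f\<bar> powr p = (p - 1) E \<bar>f\<bar> powr (p - 2) (P \<bullet> \<nabla>f)\<close>, so Young's inequality bounds the \<open>L\<^sup>p\<close> norm of \<open>f\<close> by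
  \<open>(p - 1) sqrt N\<close> times that of \<open>P\<close>. For constant \<open>P\<close> the gradient is constant and the same computation
  gives the factor \<open>sqrt (p - 1)\<close>.
\<close>

section \<open>Gaussian integrals of functions of polynomial growth\<close>

text \<open>For \<open>s = 1\<close> and \<delta> = 0 the convexity is spectral: Wick ordering along
  the path gives E |F(Z)|^2 as the sum over k <= N of exp (k t) times the squared norm of the k-th
  Hermite component, so its derivative at t = 0 is at most N times its value. Working with the path
  instead of the spectrum is what lets the argument pass to the power \<open>s\<close>, where no
  such expansion is available. Two obstacles shape the formal proof. A power of F is not holomorphic
  near the zeros of F, so the formula for the second derivative does not apply to it directly; for
  the regularised power that derivative contains extra terms, and their sign is settled by an exact
  algebraic identity (\<open>H_eq\<close>). Moreover the coefficient of Y has infinite slope at t =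
  0, so all derivatives are taken at t > 0, and only the resulting first order inequality is passed
  to the limit.\<close>

lemma has_vector_derivative_imp_tendsto_seq:
  fixes g :: "real \<Rightarrow> 'b::real_normed_vector"
  assumes "(g has_vector_derivative D) (at t0)"
    and "\<And>i. u i \<noteq> t0" and "u \<longlonglongrightarrow> t0"
  shows "(\<lambda>i. (g (u i) - g t0) /\<^sub>R (u i - t0)) \<longlonglongrightarrow> D"
proof -
  have "((\<lambda>h. norm (g (t0 + h) - g t0 - h *\<^sub>R D) / norm h) \<longlongrightarrow> 0) (at 0)"
    using assms(1) unfolding has_vector_derivative_def has_derivative_at by auto
  then have "((\<lambda>h. norm ((g (t0 + h) - g t0) /\<^sub>R h - D)) \<longlongrightarrow> 0) (at 0)"
  proof (rule Lim_transform_eventually)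
    show "\<forall>\<^sub>F h in at 0. norm (g (t0 + h) - g t0 - h *\<^sub>R D) / norm h = norm ((g (t0 + h) - g t0) /\<^sub>R h - D)"
    proof (rule eventually_at_filter[THEN iffD2], rule always_eventually, clarify)
      fix h :: real assume h: "h \<noteq> 0"
      have "(g (t0 + h) - g t0) /\<^sub>R h - D = (g (t0 + h) - g t0 - h *\<^sub>R D) /\<^sub>R h"
        using h by (simp add: scaleR_diff_right)
      then show "norm (g (t0 + h) - g t0 - h *\<^sub>R D) / norm h = norm ((g (t0 + h) - g t0) /\<^sub>R h - D)"
        by (simp add: divide_inverse mult.commute)
    qed
  qed
  then have l: "((\<lambda>h. (g (t0 + h) - g t0) /\<^sub>R h) \<longlongrightarrow> D) (at 0)"
    using tendsto_norm_zero_iff LIM_zero_iff by metis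
  have "filterlim (\<lambda>i. u i - t0) (at 0) sequentially"
    using assms(2,3) by (auto simp: filterlim_at LIM_zero_iff)
  from filterlim_compose[OF l this] show ?thesis by simp
qed

text \<open>The bound \<open>H\<close> on the derivative dominates all difference quotients, by the
  mean value inequality. Dominated convergence speaks about sequences, hence the detour through
  sequences in the interval that tend to \<open>t0\<close>.\<close>

lemma has_vector_derivative_integral:
  fixes g :: "real \<Rightarrow> 'a \<Rightarrow> 'b::{banach, second_countable_topology}"
  assumes t0: "t0 \<in> {a<..<b}"
    and deriv: "\<And>t w. t \<in> {a<..<b} \<Longrightarrow> ((\<lambda>t. g t w) has_vector_derivative g' t w) (at t)"
    and int: "\<And>t. t \<in> {a<..<b} \<Longrightarrow> integrable M (g t)"
    and bound: "\<And>t w. t \<in> {a<..<b} \<Longrightarrow> norm (g' t w) \<le> H w"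
    and H: "integrable M H"
    and meas: "g' t0 \<in> borel_measurable M"
  shows "((\<lambda>t. \<integral>w. g t w \<partial>M) has_vector_derivative (\<integral>w. g' t0 w \<partial>M)) (at t0)"
proof -
  have lip: "norm (g t w - g t0 w) \<le> H w * \<bar>t - t0\<bar>" if t: "t \<in> {a<..<b}" for t w
  proof -
    have "norm (g t w - g t0 w) \<le> H w * norm (t - t0)"
    proof (rule differentiable_bound[where S="{a<..<b}" and f'="\<lambda>t h. h *\<^sub>R g' t w"])
      show "onorm (\<lambda>h. h *\<^sub>R g' x w) \<le> H w" if "x \<in> {a<..<b}" for x
        using bound[OF that, of w] by (simp add: onorm_scaleR_left_lemma onorm_scaleR_left onorm_id)
    qed (use t t0 deriv in \<open>auto simp: has_vector_derivative_def intro: has_derivative_at_withinI\<close>)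
    then show ?thesis by simp
  qed
  have lim: "(\<lambda>i. ((\<integral>w. g (u i) w \<partial>M) - (\<integral>w. g t0 w \<partial>M)) /\<^sub>R (u i - t0)) \<longlonglongrightarrow> (\<integral>w. g' t0 w \<partial>M)"
    if u: "\<And>i. u i \<noteq> t0" "u \<longlonglongrightarrow> t0" "\<And>i. u i \<in> {a<..<b}" for u
  proof -
    have "(\<lambda>i. \<integral>w. (g (u i) w - g t0 w) /\<^sub>R (u i - t0) \<partial>M) \<longlonglongrightarrow> (\<integral>w. g' t0 w \<partial>M)"
    proof (rule integral_dominated_convergence[where w=H])
      show "(\<lambda>w. (g (u i) w - g t0 w) /\<^sub>R (u i - t0)) \<in> borel_measurable M" for i
        using int[OF u(3)[of i]] int[OF t0] by measurable
      show "AE w in M. (\<lambda>i. (g (u i) w - g t0 w) /\<^sub>R (u i - t0)) \<longlonglongrightarrow> g' t0 w"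
        using has_vector_derivative_imp_tendsto_seq[OF deriv[OF t0] u(1,2)] by auto
      show "AE w in M. norm ((g (u i) w - g t0 w) /\<^sub>R (u i - t0)) \<le> H w" for i
      proof (rule AE_I2)
        fix w
        show "norm ((g (u i) w - g t0 w) /\<^sub>R (u i - t0)) \<le> H w"
          using lip[OF u(3)[of i], of w] u(1)[of i] by (simp add: divide_simps mult.commute)
      qed
    qed (use H meas in auto)
    moreover have "(\<integral>w. (g (u i) w - g t0 w) /\<^sub>R (u i - t0) \<partial>M)
        = ((\<integral>w. g (u i) w \<partial>M) - (\<integral>w. g t0 w \<partial>M)) /\<^sub>R (u i - t0)" for i
      using int[OF u(3)[of i]] int[OF t0] by simp
    ultimately show ?thesis by (simp only:)
  qed
  have "((\<lambda>t. ((\<integral>w. g t w \<partial>M) - (\<integral>w. g t0 w \<partial>M)) /\<^sub>R (t - t0)) \<longlongrightarrow> (\<integral>w. g' t0 w \<partial>M)) (at t0 within {a<..<b})"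
    unfolding tendsto_at_iff_sequentially comp_def using lim by auto
  then have l: "((\<lambda>t. ((\<integral>w. g t w \<partial>M) - (\<integral>w. g t0 w \<partial>M)) /\<^sub>R (t - t0)) \<longlongrightarrow> (\<integral>w. g' t0 w \<partial>M)) (at t0)"
    using at_within_open[OF t0] by simp
  have "((\<lambda>t. norm (((\<integral>w. g t w \<partial>M) - (\<integral>w. g t0 w \<partial>M)) /\<^sub>R (t - t0) - (\<integral>w. g' t0 w \<partial>M))) \<longlongrightarrow> 0) (at t0)"
    using l by (simp add: tendsto_norm_zero_iff LIM_zero_iff)
  then have "((\<lambda>t. norm ((\<integral>w. g t w \<partial>M) - (\<integral>w. g t0 w \<partial>M) - (t - t0) *\<^sub>R (\<integral>w. g' t0 w \<partial>M)) / norm (t - t0)) \<longlongrightarrow> 0) (at t0)"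
  proof (rule Lim_transform_eventually)
    show "\<forall>\<^sub>F t in at t0. norm (((\<integral>w. g t w \<partial>M) - (\<integral>w. g t0 w \<partial>M)) /\<^sub>R (t - t0) - (\<integral>w. g' t0 w \<partial>M))
      = norm ((\<integral>w. g t w \<partial>M) - (\<integral>w. g t0 w \<partial>M) - (t - t0) *\<^sub>R (\<integral>w. g' t0 w \<partial>M)) / norm (t - t0)"
    proof (rule eventually_at_filter[THEN iffD2], rule always_eventually, clarify)
      fix t :: real assume h: "t \<noteq> t0"
      have "((\<integral>w. g t w \<partial>M) - (\<integral>w. g t0 w \<partial>M)) /\<^sub>R (t - t0) - (\<integral>w. g' t0 w \<partial>M)
        = ((\<integral>w. g t w \<partial>M) - (\<integral>w. g t0 w \<partial>M) - (t - t0) *\<^sub>R (\<integral>w. g' t0 w \<partial>M)) /\<^sub>R (t - t0)"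
        using h by (simp add: scaleR_diff_right)
      then show "norm (((\<integral>w. g t w \<partial>M) - (\<integral>w. g t0 w \<partial>M)) /\<^sub>R (t - t0) - (\<integral>w. g' t0 w \<partial>M))
      = norm ((\<integral>w. g t w \<partial>M) - (\<integral>w. g t0 w \<partial>M) - (t - t0) *\<^sub>R (\<integral>w. g' t0 w \<partial>M)) / norm (t - t0)"
        by (simp add: divide_inverse mult.commute)
    qed
  qed
  then show ?thesis
    unfolding has_vector_derivative_def has_derivative_iff_norm
    by (simp add: bounded_linear_scaleR_left)
qed

text \<open>This class is closed under arithmetic and composition, and its members are integrable
  against the Gaussian weight. Integrability side conditions thereby reduce to structural
  \<open>tame\<close> goals.\<close>

definition tame :: "('a::euclidean_space \<Rightarrow> 'b::real_normed_vector) \<Rightarrow> bool" where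
  "tame f \<longleftrightarrow> f \<in> borel_measurable borel \<and> (\<exists>C k. \<forall>x. norm (f x) \<le> C * (1 + norm x) ^ k)"

lemma tameI:
  assumes "f \<in> borel_measurable borel" "\<And>x. norm (f x) \<le> C * (1 + norm x) ^ k"
  shows "tame f"
  using assms unfolding tame_def by blast

lemma tameD [measurable_dest]: "tame f \<Longrightarrow> f \<in> borel_measurable borel"
  by (simp add: tame_def)

lemma tameE:
  assumes "tame f"
  obtains C k where "C \<ge> 0" "\<And>x. norm (f x) \<le> C * (1 + norm x) ^ k"
proof -
  obtain C k where C: "\<And>x. norm (f x) \<le> C * (1 + norm x) ^ k" using assms unfolding tame_def by auto
  have "norm (f x) \<le> \<bar>C\<bar> * (1 + norm x) ^ k" for x
    using C[of x] by (smt (verit, ccfv_SIG) mult_right_mono norm_ge_zero zero_le_power)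
  then show ?thesis using that[of "\<bar>C\<bar>" k] by auto
qed

lemma tame_const [simp, intro]: "tame (\<lambda>x. c)"
  by (rule tameI[where C="norm c" and k=0]) auto

lemma tame_mono:
  assumes "tame g" "f \<in> borel_measurable borel" "\<And>x. norm (f x) \<le> norm (g x)"
  shows "tame f"
proof -
  obtain C k where "\<And>x. norm (g x) \<le> C * (1 + norm x) ^ k" using tameE[OF assms(1)] by metis
  with assms show ?thesis by (intro tameI[where C=C and k=k]) (auto intro: order_trans)
qed

lemma tame_add [intro]:
  fixes f g :: "'a::euclidean_space \<Rightarrow> 'b::{real_normed_vector, second_countable_topology}"
  assumes "tame f" "tame g"
  shows "tame (\<lambda>x. f x + g x)"
proof -
  obtain C k where C: "C \<ge> 0" "\<And>x. norm (f x) \<le> C * (1 + norm x) ^ k" using tameE[OF assms(1)] by metis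
  obtain D l where D: "D \<ge> 0" "\<And>x. norm (g x) \<le> D * (1 + norm x) ^ l" using tameE[OF assms(2)] by metis
  show ?thesis
  proof (rule tameI[where C="C+D" and k="k+l"])
    show "(\<lambda>x. f x + g x) \<in> borel_measurable borel" using assms by measurable
    fix x
    have "norm (f x + g x) \<le> C * (1 + norm x) ^ k + D * (1 + norm x) ^ l"
      using C(2)[of x] D(2)[of x] norm_triangle_ineq[of "f x" "g x"] by linarith
    also have "\<dots> \<le> C * (1 + norm x) ^ (k+l) + D * (1 + norm x) ^ (k+l)"
      using C(1) D(1) by (intro add_mono mult_left_mono power_increasing) auto
    finally show "norm (f x + g x) \<le> (C + D) * (1 + norm x) ^ (k+l)" by (simp add: algebra_simps)
  qed
qed

lemma tame_mult [intro]:
  fixes f g :: "'a::euclidean_space \<Rightarrow> 'b::{real_normed_algebra, second_countable_topology}"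
  assumes "tame f" "tame g"
  shows "tame (\<lambda>x. f x * g x)"
proof -
  obtain C k where C: "C \<ge> 0" "\<And>x. norm (f x) \<le> C * (1 + norm x) ^ k" using tameE[OF assms(1)] by metis
  obtain D l where D: "D \<ge> 0" "\<And>x. norm (g x) \<le> D * (1 + norm x) ^ l" using tameE[OF assms(2)] by metis
  show ?thesis
  proof (rule tameI[where C="C*D" and k="k+l"])
    show "(\<lambda>x. f x * g x) \<in> borel_measurable borel" using assms by measurable
    fix x
    have "norm (f x * g x) \<le> norm (f x) * norm (g x)" by (rule norm_mult_ineq)
    also have "\<dots> \<le> (C * (1 + norm x) ^ k) * (D * (1 + norm x) ^ l)"
      using C D by (intro mult_mono) auto
    finally show "norm (f x * g x) \<le> (C * D) * (1 + norm x) ^ (k+l)" by (simp add: algebra_simps power_add)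
  qed
qed

lemma tame_scaleR [intro]:
  fixes g :: "'a::euclidean_space \<Rightarrow> 'b::{real_normed_vector, second_countable_topology}"
  assumes "tame f" "tame g"
  shows "tame (\<lambda>x. f x *\<^sub>R g x)"
proof -
  have n: "tame (\<lambda>x. norm (f x) * norm (g x))"
  proof (rule tame_mult)
    show "tame (\<lambda>x. norm (f x))" by (rule tame_mono[OF assms(1)]) (use assms in \<open>auto dest: tameD\<close>)
    show "tame (\<lambda>x. norm (g x))" by (rule tame_mono[OF assms(2)]) (use assms in \<open>auto dest: tameD\<close>)
  qed
  show ?thesis by (rule tame_mono[OF n]) (use assms in \<open>auto dest: tameD\<close>)
qed

lemma tame_norm [intro]: "tame f \<Longrightarrow> tame (\<lambda>x. norm (f x))"
  by (rule tame_mono[of f]) (auto dest: tameD)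

lemma tame_uminus [intro]: 
  fixes f :: "'a::euclidean_space \<Rightarrow> 'b::{real_normed_vector, second_countable_topology}"
  shows "tame f \<Longrightarrow> tame (\<lambda>x. - f x)"
  by (rule tame_mono[of f]) (auto dest: tameD)

lemma tame_diff [intro]:
  fixes f g :: "'a::euclidean_space \<Rightarrow> 'b::{real_normed_vector, second_countable_topology}"
  shows "tame f \<Longrightarrow> tame g \<Longrightarrow> tame (\<lambda>x. f x - g x)"
  using tame_add[of f "\<lambda>x. - g x"] by auto

lemma tame_sum [intro]:
  fixes f :: "'i \<Rightarrow> 'a::euclidean_space \<Rightarrow> 'b::{real_normed_vector, second_countable_topology}"
  shows "(\<And>i. i \<in> I \<Longrightarrow> tame (f i)) \<Longrightarrow> tame (\<lambda>x. \<Sum>i\<in>I. f i x)"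
  by (induction I rule: infinite_finite_induct) auto

lemma tame_power [intro]:
  fixes f :: "'a::euclidean_space \<Rightarrow> 'b::{real_normed_algebra_1, second_countable_topology}"
  shows "tame f \<Longrightarrow> tame (\<lambda>x. f x ^ k)"
  by (induction k) auto

lemma tame_compose:
  fixes f :: "'b::euclidean_space \<Rightarrow> 'c::real_normed_vector" and g :: "'a::euclidean_space \<Rightarrow> 'b"
  assumes "tame f" "tame g"
  shows "tame (\<lambda>x. f (g x))"
proof -
  obtain C k where C: "C \<ge> 0" "\<And>x. norm (f x) \<le> C * (1 + norm x) ^ k" using tameE[OF assms(1)] by metis
  have t: "tame (\<lambda>x. C * (1 + norm (g x)) ^ k)" using assms by (intro tame_mult tame_power tame_add) auto
  show ?thesis
    by (rule tame_mono[OF t]) (use assms C in \<open>auto intro: order_trans[OF C(2)] measurable_compose[of g borel borel f borel] dest: tameD\<close>)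
qed

lemma tame_linear:
  assumes "bounded_linear f"
  shows "tame f"
proof -
  obtain K where K: "K > 0" "\<And>x. norm (f x) \<le> norm x * K" using bounded_linear.pos_bounded[OF assms] by blast
  show ?thesis
  proof (rule tameI[where C=K and k=1])
    show "f \<in> borel_measurable borel"
      using assms by (intro borel_measurable_continuous_onI linear_continuous_on)
    show "norm (f x) \<le> K * (1 + norm x)^1" for x
      using K(1) K(2)[of x] by (simp add: algebra_simps)
  qed
qed

lemma tame_bounded_linear_comp:
  fixes g :: "'a::euclidean_space \<Rightarrow> 'b::euclidean_space"
  assumes "bounded_linear f" "tame g"
  shows "tame (\<lambda>x. f (g x))"
  using tame_compose[OF tame_linear[OF assms(1)] assms(2)] .

section \<open>The Gaussian weight and its integral\<close>

definition gauss :: "'a::euclidean_space \<Rightarrow> real" where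
  "gauss x = exp (- (norm x)\<^sup>2 / 2)"

lemma gauss_pos [simp]: "gauss x > 0" and gauss_nonneg [simp]: "gauss x \<ge> 0"
  by (auto simp: gauss_def)

lemma gauss_measurable [measurable]: "gauss \<in> borel_measurable borel"
  unfolding gauss_def by measurable

lemma integrable_exp_neg_norm_square:
  assumes a: "a > 0"
  shows "integrable lborel (\<lambda>x::'a::euclidean_space. exp (- a * (norm x)\<^sup>2))"
proof (rule integrableI_nonneg)
  show "(\<lambda>x::'a. exp (- a * (norm x)\<^sup>2)) \<in> borel_measurable lborel" by measurable
  have 1: "integrable lborel (\<lambda>x::real. exp (- a * x\<^sup>2))"
  proof -
    \<comment> \<open>With this \<sigma> the exponent of \<open>normal_density 0 \<sigma>\<close> is
      - a x^2.\<close>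
    define \<sigma> where "\<sigma> = sqrt (1 / (2 * a))"
    have s: "\<sigma>\<^sup>2 = 1 / (2 * a)" using a by (simp add: \<sigma>_def)
    have "exp (- a * x\<^sup>2) = sqrt (2 * pi * \<sigma>\<^sup>2) * normal_density 0 \<sigma> x" for x
      using a unfolding normal_density_def s by (simp add: field_simps)
    moreover have "\<sigma> > 0" using a by (simp add: \<sigma>_def)
    ultimately show ?thesis by simp
  qed
  have "(\<integral>\<^sup>+x. ennreal (exp (- a * (norm (x::'a))\<^sup>2)) \<partial>lborel)
      = (\<integral>\<^sup>+x. (\<Prod>b\<in>Basis. ennreal (exp (- a * ((x::'a) \<bullet> b)\<^sup>2))) \<partial>lborel)"
  proof (rule nn_integral_cong)
    fix x :: 'a
    have "(norm x)\<^sup>2 = (\<Sum>b\<in>Basis. (x \<bullet> b)\<^sup>2)"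
      unfolding power2_norm_eq_inner by (subst euclidean_inner) (simp add: power2_eq_square)
    then show "ennreal (exp (- a * (norm x)\<^sup>2)) = (\<Prod>b\<in>Basis. ennreal (exp (- a * (x \<bullet> b)\<^sup>2)))"
      by (simp add: prod_ennreal exp_sum[symmetric] sum_distrib_left sum_negf)
  qed
  also have "\<dots> = (\<Prod>b\<in>(Basis::'a set). \<integral>\<^sup>+x. ennreal (exp (- a * x\<^sup>2)) \<partial>lborel)"
    by (rule nn_integral_lborel_prod) auto
  also have "\<dots> < \<infinity>"
    using 1 by (simp add: less_top[symmetric] ennreal_prod_eq_top integrable_iff_bounded del: prod_constant)
  finally show "(\<integral>\<^sup>+x. ennreal (exp (- a * (norm (x::'a))\<^sup>2)) \<partial>lborel) < \<infinity>" .
qed auto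

text \<open>Half of the exponent absorbs the polynomial: (1 + |x|)^k <= exp (k (1 + |x|)), and
  completing the square gives k |x| <= k^2 / (2 a) + (a / 2) |x|^2, whence the constant in the
  majorant.\<close>

lemma integrable_power_exp_neg_norm_square:
  assumes a: "a > 0"
  shows "integrable lborel (\<lambda>x::'a::euclidean_space. (1 + norm x) ^ k * exp (- a * (norm x)\<^sup>2))"
proof (rule Bochner_Integration.integrable_bound)
  show "integrable lborel (\<lambda>x::'a. exp (real k + (real k)\<^sup>2 / (2 * a)) * exp (- (a/2) * (norm x)\<^sup>2))"
    using integrable_exp_neg_norm_square[of "a/2"] a by auto
  show "AE x::'a in lborel. norm ((1 + norm x) ^ k * exp (- a * (norm x)\<^sup>2))
     \<le> norm (exp (real k + (real k)\<^sup>2 / (2 * a)) * exp (- (a/2) * (norm x)\<^sup>2))"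
  proof (rule AE_I2)
    fix x :: 'a
    have "(1 + norm x) ^ k \<le> exp (1 + norm x) ^ k"
      by (rule power_mono) (use exp_ge_add_one_self[of "1 + norm x"] in auto)
    also have "\<dots> = exp (real k * (1 + norm x))" by (simp add: exp_of_nat_mult)
    finally have 1: "(1 + norm x) ^ k * exp (- a * (norm x)\<^sup>2) \<le> exp (real k * (1 + norm x)) * exp (- a * (norm x)\<^sup>2)"
      by (rule mult_right_mono) auto
    have "0 \<le> (a * norm x - real k)\<^sup>2 / (2 * a)" using a by simp
    then have "real k * norm x \<le> (real k)\<^sup>2 / (2 * a) + (a/2) * (norm x)\<^sup>2"
      using a by (simp add: power2_eq_square field_simps)
    then have 2: "exp (real k * (1 + norm x)) * exp (- a * (norm x)\<^sup>2)
        \<le> exp (real k + (real k)\<^sup>2 / (2 * a)) * exp (- (a/2) * (norm x)\<^sup>2)"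
      unfolding exp_add[symmetric] by (simp add: algebra_simps)
    show "norm ((1 + norm x) ^ k * exp (- a * (norm x)\<^sup>2))
     \<le> norm (exp (real k + (real k)\<^sup>2 / (2 * a)) * exp (- (a/2) * (norm x)\<^sup>2))"
      using order_trans[OF 1 2] by (simp only: real_norm_def abs_mult power_abs[symmetric] abs_exp_cancel) simp
  qed
qed measurable

lemma integrable_tame_gauss [intro]:
  fixes f :: "'a::euclidean_space \<Rightarrow> 'b::{banach, second_countable_topology}"
  assumes "tame f"
  shows "integrable lborel (\<lambda>x. gauss x *\<^sub>R f x)"
proof -
  obtain C k where C: "C \<ge> 0" "\<And>x. norm (f x) \<le> C * (1 + norm x) ^ k" using tameE[OF assms] by metis
  show ?thesis
  proof (rule Bochner_Integration.integrable_bound)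
    show "integrable lborel (\<lambda>x::'a. C * ((1 + norm x) ^ k * exp (- (1/2) * (norm x)\<^sup>2)))"
      using integrable_power_exp_neg_norm_square[of "1/2" k] by auto
    show "(\<lambda>x. gauss x *\<^sub>R f x) \<in> borel_measurable lborel" using assms by measurable
    show "AE x in lborel. norm (gauss x *\<^sub>R f x) \<le> norm (C * ((1 + norm x) ^ k * exp (- (1/2) * (norm x)\<^sup>2)))"
    proof (rule AE_I2)
      fix x
      show "norm (gauss x *\<^sub>R f x) \<le> norm (C * ((1 + norm x) ^ k * exp (- (1/2) * (norm x)\<^sup>2)))"
        using mult_right_mono[OF C(2)[of x], of "exp (- (norm x)\<^sup>2 / 2)"] C(1)
        by (simp add: gauss_def abs_mult mult_ac)
    qed
  qed
qed

text \<open>Unnormalised: the total mass is \<open>(2 * pi) powr (DIM('a) / 2)\<close>.\<close>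
definition gint :: "('a::euclidean_space \<Rightarrow> 'b::{banach, second_countable_topology}) \<Rightarrow> 'b" where
  "gint f = (\<integral>x. gauss x *\<^sub>R f x \<partial>lborel)"

lemma gint_add: "tame f \<Longrightarrow> tame g \<Longrightarrow> gint (\<lambda>x. f x + g x) = gint f + gint g"
  unfolding gint_def by (simp add: scaleR_add_right integrable_tame_gauss)

lemma gint_diff: "tame f \<Longrightarrow> tame g \<Longrightarrow> gint (\<lambda>x. f x - g x) = gint f - gint g"
  unfolding gint_def by (simp add: scaleR_diff_right integrable_tame_gauss)

lemma gint_sum: "(\<And>i. i \<in> I \<Longrightarrow> tame (f i)) \<Longrightarrow> gint (\<lambda>x. \<Sum>i\<in>I. f i x) = (\<Sum>i\<in>I. gint (f i))"
  unfolding gint_def by (simp add: scaleR_sum_right integrable_tame_gauss)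

lemma gint_cmult:
  fixes c :: "'b::{banach, second_countable_topology, real_normed_field}"
  shows "gint (\<lambda>x. c * f x) = c * gint f"
  unfolding gint_def by (simp add: mult_scaleR_right[symmetric] del: mult_scaleR_right)

lemma gint_bounded_linear:
  assumes "bounded_linear T" "tame f"
  shows "gint (\<lambda>x. T (f x)) = T (gint f)"
  unfolding gint_def
  by (simp add: integral_bounded_linear[OF assms(1) integrable_tame_gauss[OF assms(2)]]
    linear.scaleR[OF bounded_linear.linear[OF assms(1)], symmetric])

lemma gint_mono:
  fixes f g :: "'a::euclidean_space \<Rightarrow> real"
  assumes "tame f" "tame g" "\<And>x. f x \<le> g x"
  shows "gint f \<le> gint g"
  unfolding gint_def using assms(3)
  by (intro integral_mono integrable_tame_gauss assms(1,2)) (auto intro: mult_left_mono)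

lemma gint_nonneg: "(\<And>x. f x \<ge> (0::real)) \<Longrightarrow> gint f \<ge> 0"
  unfolding gint_def by (intro integral_nonneg_AE) auto

lemma gint_const_pos:
  assumes "c > (0::real)"
  shows "gint (\<lambda>x::'a::euclidean_space. c) > 0"
proof -
  have "gint (\<lambda>x::'a. c) \<noteq> 0"
  proof
    assume "gint (\<lambda>x::'a. c) = 0"
    then have "AE x::'a in lborel. gauss x *\<^sub>R c = 0"
      unfolding gint_def using assms
      using integrable_tame_gauss[OF tame_const[of c]]
      by (subst (asm) integral_nonneg_eq_0_iff_AE) auto
    then have "AE x::'a in lborel. False" using assms gauss_pos
      by (auto simp: less_le)
    then show False by (simp add: AE_iff_null null_sets_def)
  qed
  with gint_nonneg[of "\<lambda>x::'a. c"] assms show ?thesis by auto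
qed

text \<open>Translation invariance of \<open>lborel\<close> makes \<open>t \<mapsto> \<integral> gauss (x + t h) * f (x + t h)\<close> constant;
  its derivative at \<open>0\<close> is the difference of the two sides.\<close>
lemma gint_by_parts:
  fixes f :: "'a::euclidean_space \<Rightarrow> 'b::{banach, second_countable_topology}"
  assumes deriv: "\<And>x. ((\<lambda>t. f (x + t *\<^sub>R h)) has_vector_derivative f' x) (at 0)"
    and f: "tame f" and f': "tame f'"
  shows "gint (\<lambda>x. (x \<bullet> h) *\<^sub>R f x) = gint f'"
proof -
  define F where "F t x = gauss (x + t *\<^sub>R h) *\<^sub>R f (x + t *\<^sub>R h)" for t :: real and x
  define D where "D x = f' x - (x \<bullet> h) *\<^sub>R f x" for x
  define F' where "F' t x = gauss (x + t *\<^sub>R h) *\<^sub>R D (x + t *\<^sub>R h)" for t :: real and x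
  have th: "tame (\<lambda>x. x \<bullet> h)" by (intro tame_linear bounded_linear_inner_left)
  have tD: "tame D" unfolding D_def by (intro tame_diff tame_scaleR th f f')
  have dF: "((\<lambda>t. F t x) has_vector_derivative F' t x) (at t)" for t x
  proof -
    have s: "((\<lambda>u. u - t) has_vector_derivative 1) (at t)"
      by (auto intro!: derivative_eq_intros simp: has_real_derivative_iff_has_vector_derivative[symmetric])
    have "((\<lambda>u. f ((x + t *\<^sub>R h) + u *\<^sub>R h)) \<circ> (\<lambda>u. u - t) has_vector_derivative (1 *\<^sub>R f' (x + t *\<^sub>R h))) (at t)"
      by (rule vector_diff_chain_at[OF s]) (simp add: deriv)
    then have fd: "((\<lambda>u. f (x + u *\<^sub>R h)) has_vector_derivative f' (x + t *\<^sub>R h)) (at t)"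
      by (simp add: o_def algebra_simps)
    have n: "(\<lambda>u. gauss (x + u *\<^sub>R h)) = (\<lambda>u. exp (- ((x \<bullet> x) + 2 * u * (x \<bullet> h) + u^2 * (h \<bullet> h)) / 2))"
      unfolding gauss_def power2_norm_eq_inner by (auto simp: inner_simps power2_eq_square inner_commute algebra_simps)
    have q: "((\<lambda>u. - ((x \<bullet> x) + 2 * u * (x \<bullet> h) + u^2 * (h \<bullet> h)) / 2) has_real_derivative - ((x + t *\<^sub>R h) \<bullet> h)) (at t)"
      by (auto intro!: derivative_eq_intros simp: inner_simps field_simps)
    have gd: "((\<lambda>u. gauss (x + u *\<^sub>R h)) has_real_derivative (- ((x + t *\<^sub>R h) \<bullet> h) * gauss (x + t *\<^sub>R h))) (at t)"
      using DERIV_fun_exp[OF q] fun_cong[OF n, of t] unfolding n by (simp add: mult.commute)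
    show ?thesis
      unfolding F_def F'_def D_def
      by (rule has_vector_derivative_eq_rhs[OF has_vector_derivative_scaleR[OF gd fd]])
        (simp add: algebra_simps)
  qed
  have iF: "integrable lborel (F t)" for t
    unfolding F_def
    by (subst integrable_distr_eq[of "\<lambda>x. x + t *\<^sub>R h" lborel borel "\<lambda>x. gauss x *\<^sub>R f x", symmetric])
       (use f integrable_tame_gauss[OF f] in \<open>auto simp: lborel_distr_plus add.commute[of _ "t *\<^sub>R h"] dest: tameD\<close>)
  obtain C k where C: "C \<ge> 0" "\<And>x. norm (D x) \<le> C * (1 + norm x) ^ k" using tameE[OF tD] by metis
  \<comment> \<open>Majorant for |t| < 1. The estimate |x|^2 <= 2 |x + t h|^2 + 2 |h|^2 costs half
    of the exponent, leaving 1/4; the polynomial factor is handled by 1 + |x + t h| <= (1 + |h|) (1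
    + |x|).\<close>
  define H where "H x = C * (1 + norm h) ^ k * exp ((norm h)\<^sup>2 / 2) * ((1 + norm x) ^ k * exp (- (1/4) * (norm x)\<^sup>2))" for x :: 'a
  have "((\<lambda>t. \<integral>x. F t x \<partial>lborel) has_vector_derivative (\<integral>x. F' 0 x \<partial>lborel)) (at 0)"
  proof (rule has_vector_derivative_integral[where a="-1" and b=1 and H=H])
    show "integrable lborel H" unfolding H_def
      using integrable_power_exp_neg_norm_square[of "1/4" k] by (intro integrable_mult_right) auto
    show "F' 0 \<in> borel_measurable lborel" unfolding F'_def using tameD[OF tD] by simp
    fix t :: real and x :: 'a assume t: "t \<in> {-1<..<1}"
    let ?y = "x + t *\<^sub>R h"
    have th: "norm (t *\<^sub>R h) \<le> norm h" using t by (auto simp: mult_left_le_one_le abs_le_iff)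
    have "1 + norm ?y \<le> (1 + norm h) * (1 + norm x)"
      using th norm_triangle_ineq[of x "t *\<^sub>R h"] by (simp add: algebra_simps) (smt (verit) mult_nonneg_nonneg norm_ge_zero)
    then have "C * (1 + norm ?y) ^ k \<le> C * ((1 + norm h) * (1 + norm x)) ^ k"
      using C(1) by (intro mult_left_mono power_mono) auto
    with C(2)[of ?y] have 1: "norm (D ?y) \<le> C * (1 + norm h) ^ k * (1 + norm x) ^ k"
      by (simp add: power_mult_distrib)
    have "norm x \<le> norm ?y + norm h" using th norm_triangle_ineq4[of ?y "t *\<^sub>R h"] by simp
    then have "(norm x)\<^sup>2 \<le> (norm ?y + norm h)\<^sup>2" by (intro power_mono) auto
    also have "\<dots> \<le> 2 * (norm ?y)\<^sup>2 + 2 * (norm h)\<^sup>2"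
      using sum_squares_bound[of "norm ?y" "norm h"] by (simp add: power2_sum)
    finally have 2: "gauss ?y \<le> exp ((norm h)\<^sup>2 / 2) * exp (- (1/4) * (norm x)\<^sup>2)"
      unfolding gauss_def exp_add[symmetric] by simp
    have "norm (F' t x) = gauss ?y * norm (D ?y)" by (simp add: F'_def)
    also have "\<dots> \<le> (exp ((norm h)\<^sup>2 / 2) * exp (- (1/4) * (norm x)\<^sup>2)) * (C * (1 + norm h) ^ k * (1 + norm x) ^ k)"
      by (rule mult_mono[OF 2 1]) auto
    finally show "norm (F' t x) \<le> H x" unfolding H_def by (simp add: mult_ac)
  qed (use dF iF in auto)
  moreover have "(\<lambda>t. \<integral>x. F t x \<partial>lborel) = (\<lambda>t. gint f)"
  proof
    fix t
    have "(\<integral>x. F t x \<partial>lborel) = (\<integral>x. gauss x *\<^sub>R f x \<partial>distr lborel borel (\<lambda>x. t *\<^sub>R h + x))"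
      unfolding F_def using f by (subst integral_distr) (auto simp: add.commute dest: tameD)
    then show "(\<integral>x. F t x \<partial>lborel) = gint f" by (simp add: lborel_distr_plus gint_def)
  qed
  ultimately have "((\<lambda>t::real. gint f) has_vector_derivative (\<integral>x. F' 0 x \<partial>lborel)) (at 0)" by simp
  then have "(\<integral>x. F' 0 x \<partial>lborel) = 0"
    using vector_derivative_unique_at has_vector_derivative_const by blast
  then have "gint D = 0" by (simp add: F'_def gint_def)
  moreover have "gint D = gint f' - gint (\<lambda>x. (x \<bullet> h) *\<^sub>R f x)"
    unfolding D_def by (intro gint_diff tame_scaleR th f f')
  ultimately show ?thesis by simp
qed

section \<open>Complex polynomials\<close>

text \<open>\<open>n\<close> is only an upper bound for the degree, since constants enter at every
  \<open>n\<close>. The inductive form turns growth, differentiability and the bookkeeping of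
  degrees into rule inductions without multi-indices.\<close>

inductive cpoly :: "nat \<Rightarrow> (complex ^ 'd \<Rightarrow> complex) \<Rightarrow> bool" where
  cpoly_const: "cpoly n (\<lambda>z. c)"
| cpoly_var_mult: "cpoly n F \<Longrightarrow> cpoly (Suc n) (\<lambda>z. z $ j * F z)"
| cpoly_add: "cpoly n F \<Longrightarrow> cpoly n G \<Longrightarrow> cpoly n (\<lambda>z. F z + G z)"

lemma cpoly_Suc: "cpoly n F \<Longrightarrow> cpoly (Suc n) F"
  by (induction rule: cpoly.induct) (auto intro: cpoly.intros)

lemma cpoly_mono: "cpoly n F \<Longrightarrow> n \<le> m \<Longrightarrow> cpoly m F"
  by (induction m) (auto simp: le_Suc_eq intro: cpoly_Suc)

lemma cpoly_cmult: "cpoly n F \<Longrightarrow> cpoly n (\<lambda>z. c * F z)"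
proof (induction rule: cpoly.induct)
  case (cpoly_var_mult n F j)
  from cpoly.cpoly_var_mult[OF cpoly_var_mult.IH, of j] show ?case by (simp add: mult.left_commute)
qed (auto intro: cpoly.intros simp: distrib_left)

lemma cpoly_diff: "cpoly n F \<Longrightarrow> cpoly n G \<Longrightarrow> cpoly n (\<lambda>z. F z - G z)"
  using cpoly_add[OF _ cpoly_cmult[of n G "-1"], of F] by simp

lemma cpoly_mult: "cpoly n F \<Longrightarrow> cpoly m G \<Longrightarrow> cpoly (n + m) (\<lambda>z. F z * G z)"
proof (induction rule: cpoly.induct)
  case (cpoly_const n c)
  show ?case by (rule cpoly_mono[OF cpoly_cmult[OF cpoly_const]]) simp
next
  case (cpoly_var_mult n F j)
  from cpoly.cpoly_var_mult[OF cpoly_var_mult.IH[OF cpoly_var_mult.prems], of j]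
  show ?case by (simp add: mult_ac)
next
  case (cpoly_add n F G')
  then show ?case by (simp add: distrib_right cpoly.cpoly_add)
qed

lemma cpoly_sum: "(\<And>i. i \<in> I \<Longrightarrow> cpoly n (F i)) \<Longrightarrow> cpoly n (\<lambda>z. \<Sum>i\<in>I. F i z)"
  by (induction I rule: infinite_finite_induct) (auto intro: cpoly.intros)

lemma cpoly_power_var: "cpoly k (\<lambda>z. z $ j ^ k)"
  by (induction k) (auto intro: cpoly_const[of 0 1, simplified] cpoly_var_mult cpoly_const)

lemma cpoly_monomial: "finite I \<Longrightarrow> cpoly (\<Sum>i\<in>I. \<alpha> i) (\<lambda>z. \<Prod>i\<in>I. z $ i ^ \<alpha> i)"
  by (induction I rule: finite_induct) (auto intro: cpoly_const cpoly_mult cpoly_power_var)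

lemma cpoly_growth:
  "cpoly n F \<Longrightarrow> \<exists>C\<ge>0. \<forall>z. norm (F z) \<le> C * (1 + norm z) ^ n"
proof (induction rule: cpoly.induct)
  case (cpoly_const n c)
  have "norm c * 1 \<le> norm c * (1 + norm z) ^ n" for z :: "complex^'a" by (intro mult_left_mono one_le_power) auto
  then show ?case by (intro exI[of _ "norm c"]) auto
next
  case (cpoly_var_mult n F j)
  then obtain C where C: "C \<ge> 0" "\<And>z. norm (F z) \<le> C * (1 + norm z) ^ n" by blast
  have "norm (z $ j * F z) \<le> C * (1 + norm z) ^ Suc n" for z
  proof -
    have "norm (z $ j * F z) \<le> (1 + norm z) * (C * (1 + norm z) ^ n)"
      unfolding norm_mult using C Finite_Cartesian_Product.norm_nth_le[of z j] by (intro mult_mono) auto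
    then show ?thesis by (simp add: mult_ac)
  qed
  with C(1) show ?case by blast
next
  case (cpoly_add n F G)
  then obtain C D where C: "C \<ge> 0" "\<And>z. norm (F z) \<le> C * (1 + norm z) ^ n"
    "D \<ge> 0" "\<And>z. norm (G z) \<le> D * (1 + norm z) ^ n" by metis
  have "norm (F z + G z) \<le> (C + D) * (1 + norm z) ^ n" for z
    using C(2)[of z] C(4)[of z] norm_triangle_ineq[of "F z" "G z"] by (simp add: distrib_right)
  with C show ?case by (intro exI[of _ "C + D"]) auto
qed

text \<open>Holomorphy in several variables: the real derivative is complex linear, with the complex
  partials \<open>dF j\<close> as coefficients.\<close>

definition is_cgrad :: "(complex ^ 'd \<Rightarrow> complex) \<Rightarrow> ('d \<Rightarrow> complex ^ 'd \<Rightarrow> complex) \<Rightarrow> bool" where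
  "is_cgrad F dF \<longleftrightarrow> (\<forall>z. (F has_derivative (\<lambda>h. \<Sum>j\<in>UNIV. dF j z * h $ j)) (at z))"

text \<open>The partials keep the bound \<open>n\<close> instead of \<open>n - 1\<close>, which is
  harmless: the rate in \<open>M_growth\<close> comes from \<open>F\<close> itself, and in the
  divergence the product with a coordinate has degree \<open>n + 1\<close> anyway.\<close>

lemma cpoly_cgrad: "cpoly n F \<Longrightarrow> \<exists>dF. (\<forall>j. cpoly n (dF j)) \<and> is_cgrad F dF"
proof (induction rule: cpoly.induct)
  case (cpoly_const n c)
  show ?case by (intro exI[of _ "\<lambda>j z. 0"]) (auto simp: is_cgrad_def intro: cpoly.intros)
next
  case (cpoly_var_mult n F i)
  then obtain dF where dF: "\<And>j. cpoly n (dF j)" "is_cgrad F dF" by blast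
  define dG where "dG j z = z $ i * dF j z + (if j = i then 1 else 0) * F z" for j z
  have "cpoly (Suc n) (dG j)" for j
    unfolding dG_def
    by (intro cpoly_add cpoly.cpoly_var_mult dF cpoly_cmult cpoly_Suc[OF cpoly_var_mult.hyps])
  moreover have "is_cgrad (\<lambda>z. z $ i * F z) dG"
    unfolding is_cgrad_def
  proof
    fix z
    have "((\<lambda>z. z $ i * F z) has_derivative (\<lambda>h. z $ i * (\<Sum>j\<in>UNIV. dF j z * h $ j) + h $ i * F z)) (at z)"
      using dF(2) unfolding is_cgrad_def
      by (auto intro!: has_derivative_mult bounded_linear.has_derivative[OF bounded_linear_vec_nth])
    moreover have "(\<Sum>j\<in>UNIV. dG j z * h $ j) = z $ i * (\<Sum>j\<in>UNIV. dF j z * h $ j) + h $ i * F z" for h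
    proof -
      have "dG j z * h $ j = z $ i * (dF j z * h $ j) + (if j = i then h $ j * F z else 0)" for j
        by (simp add: dG_def algebra_simps)
      then show ?thesis by (simp add: sum.distrib sum_distrib_left)
    qed
    ultimately show "((\<lambda>z. z $ i * F z) has_derivative (\<lambda>h. \<Sum>j\<in>UNIV. dG j z * h $ j)) (at z)" by simp
  qed
  ultimately show ?case by blast
next
  case (cpoly_add n F G)
  then obtain dF dG where "\<And>j. cpoly n (dF j)" "is_cgrad F dF" "\<And>j. cpoly n (dG j)" "is_cgrad G dG" by metis
  then show ?case
    by (intro exI[of _ "\<lambda>j z. dF j z + dG j z"])
       (auto simp: is_cgrad_def distrib_right sum.distrib intro!: cpoly.cpoly_add has_derivative_add)
qed

lemma is_cgrad_continuous: "is_cgrad F dF \<Longrightarrow> continuous_on UNIV F"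
  unfolding is_cgrad_def
  by (intro continuous_at_imp_continuous_on ballI) (blast intro: has_derivative_continuous)

lemma cpoly_tame: "cpoly n F \<Longrightarrow> tame F"
  by (metis cpoly_growth cpoly_cgrad tameI borel_measurable_continuous_onI is_cgrad_continuous)

section \<open>Holomorphic extensions of real polynomials\<close>

definition cvec :: "real ^ 'd \<Rightarrow> complex ^ 'd" where
  "cvec x = (\<chi> i. complex_of_real (x $ i))"

lemma cvec_nth [simp]: "cvec x $ i = complex_of_real (x $ i)"
  by (simp add: cvec_def)

lemma bounded_linear_cvec: "bounded_linear cvec"
  by (rule linear_conv_bounded_linear[THEN iffD1])
    (rule linearI; simp add: vec_eq_iff scaleR_conv_of_real[where 'a=complex])

lemma tame_cvec: "tame cvec"
  by (rule tame_linear[OF bounded_linear_cvec])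

definition extends_to :: "(real ^ 'd \<Rightarrow> real) \<Rightarrow> (complex ^ 'd \<Rightarrow> complex) \<Rightarrow> bool" where
  "extends_to f F \<longleftrightarrow> (\<forall>x. F (cvec x) = complex_of_real (f x))"

lemma polynomial_degree_le_extension:
  assumes "polynomial_degree_le n f"
  obtains F where "cpoly n F" "extends_to f F"
proof -
  obtain c where c: "\<And>x. f x = (\<Sum>\<alpha> | (\<Sum>i\<in>UNIV. \<alpha> i) \<le> n. c \<alpha> * (\<Prod>i\<in>UNIV. x $ i ^ \<alpha> i))"
    using assms unfolding polynomial_degree_le_def by blast
  define F where "F z = (\<Sum>\<alpha> | (\<Sum>i\<in>UNIV. \<alpha> i) \<le> n. complex_of_real (c \<alpha>) * (\<Prod>i\<in>UNIV. z $ i ^ \<alpha> i))" for z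
  have "cpoly n F" unfolding F_def
    by (intro cpoly_sum cpoly_cmult) (auto intro: cpoly_mono[OF cpoly_monomial])
  moreover have "extends_to f F" by (simp add: extends_to_def F_def c)
  ultimately show ?thesis using that by blast
qed

lemma sum_mult_axis: "(\<Sum>j\<in>UNIV. f j * axis i c $ j) = (f i * c :: 'a::comm_ring_1)"
proof -
  have "f j * axis i c $ j = (if j = i then f j * c else 0)" for j by (simp add: axis_def)
  then show ?thesis by simp
qed

text \<open>\<open>F\<close> is real on real points, so the imaginary part of its derivative along
  \<open>cvec\<close> is the derivative of the zero function; evaluation on \<open>axis j 1\<close>
  shows that each \<open>dF j\<close> is real there. The second claim allows iteration to higher
  derivatives.\<close>

lemma extends_to_grad:
  assumes "extends_to f F" "is_cgrad F dF"
  shows "(f has_derivative (\<lambda>h. \<Sum>j\<in>UNIV. Re (dF j (cvec x)) * h $ j)) (at x)"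
    and "extends_to (\<lambda>x. Re (dF j (cvec x))) (dF j)"
proof -
  have d: "((\<lambda>x. F (cvec x)) has_derivative (\<lambda>h. \<Sum>j\<in>UNIV. dF j (cvec x) * cvec h $ j)) (at x)" for x
    by (rule has_derivative_compose[OF bounded_linear_imp_has_derivative[OF bounded_linear_cvec]])
       (use assms(2) in \<open>auto simp: is_cgrad_def\<close>)
  have e: "F (cvec x) = complex_of_real (f x)" for x using assms(1) by (auto simp: extends_to_def)
  show "(f has_derivative (\<lambda>h. \<Sum>j\<in>UNIV. Re (dF j (cvec x)) * h $ j)) (at x)"
    using bounded_linear.has_derivative[OF bounded_linear_Re d[of x]] unfolding e by simp
  have "((\<lambda>x. 0) has_derivative (\<lambda>h. \<Sum>j\<in>UNIV. Im (dF j (cvec x)) * h $ j)) (at x)" for x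
    using bounded_linear.has_derivative[OF bounded_linear_Im d[of x]] unfolding e by simp
  then have z: "(\<lambda>h. \<Sum>j\<in>UNIV. Im (dF j (cvec x)) * h $ j) = (\<lambda>h. 0)" for x
    by (rule has_derivative_unique[OF _ has_derivative_const])
  have "Im (dF j (cvec x)) = 0" for x
    using fun_cong[OF z[of x], of "axis j 1"] by (simp add: sum_mult_axis)
  then show "extends_to (\<lambda>x. Re (dF j (cvec x))) (dF j)"
    by (simp add: extends_to_def complex_eq_iff)
qed

lemma extends_to_directional:
  assumes "extends_to f F" "is_cgrad F dF"
  shows "((\<lambda>t. f (x + t *\<^sub>R axis i 1)) has_real_derivative Re (dF i (cvec x))) (at 0)"
proof -
  have l: "((\<lambda>t::real. x + t *\<^sub>R axis i (1::real)) has_derivative (\<lambda>t. t *\<^sub>R axis i 1)) (at 0)"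
    by (auto intro!: derivative_eq_intros)
  have "((\<lambda>t. f (x + t *\<^sub>R axis i 1)) has_derivative (\<lambda>t. \<Sum>j\<in>UNIV. Re (dF j (cvec x)) * (t *\<^sub>R axis i 1) $ j)) (at 0)"
    by (rule has_derivative_compose[OF l]) (use extends_to_grad(1)[OF assms, of x] in simp)
  moreover have "(\<Sum>j\<in>UNIV. Re (dF j (cvec x)) * (t *\<^sub>R axis i 1) $ j) = Re (dF i (cvec x)) * t" for t :: real
    by (simp add: sum_mult_axis mult.left_commute[of _ t] sum_distrib_left[symmetric])
  ultimately show ?thesis
    by (simp add: has_field_derivative_def)
qed

lemma extends_to_partial_deriv:
  assumes "extends_to f F" "is_cgrad F dF"
  shows "partial_deriv i f x = Re (dF i (cvec x))"
  unfolding partial_deriv_def by (rule DERIV_imp_deriv[OF extends_to_directional[OF assms]])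

lemma extends_to_tame: "extends_to f F \<Longrightarrow> cpoly n F \<Longrightarrow> tame f"
proof -
  assume "extends_to f F" "cpoly n F"
  then have e: "f = (\<lambda>x. Re (F (cvec x)))" by (auto simp: extends_to_def)
  show ?thesis
    unfolding e
    by (rule tame_bounded_linear_comp[OF bounded_linear_Re tame_compose[OF cpoly_tame tame_cvec]]) fact
qed

section \<open>Gaussian integrals along complexified paths\<close>

text \<open>A point \<open>w\<close> of the product space carries the independent pair (X, Y),
  because \<open>gauss\<close> on pairs is the product weight.\<close>

definition zmap :: "real \<Rightarrow> real \<Rightarrow> (real ^ 'd) \<times> (real ^ 'd) \<Rightarrow> complex ^ 'd" where
  "zmap a b w = (\<chi> j. complex_of_real (a * fst w $ j) + \<i> * complex_of_real (b * snd w $ j))"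

lemma zmap_nth: "zmap a b w $ j = complex_of_real (a * fst w $ j) + \<i> * complex_of_real (b * snd w $ j)"
  by (simp add: zmap_def)

lemma bounded_linear_zmap: "bounded_linear (zmap a b)"
  by (rule linear_conv_bounded_linear[THEN iffD1])
    (rule linearI; simp add: vec_eq_iff zmap_nth scaleR_conv_of_real[where 'a=complex] algebra_simps)

lemma tame_zmap: "tame (zmap a b)"
  by (rule tame_linear[OF bounded_linear_zmap])

lemma norm_zmap_le: "norm (zmap a b w) \<le> (\<bar>a\<bar> + \<bar>b\<bar>) * norm w"
proof -
  have c: "norm (cvec x) = norm x" for x :: "real ^ 'a" by (simp add: norm_vec_def)
  have "zmap a b w = a *\<^sub>R cvec (fst w) + b *\<^sub>R (\<chi> j. \<i> * cvec (snd w) $ j)"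
    by (simp add: vec_eq_iff zmap_nth complex_eq_iff)
  then have "norm (zmap a b w) \<le> \<bar>a\<bar> * norm (cvec (fst w)) + \<bar>b\<bar> * norm (\<chi> j. \<i> * cvec (snd w) $ j)"
    by (metis norm_triangle_ineq norm_scaleR)
  also have "norm (\<chi> j. \<i> * cvec (snd w) $ j) = norm (cvec (snd w))" by (simp add: norm_vec_def norm_mult)
  also have "\<bar>a\<bar> * norm (cvec (fst w)) + \<bar>b\<bar> * norm (cvec (snd w)) \<le> \<bar>a\<bar> * norm w + \<bar>b\<bar> * norm w"
    unfolding c by (intro add_mono mult_left_mono norm_fst_le[of "fst w" "snd w", simplified] norm_snd_le[of "snd w" "fst w", simplified]) auto
  finally show ?thesis by (simp add: distrib_right)
qed

text \<open>Wirtinger gradient: \<open>A\<close> collects the \<open>\<partial>/\<partial>z\<close>, \<open>B\<close> the \<open>\<partial>/\<partial>(cnj z)\<close>.\<close>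
definition is_wgrad ::
  "(complex ^ 'd \<Rightarrow> complex) \<Rightarrow> ('d \<Rightarrow> complex ^ 'd \<Rightarrow> complex) \<Rightarrow> ('d \<Rightarrow> complex ^ 'd \<Rightarrow> complex) \<Rightarrow> bool" where
  "is_wgrad f A B \<longleftrightarrow> (\<forall>z. (f has_derivative (\<lambda>h. \<Sum>j\<in>UNIV. A j z * h $ j + B j z * cnj (h $ j))) (at z))"

definition tame_wgrad ::
  "(complex ^ 'd \<Rightarrow> complex) \<Rightarrow> ('d \<Rightarrow> complex ^ 'd \<Rightarrow> complex) \<Rightarrow> ('d \<Rightarrow> complex ^ 'd \<Rightarrow> complex) \<Rightarrow> bool" where
  "tame_wgrad f A B \<longleftrightarrow> is_wgrad f A B \<and> tame f \<and> (\<forall>j. tame (A j)) \<and> (\<forall>j. tame (B j))"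

lemma gint_pair_by_parts:
  fixes f :: "(real ^ 'd) \<times> (real ^ 'd) \<Rightarrow> complex"
  assumes "\<And>w. ((\<lambda>t. f (w + t *\<^sub>R (axis j 1, 0))) has_vector_derivative fx w) (at 0)"
    and "\<And>w. ((\<lambda>t. f (w + t *\<^sub>R (0, axis j 1))) has_vector_derivative fy w) (at 0)"
    and "tame f" "tame fx" "tame fy"
  shows "gint (\<lambda>w. (complex_of_real (a * fst w $ j) + \<i> * complex_of_real (b * snd w $ j)) * f w)
    = gint (\<lambda>w. complex_of_real a * fx w + \<i> * complex_of_real b * fy w)"
proof -
  have x: "gint (\<lambda>w. (fst w $ j) *\<^sub>R f w) = gint fx"
    using gint_by_parts[OF assms(1,3,4)] by (simp add: inner_prod_def inner_axis)
  have y: "gint (\<lambda>w. (snd w $ j) *\<^sub>R f w) = gint fy"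
    using gint_by_parts[OF assms(2,3,5)] by (simp add: inner_prod_def inner_axis)
  have tx: "tame (\<lambda>w::(real ^ 'd) \<times> (real ^ 'd). fst w $ j)"
    and ty: "tame (\<lambda>w::(real ^ 'd) \<times> (real ^ 'd). snd w $ j)"
    by (auto intro!: tame_linear bounded_linear_compose[OF bounded_linear_vec_nth] bounded_linear_fst bounded_linear_snd)
  have "gint (\<lambda>w. (complex_of_real (a * fst w $ j) + \<i> * complex_of_real (b * snd w $ j)) * f w)
    = gint (\<lambda>w. complex_of_real a * ((fst w $ j) *\<^sub>R f w) + (\<i> * complex_of_real b) * ((snd w $ j) *\<^sub>R f w))"
    by (simp add: scaleR_conv_of_real algebra_simps)
  also have "\<dots> = complex_of_real a * gint fx + (\<i> * complex_of_real b) * gint fy"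
    by (subst gint_add) (auto intro!: tame_mult tame_scaleR tx ty assms simp: gint_cmult x y simp del: mult_scaleR_right)
  also have "\<dots> = gint (\<lambda>w. complex_of_real a * fx w + \<i> * complex_of_real b * fy w)"
    by (subst gint_add) (auto intro!: tame_mult assms simp: gint_cmult)
  finally show ?thesis .
qed

text \<open>Moving x_j changes z_j and its conjugate both by a; moving y_j changes them by i b and
  by - i b. Hence the sum and the difference of the Wirtinger derivatives.\<close>

lemma zmap_directional:
  assumes "is_wgrad f A B"
  shows "((\<lambda>t. f (zmap a b (w + t *\<^sub>R (axis j 1, 0)))) has_vector_derivative
      complex_of_real a * (A j (zmap a b w) + B j (zmap a b w))) (at 0)" (is ?x)
    and "((\<lambda>t. f (zmap a b (w + t *\<^sub>R (0, axis j 1)))) has_vector_derivative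
      \<i> * complex_of_real b * (A j (zmap a b w) - B j (zmap a b w))) (at 0)" (is ?y)
proof -
  have d: "((\<lambda>t. f (zmap a b (w + t *\<^sub>R h))) has_derivative
     (\<lambda>t. \<Sum>k\<in>UNIV. A k (zmap a b w) * (t *\<^sub>R zmap a b h) $ k + B k (zmap a b w) * cnj ((t *\<^sub>R zmap a b h) $ k))) (at 0)" for h
  proof (rule has_derivative_compose[where f="\<lambda>t. zmap a b (w + t *\<^sub>R h)" and s=UNIV])
    have "(\<lambda>t. zmap a b (w + t *\<^sub>R h)) = (\<lambda>t. zmap a b w + t *\<^sub>R zmap a b h)"
      by (simp add: fun_eq_iff vec_eq_iff zmap_nth scaleR_conv_of_real[where 'a=complex] algebra_simps)
    then show "((\<lambda>t. zmap a b (w + t *\<^sub>R h)) has_derivative (\<lambda>t. t *\<^sub>R zmap a b h)) (at 0)"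
      by (auto intro!: derivative_eq_intros)
  qed (use assms in \<open>auto simp: is_wgrad_def\<close>)
  have zx: "zmap a b (axis j 1, 0) = axis j (complex_of_real a)"
    and zy: "zmap a b (0, axis j 1) = axis j (\<i> * complex_of_real b)"
    by (auto simp: vec_eq_iff zmap_nth axis_def)
  have s: "(\<Sum>k\<in>UNIV. A k z * (t *\<^sub>R axis j c) $ k + B k z * cnj ((t *\<^sub>R axis j c) $ k))
      = t *\<^sub>R (A j z * c + B j z * cnj c)" for z and t :: real and c
  proof -
    have "A k z * (t *\<^sub>R axis j c) $ k + B k z * cnj ((t *\<^sub>R axis j c) $ k)
      = (if k = j then t *\<^sub>R (A j z * c + B j z * cnj c) else 0)" for k
      by (simp add: axis_def scaleR_add_right)
    then show ?thesis by simp
  qed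
  show ?x ?y
    unfolding has_vector_derivative_def
    by (rule has_derivative_eq_rhs[OF d], unfold zx zy s, simp add: algebra_simps)+
qed

context
  fixes f :: "complex ^ 'd \<Rightarrow> complex" and A B :: "'d \<Rightarrow> complex ^ 'd \<Rightarrow> complex" and a b :: real
  assumes f: "tame_wgrad f A B" and a: "a \<noteq> 0" and b: "b \<noteq> 0"
begin

lemma tame_zmap_comp: "tame g \<Longrightarrow> tame (\<lambda>w. g (zmap a b w))"
  by (rule tame_compose[OF _ tame_zmap])

lemma tame_zmap_form: "tame (\<lambda>w. complex_of_real (c * fst w $ j) + \<i> * complex_of_real (d * snd w $ j))"
  using tame_linear[OF bounded_linear_compose[OF bounded_linear_vec_nth[of j] bounded_linear_zmap[of c d]]]
  by (simp add: zmap_nth)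

text \<open>The coefficients 1/a and -1/b make the two integrations by parts combine to (A + B) + (A
  - B), which cancels the antiholomorphic derivative.\<close>

lemma gint_wirtinger_by_parts:
  "gint (\<lambda>w. (complex_of_real (fst w $ j / a) + \<i> * complex_of_real (- snd w $ j / b)) * f (zmap a b w))
    = 2 * gint (\<lambda>w. A j (zmap a b w))"
proof -
  have t: "tame f" "tame (A j)" "tame (B j)" and g: "is_wgrad f A B" using f by (auto simp: tame_wgrad_def)
  have "gint (\<lambda>w. (complex_of_real ((1/a) * fst w $ j) + \<i> * complex_of_real ((-1/b) * snd w $ j)) * f (zmap a b w))
    = gint (\<lambda>w. complex_of_real (1/a) * (complex_of_real a * (A j (zmap a b w) + B j (zmap a b w)))
         + \<i> * complex_of_real (-1/b) * (\<i> * complex_of_real b * (A j (zmap a b w) - B j (zmap a b w))))"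
    by (rule gint_pair_by_parts[OF zmap_directional[OF g]])
       (intro tame_mult tame_add tame_diff tame_const tame_zmap_comp t)+
  also have "\<dots> = gint (\<lambda>w. 2 * A j (zmap a b w))"
    using a b by (intro arg_cong[where f=gint] ext) (simp add: field_simps)
  finally show ?thesis by (simp add: gint_cmult)
qed

text \<open>Both sides equal half of \<open>gint ((cmod L)\<^sup>2 * f) - (1/a\<^sup>2 + 1/b\<^sup>2) * gint f\<close>, where \<open>L\<close> is
  the linear form on the left.\<close>
lemma gint_wirtinger_swap:
  "gint (\<lambda>w. (complex_of_real (fst w $ j / a) + \<i> * complex_of_real (snd w $ j / b)) * A j (zmap a b w))
    = gint (\<lambda>w. (complex_of_real (fst w $ j / a) + \<i> * complex_of_real (- snd w $ j / b)) * B j (zmap a b w))"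
proof -
  have t: "tame f" "tame (A j)" "tame (B j)" and g: "is_wgrad f A B" using f by (auto simp: tame_wgrad_def)
  define M where "M e w = complex_of_real ((1/a) * fst w $ j) + \<i> * complex_of_real ((e/b) * snd w $ j)"
    for e and w :: "(real ^ 'd) \<times> (real ^ 'd)"
  have tM: "tame (M e)" for e unfolding M_def by (rule tame_zmap_form)
  \<comment> \<open>\<open>M 1\<close> and \<open>M (-1)\<close> are complex conjugates of each
    other. Integrating the outer factor by parts produces A (1 + e) + B (1 - e), so e = 1 isolates
    \<open>A j\<close> and e = -1 isolates \<open>B j\<close>, while the two left sides agree by
    commutativity.\<close>
  have main: "gint (\<lambda>w. M (-e) w * (M e w * f (zmap a b w)))
     = complex_of_real (1/a^2 + e^2/b^2) * gint (\<lambda>w. f (zmap a b w))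
       + gint (\<lambda>w. M e w * (A j (zmap a b w) * (1 + e) + B j (zmap a b w) * (1 - e)))" for e
  proof -
    have vx: "((\<lambda>t. M e (w + t *\<^sub>R (axis j 1, 0)) * f (zmap a b (w + t *\<^sub>R (axis j 1, 0)))) has_vector_derivative
        (M e w * (complex_of_real a * (A j (zmap a b w) + B j (zmap a b w))) + complex_of_real (1/a) * f (zmap a b w))) (at 0)" for w
    proof -
      have "((\<lambda>t. M e (w + t *\<^sub>R (axis j 1, 0))) has_vector_derivative complex_of_real (1/a)) (at 0)"
        unfolding M_def by (auto intro!: derivative_eq_intros)
      from has_vector_derivative_mult[OF this zmap_directional(1)[OF g, of a b w j]] show ?thesis
        by (simp add: zero_prod_def[symmetric])
    qed
    have vy: "((\<lambda>t. M e (w + t *\<^sub>R (0, axis j 1)) * f (zmap a b (w + t *\<^sub>R (0, axis j 1)))) has_vector_derivative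
        (M e w * (\<i> * complex_of_real b * (A j (zmap a b w) - B j (zmap a b w))) + \<i> * complex_of_real (e/b) * f (zmap a b w))) (at 0)" for w
    proof -
      have "((\<lambda>t. M e (w + t *\<^sub>R (0, axis j 1))) has_vector_derivative \<i> * complex_of_real (e/b)) (at 0)"
        unfolding M_def by (auto intro!: derivative_eq_intros)
      from has_vector_derivative_mult[OF this zmap_directional(2)[OF g, of a b w j]] show ?thesis
        by (simp add: zero_prod_def[symmetric])
    qed
    have "gint (\<lambda>w. M (-e) w * (M e w * f (zmap a b w)))
      = gint (\<lambda>w. complex_of_real (1/a) * (M e w * (complex_of_real a * (A j (zmap a b w) + B j (zmap a b w))) + complex_of_real (1/a) * f (zmap a b w))
         + \<i> * complex_of_real (- e/b) * (M e w * (\<i> * complex_of_real b * (A j (zmap a b w) - B j (zmap a b w))) + \<i> * complex_of_real (e/b) * f (zmap a b w)))"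
      unfolding M_def[of "-e"]
      by (rule gint_pair_by_parts[OF vx vy])
         (intro tame_mult tame_add tame_diff tame_const tame_zmap_comp t tM)+
    also have "\<dots> = gint (\<lambda>w. complex_of_real (1/a^2 + e^2/b^2) * f (zmap a b w)
        + M e w * (A j (zmap a b w) * (1 + e) + B j (zmap a b w) * (1 - e)))"
    proof (intro arg_cong[where f=gint] ext)
      fix w
      define u v where "u = A j (zmap a b w)" and "v = B j (zmap a b w)"
      have "complex_of_real (1/a) * (M e w * (complex_of_real a * (u + v)) + complex_of_real (1/a) * f (zmap a b w))
         + \<i> * complex_of_real (- e/b) * (M e w * (\<i> * complex_of_real b * (u - v)) + \<i> * complex_of_real (e/b) * f (zmap a b w))
        = (complex_of_real (1/a) * complex_of_real a) * (M e w * (u + v))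
        - (\<i> * \<i>) * (complex_of_real (1/b) * complex_of_real b) * (complex_of_real e * M e w * (u - v))
        + (complex_of_real (1/a) * complex_of_real (1/a) - (\<i> * \<i>) * complex_of_real (e/b) * complex_of_real (e/b)) * f (zmap a b w)"
        by (simp add: algebra_simps)
      also have "\<dots> = complex_of_real (1/a^2 + e^2/b^2) * f (zmap a b w) + M e w * (u * (1 + e) + v * (1 - e))"
        unfolding of_real_mult[symmetric] using a b by (simp add: algebra_simps power2_eq_square)
      finally show "complex_of_real (1/a) * (M e w * (complex_of_real a * (A j (zmap a b w) + B j (zmap a b w))) + complex_of_real (1/a) * f (zmap a b w))
         + \<i> * complex_of_real (- e/b) * (M e w * (\<i> * complex_of_real b * (A j (zmap a b w) - B j (zmap a b w))) + \<i> * complex_of_real (e/b) * f (zmap a b w))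
        = complex_of_real (1/a^2 + e^2/b^2) * f (zmap a b w) + M e w * (A j (zmap a b w) * (1 + e) + B j (zmap a b w) * (1 - e))"
        unfolding u_def v_def .
    qed
    also have "\<dots> = complex_of_real (1/a^2 + e^2/b^2) * gint (\<lambda>w. f (zmap a b w))
       + gint (\<lambda>w. M e w * (A j (zmap a b w) * (1 + e) + B j (zmap a b w) * (1 - e)))"
      by (subst gint_add) (auto simp: gint_cmult intro!: tame_mult tame_add tame_zmap_comp t tM)
    finally show ?thesis .
  qed
  have eq: "gint (\<lambda>w. M (-1) w * (M 1 w * f (zmap a b w))) = gint (\<lambda>w. M 1 w * (M (-1) w * f (zmap a b w)))"
    by (simp add: mult_ac)
  have "gint (\<lambda>w. M 1 w * (A j (zmap a b w) * 2)) = gint (\<lambda>w. M (-1) w * (B j (zmap a b w) * 2))"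
    using main[of 1] main[of "-1"] eq by simp
  then have "2 * gint (\<lambda>w. M 1 w * A j (zmap a b w)) = 2 * gint (\<lambda>w. M (-1) w * B j (zmap a b w))"
    unfolding gint_cmult[symmetric] by (simp add: mult_ac)
  then show ?thesis by (simp add: M_def)
qed

end

section \<open>The path of covariances and its evolution equation\<close>

definition al :: "real \<Rightarrow> real" where "al t = sqrt ((exp t + 1) / 2)"
definition be :: "real \<Rightarrow> real" where "be t = sqrt ((exp t - 1) / 2)"

lemma al_pos: "al t > 0" by (simp add: al_def add_pos_pos)
lemma be_pos: "t > 0 \<Longrightarrow> be t > 0" by (simp add: be_def)
lemma al_sq: "(al t)\<^sup>2 = (exp t + 1) / 2" by (simp add: al_def add_nonneg_nonneg)
lemma be_sq: "t \<ge> 0 \<Longrightarrow> (be t)\<^sup>2 = (exp t - 1) / 2" by (simp add: be_def)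

lemma al_deriv: "(al has_real_derivative exp t / (4 * al t)) (at t)"
proof -
  have "(exp t + 1) / 2 > 0" by (simp add: add_pos_pos)
  then show ?thesis unfolding al_def by (auto intro!: derivative_eq_intros simp: field_simps)
qed

lemma be_deriv: "t > 0 \<Longrightarrow> (be has_real_derivative exp t / (4 * be t)) (at t)"
proof -
  assume "t > 0"
  then have "(exp t - 1) / 2 > 0" by simp
  then show ?thesis unfolding be_def by (auto intro!: derivative_eq_intros simp: field_simps)
qed

lemma al_mono: "s \<le> t \<Longrightarrow> al s \<le> al t" by (simp add: al_def)
lemma be_mono: "s \<le> t \<Longrightarrow> be s \<le> be t" by (simp add: be_def)

lemma zmap_has_vector_derivative:
  assumes "t > 0"
  shows "((\<lambda>t. zmap (al t) (be t) w) has_vector_derivative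
    zmap (exp t / (4 * al t)) (exp t / (4 * be t)) w) (at t)"
proof -
  have z: "zmap a b w = a *\<^sub>R zmap 1 0 w + b *\<^sub>R zmap 0 1 w" for a b
    by (simp add: vec_eq_iff zmap_nth scaleR_conv_of_real[where 'a=complex] algebra_simps)
  show ?thesis
    unfolding z[of "al _"] z[of "exp t / _"]
    using has_vector_derivative_add[OF
        has_vector_derivative_scaleR[OF al_deriv[of t] has_vector_derivative_const[of "zmap 1 0 w"]]
        has_vector_derivative_scaleR[OF be_deriv[OF assms] has_vector_derivative_const[of "zmap 0 1 w"]]]
    by simp
qed

text \<open>Chain rule under the integral sign, with \<open>V\<close> the velocity of the path
  \<open>Z\<close>. The formula still contains the antiholomorphic derivatives \<open>B j\<close>,
  which the next theorem removes.\<close>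

lemma gint_zmap_has_vector_derivative_aux:
  fixes f :: "complex ^ 'd \<Rightarrow> complex"
  assumes f: "tame_wgrad f A B" and t: "t > 0"
  defines "Z \<equiv> \<lambda>t. zmap (al t) (be t)"
    and "V \<equiv> \<lambda>t. zmap (exp t / (4 * al t)) (exp t / (4 * be t))"
  shows "((\<lambda>t. gint (\<lambda>w. f (Z t w))) has_vector_derivative
    gint (\<lambda>w. \<Sum>j\<in>UNIV. A j (Z t w) * V t w $ j + B j (Z t w) * cnj (V t w $ j))) (at t)"
proof -
  have tf: "tame f" "\<And>j. tame (A j)" "\<And>j. tame (B j)" and g: "is_wgrad f A B"
    using f by (auto simp: tame_wgrad_def)
  define D where "D t w = (\<Sum>j\<in>UNIV. A j (Z t w) * V t w $ j + B j (Z t w) * cnj (V t w $ j))" for t w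
  define S where "S z = (\<Sum>j\<in>UNIV. norm (A j z) + norm (B j z))" for z
  have S0: "S z \<ge> 0" for z unfolding S_def by (intro sum_nonneg) auto
  have tS: "tame S" unfolding S_def by (intro tame_sum tame_add tame_norm tf)
  obtain C k where C: "C \<ge> 0" "\<And>z. norm (S z) \<le> C * (1 + norm z) ^ k" using tameE[OF tS] by metis
  have tD: "tame (D t)" for t
  proof -
    have "tame (\<lambda>w. V t w $ j)" "tame (\<lambda>w. cnj (V t w $ j))" for j
      unfolding V_def
      by (intro tame_linear bounded_linear_compose[OF bounded_linear_vec_nth] bounded_linear_zmap
        bounded_linear_compose[OF bounded_linear_cnj])+
    then show ?thesis unfolding D_def Z_def
      by (intro tame_sum tame_add tame_mult tame_compose[OF _ tame_zmap] tf)
  qed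
  \<comment> \<open>On (t/2, 2t) the path stays away from time 0, where the velocity blows up.
    Monotonicity of \<open>al\<close> and \<open>be\<close> makes \<open>K\<close> and
    \<open>K'\<close> uniform bounds for position and velocity relative to |w|.\<close>
  define K where "K = al (2*t) + be (2*t)"
  define K' where "K' = exp (2*t) / (4 * al (t/2)) + exp (2*t) / (4 * be (t/2))"
  define H where "H w = C * (1 + K * norm w) ^ k * (K' * norm w)" for w :: "(real^'d) \<times> (real^'d)"
  have "((\<lambda>t. \<integral>w. gauss w *\<^sub>R f (Z t w) \<partial>lborel) has_vector_derivative (\<integral>w. gauss w *\<^sub>R D t w \<partial>lborel)) (at t)"
  proof (rule has_vector_derivative_integral[where a="t/2" and b="2*t" and H="\<lambda>w. gauss w *\<^sub>R H w"])
    show "t \<in> {t/2<..<2*t}" using t by auto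
    fix s w assume s: "s \<in> {t/2<..<2*t}"
    then have s0: "s > 0" using t by auto
    have "((\<lambda>s. f (Z s w)) has_derivative (\<lambda>h. \<Sum>j\<in>UNIV. A j (Z s w) * (h *\<^sub>R V s w) $ j + B j (Z s w) * cnj ((h *\<^sub>R V s w) $ j))) (at s)"
    proof (rule has_derivative_compose[where f="\<lambda>s. Z s w" and s=UNIV])
      show "((\<lambda>s. Z s w) has_derivative (\<lambda>h. h *\<^sub>R V s w)) (at s)"
        using zmap_has_vector_derivative[OF s0, of w] by (simp add: has_vector_derivative_def Z_def V_def)
    qed (use g in \<open>auto simp: is_wgrad_def\<close>)
    moreover have "(\<Sum>j\<in>UNIV. A j (Z s w) * (h *\<^sub>R V s w) $ j + B j (Z s w) * cnj ((h *\<^sub>R V s w) $ j)) = h *\<^sub>R D s w" for h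
      unfolding D_def scaleR_sum_right by (intro sum.cong refl) (simp add: scaleR_add_right)
    ultimately have "((\<lambda>s. f (Z s w)) has_vector_derivative D s w) (at s)"
      by (simp add: has_vector_derivative_def)
    then show "((\<lambda>s. gauss w *\<^sub>R f (Z s w)) has_vector_derivative gauss w *\<^sub>R D s w) (at s)"
      by (auto intro!: derivative_eq_intros)
    have K: "norm (Z s w) \<le> K * norm w"
    proof -
      have "\<bar>al s\<bar> + \<bar>be s\<bar> \<le> K"
        unfolding K_def using al_mono[of s "2*t"] be_mono[of s "2*t"] al_pos[of s] be_pos[OF s0] s by simp
      then show ?thesis unfolding Z_def using norm_zmap_le[of "al s" "be s" w]
        by (meson mult_right_mono norm_ge_zero order_trans)
    qed
    have K': "norm (V s w) \<le> K' * norm w"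
    proof -
      have "exp s / (4 * al s) \<le> exp (2*t) / (4 * al (t/2))"
        by (rule frac_le) (use s al_mono[of "t/2" s] al_pos in auto)
      moreover have "exp s / (4 * be s) \<le> exp (2*t) / (4 * be (t/2))"
        by (rule frac_le) (use s t be_mono[of "t/2" s] be_pos in auto)
      ultimately have "\<bar>exp s / (4 * al s)\<bar> + \<bar>exp s / (4 * be s)\<bar> \<le> K'"
        unfolding K'_def using al_pos[of s] be_pos[OF s0] by simp
      then show ?thesis unfolding V_def using norm_zmap_le[of "exp s / (4 * al s)" "exp s / (4 * be s)" w]
        by (meson mult_right_mono norm_ge_zero order_trans)
    qed
    have "norm (D s w) \<le> (\<Sum>j\<in>UNIV. (norm (A j (Z s w)) + norm (B j (Z s w))) * norm (V s w))"
      unfolding D_def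
    proof (rule sum_norm_le)
      fix j
      have "norm (A j (Z s w) * V s w $ j + B j (Z s w) * cnj (V s w $ j))
         \<le> norm (A j (Z s w)) * norm (V s w $ j) + norm (B j (Z s w)) * norm (V s w $ j)"
        by (metis complex_mod_cnj norm_mult norm_triangle_ineq)
      also have "\<dots> \<le> norm (A j (Z s w)) * norm (V s w) + norm (B j (Z s w)) * norm (V s w)"
        by (intro add_mono mult_left_mono Finite_Cartesian_Product.norm_nth_le) auto
      finally show "norm (A j (Z s w) * V s w $ j + B j (Z s w) * cnj (V s w $ j))
         \<le> (norm (A j (Z s w)) + norm (B j (Z s w))) * norm (V s w)" by (simp add: distrib_right)
    qed
    also have "\<dots> = S (Z s w) * norm (V s w)" by (simp add: S_def sum_distrib_right)
    also have "\<dots> \<le> (C * (1 + K * norm w) ^ k) * (K' * norm w)"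
    proof (rule mult_mono[OF _ K'])
      have "S (Z s w) \<le> C * (1 + norm (Z s w)) ^ k" using C(2)[of "Z s w"] S0[of "Z s w"] by simp
      also have "\<dots> \<le> C * (1 + K * norm w) ^ k"
        using C(1) K by (intro mult_left_mono power_mono) auto
      finally show "S (Z s w) \<le> C * (1 + K * norm w) ^ k" .
      have "K \<ge> 0" unfolding K_def using al_pos[of "2*t"] be_pos[of "2*t"] t by simp
      then show "0 \<le> C * (1 + K * norm w) ^ k" using C(1) by (intro mult_nonneg_nonneg zero_le_power) auto
    qed simp
    finally show "norm (gauss w *\<^sub>R D s w) \<le> gauss w *\<^sub>R H w"
      by (simp add: H_def mult_left_mono)
  next
    show "integrable lborel (\<lambda>w. gauss w *\<^sub>R f (Z s w))" for s
      unfolding Z_def by (intro integrable_tame_gauss tame_compose[OF tf(1) tame_zmap])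
    have "tame H" unfolding H_def
      by (intro tame_mult tame_power tame_add tame_const tame_norm tame_linear bounded_linear_ident)
    then show "integrable lborel (\<lambda>w. gauss w *\<^sub>R H w)" by (rule integrable_tame_gauss)
    show "(\<lambda>w. gauss w *\<^sub>R D t w) \<in> borel_measurable lborel" using tameD[OF tD[of t]] by simp
  qed
  then show ?thesis by (simp add: gint_def D_def)
qed

text \<open>The velocity and its conjugate are exp t / 4 times the linear forms \<open>L 1 j\<close>
  and \<open>L (-1) j\<close>. By the swap identity the term with \<open>B j\<close> equals the one
  with \<open>A j\<close>, and a further integration by parts turns \<open>L (-1) j\<close> times
  \<open>A j\<close> into 2 \<open>AA j j\<close>. What remains is the holomorphic operator z . d -
  d . d applied to \<open>f\<close>.\<close>

theorem gint_zmap_has_vector_derivative: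
  fixes f :: "complex ^ 'd \<Rightarrow> complex"
  assumes f: "tame_wgrad f A B" and A: "\<And>j. tame_wgrad (A j) (AA j) (AB j)" and t: "t > 0"
  defines "Z \<equiv> zmap (al t) (be t)"
  shows "((\<lambda>t. gint (\<lambda>w. f (zmap (al t) (be t) w))) has_vector_derivative
    gint (\<lambda>w. \<Sum>j\<in>UNIV. Z w $ j * A j (Z w) - AA j j (Z w))) (at t)"
proof -
  have tf: "tame f" "\<And>j. tame (A j)" "\<And>j. tame (B j)" "\<And>j. tame (AA j j)"
    using f A by (auto simp: tame_wgrad_def)
  note tz = tame_compose[OF _ tame_zmap]
  let ?a = "al t" and ?b = "be t"
  have a: "?a \<noteq> 0" and b: "?b \<noteq> 0" using al_pos[of t] be_pos[OF t] by auto
  define V :: "(real^'d) \<times> (real^'d) \<Rightarrow> complex^'d" where "V = zmap (exp t / (4 * ?a)) (exp t / (4 * ?b))"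
  define L where "L e j w = complex_of_real (fst w $ j / ?a) + \<i> * complex_of_real (e * snd w $ j / ?b)" for e j and w :: "(real^'d) \<times> (real^'d)"
  have tL: "tame (L e j)" for e j
    using tame_linear[OF bounded_linear_compose[OF bounded_linear_vec_nth[of j] bounded_linear_zmap[of "1/?a" "e/?b"]]]
    by (simp add: zmap_nth L_def[abs_def])
  have V: "V w $ j = (exp t / 4) * L 1 j w" "cnj (V w $ j) = (exp t / 4) * L (-1) j w" for w j
    by (simp_all add: V_def zmap_nth L_def algebra_simps)
  have swap: "gint (\<lambda>w. L 1 j w * A j (Z w)) = gint (\<lambda>w. L (-1) j w * B j (Z w))" for j
    using gint_wirtinger_swap[OF f a b, of j] by (simp add: L_def Z_def)
  have ibp: "gint (\<lambda>w. AA j j (Z w)) = gint (\<lambda>w. L (-1) j w * A j (Z w)) / 2" for j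
    using gint_wirtinger_by_parts[OF A[of j] a b, of j] by (simp add: L_def Z_def)
  \<comment> \<open>Both scalar identities are 2 a^2 - 1 = exp t = 2 b^2 + 1, divided by 2 a and by
    2 b.\<close>
  have half: "Z w $ j - L (-1) j w / 2 = (exp t / 2) * L 1 j w" for w j
  proof -
    have "?a - 1 / (2 * ?a) = (exp t / 2) / ?a" "?b + 1 / (2 * ?b) = (exp t / 2) / ?b"
      using a b al_sq[of t] be_sq[of t] t by (auto simp: field_simps power2_eq_square)
    then have "(?a - 1 / (2 * ?a)) * fst w $ j = (exp t / 2) / ?a * fst w $ j"
        "(?b + 1 / (2 * ?b)) * snd w $ j = (exp t / 2) / ?b * snd w $ j" by simp_all
    then show ?thesis by (auto simp: complex_eq_iff Z_def zmap_nth L_def algebra_simps)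
  qed
  have "gint (\<lambda>w. \<Sum>j\<in>UNIV. A j (Z w) * V w $ j + B j (Z w) * cnj (V w $ j))
    = (\<Sum>j\<in>UNIV. gint (\<lambda>w. (exp t / 4) * (L 1 j w * A j (Z w)) + (exp t / 4) * (L (-1) j w * B j (Z w))))"
  proof -
    have "tame (\<lambda>w. V w $ j)" "tame (\<lambda>w. cnj (V w $ j))" for j
      unfolding V_def
      by (intro tame_linear bounded_linear_compose[OF bounded_linear_vec_nth] bounded_linear_zmap
        bounded_linear_compose[OF bounded_linear_cnj])+
    then have "gint (\<lambda>w. \<Sum>j\<in>UNIV. A j (Z w) * V w $ j + B j (Z w) * cnj (V w $ j))
      = (\<Sum>j\<in>UNIV. gint (\<lambda>w. A j (Z w) * V w $ j + B j (Z w) * cnj (V w $ j)))"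
      unfolding Z_def by (intro gint_sum tame_add tame_mult tz tf)
    moreover have "A j (Z w) * V w $ j + B j (Z w) * cnj (V w $ j)
      = (exp t / 4) * (L 1 j w * A j (Z w)) + (exp t / 4) * (L (-1) j w * B j (Z w))" for j w
      unfolding V(2) unfolding V(1) by (simp only: mult_ac)
    ultimately show ?thesis by (simp only:)
  qed
  also have "\<dots> = (\<Sum>j\<in>UNIV. (exp t / 2) * gint (\<lambda>w. L 1 j w * A j (Z w)))"
  proof (rule sum.cong[OF refl])
    fix j
    have "gint (\<lambda>w. (exp t / 4) * (L 1 j w * A j (Z w)) + (exp t / 4) * (L (-1) j w * B j (Z w)))
      = (exp t / 4) * gint (\<lambda>w. L 1 j w * A j (Z w)) + (exp t / 4) * gint (\<lambda>w. L (-1) j w * B j (Z w))"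
      unfolding gint_cmult[symmetric] Z_def
      by (rule gint_add) (intro tame_mult tz tf tL tame_const)+
    then show "gint (\<lambda>w. (exp t / 4) * (L 1 j w * A j (Z w)) + (exp t / 4) * (L (-1) j w * B j (Z w)))
      = (exp t / 2) * gint (\<lambda>w. L 1 j w * A j (Z w))"
      unfolding swap[symmetric] by simp
  qed
  also have "\<dots> = (\<Sum>j\<in>UNIV. gint (\<lambda>w. Z w $ j * A j (Z w)) - gint (\<lambda>w. AA j j (Z w)))"
  proof (rule sum.cong[OF refl])
    fix j
    have "(exp t / 2) * gint (\<lambda>w. L 1 j w * A j (Z w)) = gint (\<lambda>w. (Z w $ j - L (-1) j w / 2) * A j (Z w))"
      unfolding half by (simp add: gint_cmult[symmetric] mult.assoc)
    also have "\<dots> = gint (\<lambda>w. Z w $ j * A j (Z w) - (1/2) * (L (-1) j w * A j (Z w)))"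
      by (simp add: algebra_simps)
    also have "\<dots> = gint (\<lambda>w. Z w $ j * A j (Z w)) - gint (\<lambda>w. (1/2) * (L (-1) j w * A j (Z w)))"
    proof (rule gint_diff)
      have "tame (\<lambda>w. Z w $ j)" unfolding Z_def
        by (intro tame_linear bounded_linear_compose[OF bounded_linear_vec_nth] bounded_linear_zmap)
      then show "tame (\<lambda>w. Z w $ j * A j (Z w))" unfolding Z_def by (rule tame_mult[OF _ tz[OF tf(2)]])
      show "tame (\<lambda>w. (1/2) * (L (-1) j w * A j (Z w)))" unfolding Z_def by (intro tame_mult tz tf tL tame_const)
    qed
    finally show "(exp t / 2) * gint (\<lambda>w. L 1 j w * A j (Z w))
      = gint (\<lambda>w. Z w $ j * A j (Z w)) - gint (\<lambda>w. AA j j (Z w))"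
      unfolding ibp gint_cmult by simp
  qed
  also have "\<dots> = gint (\<lambda>w. \<Sum>j\<in>UNIV. Z w $ j * A j (Z w) - AA j j (Z w))"
  proof -
    have z: "tame (\<lambda>w. Z w $ j)" for j unfolding Z_def
      by (intro tame_linear bounded_linear_compose[OF bounded_linear_vec_nth] bounded_linear_zmap)
    show ?thesis
      by (subst gint_sum, (intro tame_diff tame_mult z; simp add: Z_def tz tf), rule sum.cong[OF refl],
          subst gint_diff, (intro tame_mult z; simp add: Z_def tz tf), simp_all add: Z_def tz tf)
  qed
  finally show ?thesis
    using gint_zmap_has_vector_derivative_aux[OF f t] by (simp add: Z_def V_def)
qed

section \<open>Powers of regularised polynomials\<close>

lemma tame_powr:
  fixes \<sigma> :: real
  assumes f: "tame f" and "\<delta> > 0" and ge: "\<And>x. f x \<ge> \<delta>"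
  shows "tame (\<lambda>x. f x powr \<sigma>)"
proof -
  let ?m = "nat \<lceil>\<sigma>\<rceil>"
  have "tame (\<lambda>x. \<delta> powr \<sigma> + (1 + f x) ^ ?m)" by (intro tame_add tame_power tame_const f)
  then show ?thesis
  proof (rule tame_mono)
    show "(\<lambda>x. f x powr \<sigma>) \<in> borel_measurable borel" using tameD[OF f] by measurable
    fix x
    have pos: "f x > 0" using ge[of x] \<open>\<delta> > 0\<close> by simp
    have "f x powr \<sigma> \<le> \<delta> powr \<sigma> + (1 + f x) ^ ?m"
    proof (cases "\<sigma> \<ge> 0")
      case True
      then have "f x powr \<sigma> \<le> (1 + f x) powr \<sigma>" using pos by (intro powr_mono2) auto
      also have "\<dots> \<le> (1 + f x) powr real ?m" using pos by (intro powr_mono) linarith+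
      also have "\<dots> = (1 + f x) ^ ?m" using pos by (simp add: powr_realpow)
      finally show ?thesis by (simp add: add_increasing)
    next
      case False
      then have "f x powr \<sigma> \<le> \<delta> powr \<sigma>" using ge[of x] \<open>\<delta> > 0\<close> by (intro powr_mono2') auto
      moreover have "(1 + f x) ^ ?m \<ge> 0" using pos by simp
      ultimately show ?thesis by linarith
    qed
    moreover have "(1 + f x) ^ ?m \<ge> 0" using pos by simp
    ultimately show "norm (f x powr \<sigma>) \<le> norm (\<delta> powr \<sigma> + (1 + f x) ^ ?m)" by simp
  qed
qed

lemma tame_of_real: "tame f \<Longrightarrow> tame (\<lambda>x. complex_of_real (f x))"
  by (rule tame_mono[of f]) (auto dest: tameD)

lemma tame_cnj: "tame f \<Longrightarrow> tame (\<lambda>x. cnj (f x))"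
  by (rule tame_bounded_linear_comp[OF bounded_linear_cnj])

lemma tame_Re: "tame f \<Longrightarrow> tame (\<lambda>x. Re (f x))"
  by (rule tame_bounded_linear_comp[OF bounded_linear_Re])

lemma tame_wgrad_add:
  assumes "tame_wgrad f A B" "tame_wgrad g A' B'"
  shows "tame_wgrad (\<lambda>z. f z + g z) (\<lambda>j z. A j z + A' j z) (\<lambda>j z. B j z + B' j z)"
  unfolding tame_wgrad_def is_wgrad_def
proof (intro conjI allI)
  fix z
  have "((\<lambda>z. f z + g z) has_derivative (\<lambda>h. (\<Sum>j\<in>UNIV. A j z * h $ j + B j z * cnj (h $ j)) + (\<Sum>j\<in>UNIV. A' j z * h $ j + B' j z * cnj (h $ j)))) (at z)"
    using assms unfolding tame_wgrad_def is_wgrad_def by (intro has_derivative_add) auto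
  then show "((\<lambda>z. f z + g z) has_derivative (\<lambda>h. \<Sum>j\<in>UNIV. (A j z + A' j z) * h $ j + (B j z + B' j z) * cnj (h $ j))) (at z)"
    unfolding sum.distrib[symmetric] by (simp add: algebra_simps)
qed (use assms in \<open>auto simp: tame_wgrad_def\<close>)

lemma tame_wgrad_cmult:
  assumes "tame_wgrad f A B"
  shows "tame_wgrad (\<lambda>z. c * f z) (\<lambda>j z. c * A j z) (\<lambda>j z. c * B j z)"
  unfolding tame_wgrad_def is_wgrad_def
proof (intro conjI allI)
  fix z
  have "((\<lambda>z. c * f z) has_derivative (\<lambda>h. c * (\<Sum>j\<in>UNIV. A j z * h $ j + B j z * cnj (h $ j)))) (at z)"
    using assms unfolding tame_wgrad_def is_wgrad_def by (intro has_derivative_mult_right) auto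
  then show "((\<lambda>z. c * f z) has_derivative (\<lambda>h. \<Sum>j\<in>UNIV. (c * A j z) * h $ j + (c * B j z) * cnj (h $ j))) (at z)"
    by (simp add: sum_distrib_left algebra_simps)
qed (use assms in \<open>auto simp: tame_wgrad_def\<close>)

text \<open>The shift by \<open>\<delta>\<close> keeps all real powers of \<open>rho\<close> smooth at the zeros of \<open>F\<close>.\<close>
locale cpoly_powr =
  fixes F :: "complex ^ 'd \<Rightarrow> complex" and dF :: "'d \<Rightarrow> complex ^ 'd \<Rightarrow> complex"
    and ddF :: "'d \<Rightarrow> 'd \<Rightarrow> complex ^ 'd \<Rightarrow> complex" and N :: nat and \<delta> :: real
  assumes F: "cpoly N F" and gF: "is_cgrad F dF" and dF: "\<And>j. cpoly N (dF j)"
    and gdF: "\<And>j. is_cgrad (dF j) (ddF j)" and ddF: "\<And>j k. cpoly N (ddF j k)"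
    and \<delta>: "\<delta> > 0"
begin

definition rho :: "complex ^ 'd \<Rightarrow> real" where
  "rho z = (cmod (F z))\<^sup>2 + \<delta>"

text \<open>The span of these functions is closed under both Wirtinger derivatives: differentiating
  \<open>rho\<close> lowers the exponent by one and moves \<open>F\<close> and \<open>dF j\<close>
  into the factors \<open>u\<close> and \<open>v\<close>. One formula thus serves for the
  regularised power and for its first derivative along the path.\<close>

definition psi :: "real \<Rightarrow> (complex ^ 'd \<Rightarrow> complex) \<Rightarrow> (complex ^ 'd \<Rightarrow> complex) \<Rightarrow> complex ^ 'd \<Rightarrow> complex" where
  "psi \<sigma> u v z = complex_of_real (rho z powr \<sigma>) * u z * cnj (v z)"

lemma rho_ge: "rho z \<ge> \<delta>" and rho_pos: "rho z > 0"
  using \<delta> by (auto simp: rho_def add_nonneg_pos)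

lemma tame_rho: "tame rho"
  unfolding rho_def[abs_def] by (intro tame_add tame_power tame_norm tame_const cpoly_tame[OF F])

lemma tame_rho_powr: "tame (\<lambda>z. rho z powr \<sigma>)"
  by (rule tame_powr[OF tame_rho \<delta> rho_ge])

lemma tame_psi: "tame u \<Longrightarrow> tame v \<Longrightarrow> tame (psi \<sigma> u v)"
  unfolding psi_def[abs_def] by (intro tame_mult tame_of_real tame_cnj tame_rho_powr)

lemma tame_F: "tame F" "tame (dF j)" "tame (ddF j k)"
  using F dF ddF by (auto intro: cpoly_tame)

lemma rho_has_derivative:
  "(rho has_derivative (\<lambda>h. 2 * Re (cnj (F z) * (\<Sum>j\<in>UNIV. dF j z * h $ j)))) (at z)"
proof -
  have r: "rho = (\<lambda>z. Re (F z * cnj (F z)) + \<delta>)"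
    by (auto simp: rho_def complex_mult_cnj cmod_power2)
  have "(F has_derivative (\<lambda>h. \<Sum>j\<in>UNIV. dF j z * h $ j)) (at z)"
    using gF by (simp add: is_cgrad_def)
  from has_derivative_add[OF bounded_linear.has_derivative[OF bounded_linear_Re
      has_derivative_mult[OF this bounded_linear.has_derivative[OF bounded_linear_cnj this]]] has_derivative_const[of \<delta>]]
  have "((\<lambda>z. Re (F z * cnj (F z)) + \<delta>) has_derivative
    (\<lambda>h. Re (F z * cnj (\<Sum>j\<in>UNIV. dF j z * h $ j) + (\<Sum>j\<in>UNIV. dF j z * h $ j) * cnj (F z)) + 0)) (at z)" .
  moreover have "Re (a * cnj b + b * cnj a) + 0 = 2 * Re (cnj a * b)" for a b by (simp add: algebra_simps)
  ultimately show ?thesis unfolding r by (simp only:)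
qed

text \<open>Since \<open>rho\<close> is \<open>F\<close> times its conjugate plus a constant, its
  partials are cnj F * dF j in z and F * cnj (dF j) in the conjugate variable. The rest is the
  product rule.\<close>

lemma psi_tame_wgrad:
  assumes u: "is_cgrad u du" "tame u" "\<And>j. tame (du j)" and v: "is_cgrad v dv" "tame v" "\<And>j. tame (dv j)"
  shows "tame_wgrad (psi \<sigma> u v)
    (\<lambda>j z. \<sigma> * psi (\<sigma> - 1) (\<lambda>z. dF j z * u z) (\<lambda>z. F z * v z) z + psi \<sigma> (du j) v z)
    (\<lambda>j z. \<sigma> * psi (\<sigma> - 1) (\<lambda>z. F z * u z) (\<lambda>z. dF j z * v z) z + psi \<sigma> u (dv j) z)"
    (is "tame_wgrad _ ?A ?B")
  unfolding tame_wgrad_def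
proof (intro conjI allI)
  show "is_wgrad (psi \<sigma> u v) ?A ?B"
    unfolding is_wgrad_def
  proof
    fix z
    let ?DF = "\<lambda>h. \<Sum>j\<in>UNIV. dF j z * h $ j" and ?Du = "\<lambda>h. \<Sum>j\<in>UNIV. du j z * h $ j"
      and ?Dv = "\<lambda>h. \<Sum>j\<in>UNIV. dv j z * h $ j"
    have "((\<lambda>x. x powr \<sigma>) has_real_derivative \<sigma> * rho z powr (\<sigma> - 1)) (at (rho z))"
      by (rule has_real_derivative_powr[OF rho_pos])
    from DERIV_compose_FDERIV[OF this rho_has_derivative]
    have r: "((\<lambda>z. complex_of_real (rho z powr \<sigma>)) has_derivative
      (\<lambda>h. complex_of_real (2 * Re (cnj (F z) * ?DF h) * (\<sigma> * rho z powr (\<sigma> - 1))))) (at z)"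
      by (rule bounded_linear.has_derivative[OF bounded_linear_of_real])
    have du: "(u has_derivative ?Du) (at z)" and dv: "(v has_derivative ?Dv) (at z)"
      using u v by (auto simp: is_cgrad_def)
    have "((\<lambda>z. complex_of_real (rho z powr \<sigma>) * u z * cnj (v z)) has_derivative
      (\<lambda>h. complex_of_real (rho z powr \<sigma>) * u z * cnj (?Dv h)
        + (complex_of_real (rho z powr \<sigma>) * ?Du h
          + complex_of_real (2 * Re (cnj (F z) * ?DF h) * (\<sigma> * rho z powr (\<sigma> - 1))) * u z) * cnj (v z))) (at z)"
      by (rule has_derivative_mult[OF has_derivative_mult[OF r du] bounded_linear.has_derivative[OF bounded_linear_cnj dv]])
    moreover have "complex_of_real (rho z powr \<sigma>) * u z * cnj (?Dv h)
        + (complex_of_real (rho z powr \<sigma>) * ?Du h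
          + complex_of_real (2 * Re (cnj (F z) * ?DF h) * (\<sigma> * rho z powr (\<sigma> - 1))) * u z) * cnj (v z)
      = (\<Sum>j\<in>UNIV. ?A j z * h $ j + ?B j z * cnj (h $ j))" for h
    proof -
      have c: "complex_of_real (2 * Re x) = x + cnj x" for x by (simp add: complex_add_cnj)
      define R where "R = complex_of_real (rho z powr \<sigma>)"
      define Q where "Q = complex_of_real (rho z powr (\<sigma> - 1))"
      have "R * u z * cnj (?Dv h) + (R * ?Du h + (cnj (F z) * ?DF h + cnj (cnj (F z) * ?DF h)) * (\<sigma> * Q) * u z) * cnj (v z)
        = (R * cnj (v z)) * ?Du h + (\<sigma> * Q * cnj (F z) * u z * cnj (v z)) * ?DF h
        + (R * u z) * cnj (?Dv h) + (\<sigma> * Q * F z * u z * cnj (v z)) * cnj (?DF h)"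
        by (simp add: algebra_simps)
      also have "\<dots> = (\<Sum>j\<in>UNIV. ?A j z * h $ j + ?B j z * cnj (h $ j))"
        unfolding cnj_sum sum_distrib_left sum.distrib[symmetric] psi_def R_def[symmetric] Q_def[symmetric]
        by (intro sum.cong refl) (simp add: algebra_simps)
      finally show ?thesis unfolding R_def Q_def of_real_mult c[unfolded of_real_mult] by (simp add: mult.assoc)
    qed
    ultimately show "(psi \<sigma> u v has_derivative (\<lambda>h. \<Sum>j\<in>UNIV. ?A j z * h $ j + ?B j z * cnj (h $ j))) (at z)"
      unfolding psi_def[abs_def] by simp
  qed
qed (intro tame_add tame_mult tame_psi tame_F u v tame_const)+

text \<open>\<open>a\<close> is L F for the operator L of the overview. \<open>q\<close> pairs the
  gradient with itself without conjugation; it measures how far L is from a derivation, as in L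
  (F^2) = 2 F a - 2 q.\<close>

definition a :: "complex ^ 'd \<Rightarrow> complex" where "a z = (\<Sum>j\<in>UNIV. z $ j * dF j z - ddF j j z)"
definition q :: "complex ^ 'd \<Rightarrow> complex" where "q z = (\<Sum>j\<in>UNIV. dF j z * dF j z)"

lemma is_cgrad_mult:
  assumes "is_cgrad u du" "is_cgrad v dv"
  shows "is_cgrad (\<lambda>z. u z * v z) (\<lambda>j z. u z * dv j z + du j z * v z)"
  unfolding is_cgrad_def
proof
  fix z
  have "((\<lambda>z. u z * v z) has_derivative (\<lambda>h. u z * (\<Sum>j\<in>UNIV. dv j z * h $ j) + (\<Sum>j\<in>UNIV. du j z * h $ j) * v z)) (at z)"
    using assms unfolding is_cgrad_def by (intro has_derivative_mult) auto
  then show "((\<lambda>z. u z * v z) has_derivative (\<lambda>h. \<Sum>j\<in>UNIV. (u z * dv j z + du j z * v z) * h $ j)) (at z)"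
    by (simp add: sum_distrib_left sum_distrib_right sum.distrib[symmetric] algebra_simps)
qed

text \<open>L differentiates holomorphically only, so cnj v and cnj F act as constants. The
  integrand on the right is cnj v times L (rho powr \<sigma> * u), expanded by the rule L (g h) = g
  L h + h L g - 2 (grad g . grad h).\<close>

lemma psi_zmap_has_vector_derivative:
  assumes u: "is_cgrad u du" "tame u" "\<And>j. tame (du j)"
    and du: "\<And>j. is_cgrad (du j) (ddu j)" "\<And>j k. tame (ddu j k)"
    and v: "is_cgrad v dv" "tame v" "\<And>j. tame (dv j)" and t: "t > 0"
  shows "((\<lambda>t. gint (\<lambda>w. psi \<sigma> u v (zmap (al t) (be t) w))) has_vector_derivative
    gint ((\<lambda>z. cnj (v z) * (\<sigma> * rho z powr (\<sigma> - 1) * cnj (F z) * u z * a z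
      + rho z powr \<sigma> * (\<Sum>j\<in>UNIV. z $ j * du j z - ddu j j z)
      - \<sigma> * (\<sigma> - 1) * rho z powr (\<sigma> - 2) * (cnj (F z))\<^sup>2 * u z * q z
      - 2 * \<sigma> * rho z powr (\<sigma> - 1) * cnj (F z) * (\<Sum>j\<in>UNIV. dF j z * du j z))) \<circ> zmap (al t) (be t))) (at t)"
proof -
  let ?A = "\<lambda>j z. \<sigma> * psi (\<sigma> - 1) (\<lambda>z. dF j z * u z) (\<lambda>z. F z * v z) z + psi \<sigma> (du j) v z"
  have gFv: "is_cgrad (\<lambda>z. F z * v z) (\<lambda>j z. F z * dv j z + dF j z * v z)"
    by (rule is_cgrad_mult[OF gF v(1)])
  have gFu: "is_cgrad (\<lambda>z. dF j z * u z) (\<lambda>k z. dF j z * du k z + ddF j k z * u z)" for j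
    by (rule is_cgrad_mult[OF gdF u(1)])
  have tFv: "tame (\<lambda>z. F z * v z)" "\<And>j. tame (\<lambda>z. F z * dv j z + dF j z * v z)"
    and tFu: "\<And>j. tame (\<lambda>z. dF j z * u z)" "\<And>j k. tame (\<lambda>z. dF j z * du k z + ddF j k z * u z)"
    by (intro tame_add tame_mult tame_F u du v)+
  note 1 = psi_tame_wgrad[OF u v, of \<sigma>]
  note 2 = tame_wgrad_add[OF tame_wgrad_cmult[OF psi_tame_wgrad[OF gFu tFu gFv tFv, of "\<sigma> - 1"]]
      psi_tame_wgrad[OF du(1) u(3) du(2) v, of \<sigma>]]
  show ?thesis
  proof (rule has_vector_derivative_eq_rhs[OF gint_zmap_has_vector_derivative[OF 1 2 t]])
    have "(\<Sum>j\<in>UNIV. z $ j * ?A j z -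
        (\<sigma> * ((\<sigma> - 1) * psi (\<sigma> - 1 - 1) (\<lambda>z. dF j z * (dF j z * u z)) (\<lambda>z. F z * (F z * v z)) z
          + psi (\<sigma> - 1) (\<lambda>z. dF j z * du j z + ddF j j z * u z) (\<lambda>z. F z * v z) z)
        + (\<sigma> * psi (\<sigma> - 1) (\<lambda>z. dF j z * du j z) (\<lambda>z. F z * v z) z + psi \<sigma> (ddu j j) v z)))
      = cnj (v z) * (\<sigma> * rho z powr (\<sigma> - 1) * cnj (F z) * u z * a z
      + rho z powr \<sigma> * (\<Sum>j\<in>UNIV. z $ j * du j z - ddu j j z)
      - \<sigma> * (\<sigma> - 1) * rho z powr (\<sigma> - 2) * (cnj (F z))\<^sup>2 * u z * q z
      - 2 * \<sigma> * rho z powr (\<sigma> - 1) * cnj (F z) * (\<Sum>j\<in>UNIV. dF j z * du j z))" for z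
      unfolding a_def q_def right_diff_distrib distrib_left sum_distrib_left
        sum_subtractf[symmetric] sum.distrib[symmetric] psi_def
      by (intro sum.cong refl) (simp add: algebra_simps power2_eq_square)
    then show "gint (\<lambda>w. \<Sum>j\<in>UNIV. zmap (al t) (be t) w $ j * ?A j (zmap (al t) (be t) w) -
        (complex_of_real \<sigma> * (complex_of_real (\<sigma> - 1) * psi (\<sigma> - 1 - 1) (\<lambda>z. dF j z * (dF j z * u z)) (\<lambda>z. F z * (F z * v z)) (zmap (al t) (be t) w)
          + psi (\<sigma> - 1) (\<lambda>z. dF j z * du j z + ddF j j z * u z) (\<lambda>z. F z * v z) (zmap (al t) (be t) w))
        + (complex_of_real \<sigma> * psi (\<sigma> - 1) (\<lambda>z. dF j z * du j z) (\<lambda>z. F z * v z) (zmap (al t) (be t) w) + psi \<sigma> (ddu j j) v (zmap (al t) (be t) w))))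
      = gint ((\<lambda>z. cnj (v z) * (\<sigma> * rho z powr (\<sigma> - 1) * cnj (F z) * u z * a z
      + rho z powr \<sigma> * (\<Sum>j\<in>UNIV. z $ j * du j z - ddu j j z)
      - \<sigma> * (\<sigma> - 1) * rho z powr (\<sigma> - 2) * (cnj (F z))\<^sup>2 * u z * q z
      - 2 * \<sigma> * rho z powr (\<sigma> - 1) * cnj (F z) * (\<Sum>j\<in>UNIV. dF j z * du j z))) \<circ> zmap (al t) (be t))"
      unfolding comp_def by simp
  qed
qed

end

section \<open>Logarithmic convexity\<close>

lemma is_cgrad_const: "is_cgrad (\<lambda>z. c) (\<lambda>j z. 0)"
  by (simp add: is_cgrad_def)

lemma tame_wgrad_continuous: "tame_wgrad f A B \<Longrightarrow> continuous_on UNIV f"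
  unfolding tame_wgrad_def is_wgrad_def
  by (intro continuous_at_imp_continuous_on ballI) (blast intro: has_derivative_continuous)

lemma zmap_0: "zmap (al 0) (be 0) w = cvec (fst w)"
  by (simp add: al_def be_def vec_eq_iff zmap_nth)

lemma al_be_le: assumes "t \<ge> 0" shows "\<bar>al t\<bar> + \<bar>be t\<bar> \<le> 2 * exp (t / 2)"
proof -
  have "al t \<le> exp (t/2)" "be t \<le> exp (t/2)"
    using assms exp_ge_add_one_self[of t] order_trans[OF _ exp_ge_zero[of t], of "-1"]
    by (auto intro!: real_le_lsqrt simp: al_def be_def power2_eq_square exp_add[symmetric])
  moreover have "be t \<ge> 0" using assms by (simp add: be_def)
  ultimately show ?thesis using al_pos[of t] by simp
qed

lemma continuous_al_be: "continuous_on UNIV al" "continuous_on UNIV be"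
  unfolding al_def[abs_def] be_def[abs_def] by (intro continuous_intros; simp)+

lemma gint_zmap_tendsto:
  fixes f :: "complex ^ 'd \<Rightarrow> 'b::{banach, second_countable_topology}"
  assumes f: "tame f" and c: "continuous_on UNIV f" and u: "u \<longlonglongrightarrow> 0" "\<And>i. u i \<in> {0..1}"
  shows "(\<lambda>i. gint (\<lambda>w. f (zmap (al (u i)) (be (u i)) w))) \<longlonglongrightarrow> gint (\<lambda>w::(real^'d) \<times> (real^'d). f (cvec (fst w)))"
proof -
  obtain C k where C: "C \<ge> 0" "\<And>z. norm (f z) \<le> C * (1 + norm z) ^ k" using tameE[OF f] by metis
  define H where "H w = C * (1 + 2 * exp 1 * norm w) ^ k" for w :: "(real^'d) \<times> (real^'d)"
  show ?thesis unfolding gint_def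
  proof (rule integral_dominated_convergence[where w="\<lambda>w. gauss w *\<^sub>R H w" and M=lborel and f="\<lambda>w. gauss w *\<^sub>R f (cvec (fst w))"
    and s="\<lambda>i w. gauss w *\<^sub>R f (zmap (al (u i)) (be (u i)) w)"])
    have "tame H" unfolding H_def
      by (intro tame_mult tame_power tame_add tame_const tame_norm tame_linear bounded_linear_ident)
    then show "integrable lborel (\<lambda>w. gauss w *\<^sub>R H w)" by (rule integrable_tame_gauss)
    show "AE w in lborel. norm (gauss w *\<^sub>R f (zmap (al (u i)) (be (u i)) w)) \<le> gauss w *\<^sub>R H w" for i
    proof (rule AE_I2)
      fix w :: "(real^'d) \<times> (real^'d)"
      have "norm (zmap (al (u i)) (be (u i)) w) \<le> (2 * exp (u i / 2)) * norm w"
        using norm_zmap_le[of "al (u i)" "be (u i)" w] al_be_le[of "u i"] u(2)[of i]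
        by (meson atLeastAtMost_iff mult_right_mono norm_ge_zero order_trans)
      also have "\<dots> \<le> 2 * exp 1 * norm w"
        using u(2)[of i] by (intro mult_right_mono) auto
      finally have "norm (f (zmap (al (u i)) (be (u i)) w)) \<le> H w"
        unfolding H_def using C by (intro order_trans[OF C(2)] mult_left_mono power_mono) auto
      then show "norm (gauss w *\<^sub>R f (zmap (al (u i)) (be (u i)) w)) \<le> gauss w *\<^sub>R H w"
        by (simp add: mult_left_mono)
    qed
    show "AE w in lborel. (\<lambda>i. gauss w *\<^sub>R f (zmap (al (u i)) (be (u i)) w)) \<longlonglongrightarrow> gauss w *\<^sub>R f (cvec (fst (w::(real^'d) \<times> (real^'d))))"
    proof (intro AE_I2 tendsto_scaleR tendsto_const)
      fix w :: "(real^'d) \<times> (real^'d)"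
      have "(\<lambda>i. al (u i)) \<longlonglongrightarrow> al 0" "(\<lambda>i. be (u i)) \<longlonglongrightarrow> be 0"
        using continuous_on_tendsto_compose[OF continuous_al_be(1) u(1)]
          continuous_on_tendsto_compose[OF continuous_al_be(2) u(1)] by simp_all
      then have "(\<lambda>i. zmap (al (u i)) (be (u i)) w) \<longlonglongrightarrow> zmap (al 0) (be 0) w"
        unfolding zmap_def by (intro vec_tendstoI) (auto intro!: tendsto_intros)
      then show "(\<lambda>i. f (zmap (al (u i)) (be (u i)) w)) \<longlonglongrightarrow> f (cvec (fst w))"
        unfolding zmap_0 by (rule continuous_on_tendsto_compose[OF c]) simp_all
    qed
    show "(\<lambda>w. gauss w *\<^sub>R f (zmap (al (u i)) (be (u i)) w)) \<in> borel_measurable lborel" for i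
      using tameD[OF tame_compose[OF f tame_zmap[of "al (u i)" "be (u i)"]]] by simp
    have "tame (\<lambda>w::(real^'d) \<times> (real^'d). f (cvec (fst w)))"
      by (rule tame_compose[OF f tame_compose[OF tame_cvec tame_linear[OF bounded_linear_fst]]])
    then show "(\<lambda>w::(real^'d) \<times> (real^'d). gauss w *\<^sub>R f (cvec (fst w))) \<in> borel_measurable lborel"
      by (rule borel_measurable_integrable[OF integrable_tame_gauss])
  qed
qed

text \<open>At t = 0 the integrand depends on X alone; the mass of the Y-factor splits off by Fubini
  and later cancels from both sides of an inequality.\<close>

lemma gint_fst:
  fixes g :: "'a::euclidean_space \<Rightarrow> real"
  assumes g: "tame g"
  shows "gint (\<lambda>w::'a \<times> 'b::euclidean_space. g (fst w)) = gint g * gint (\<lambda>y::'b. 1)"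
proof -
  have e: "gauss (x, y) = gauss x * gauss y" for x :: 'a and y :: 'b
    by (simp add: gauss_def norm_prod_def exp_add[symmetric] add_divide_distrib)
  have "tame (\<lambda>w::'a \<times> 'b. g (fst w))" by (intro tame_compose[OF g] tame_linear bounded_linear_fst)
  then have i: "integrable (lborel \<Otimes>\<^sub>M lborel) (\<lambda>w::'a \<times> 'b. gauss w *\<^sub>R g (fst w))"
    unfolding lborel_prod by (rule integrable_tame_gauss)
  have "gint (\<lambda>w::'a \<times> 'b. g (fst w)) = integral\<^sup>L (lborel \<Otimes>\<^sub>M lborel) (\<lambda>w::'a \<times> 'b. gauss w *\<^sub>R g (fst w))"
    by (simp add: gint_def lborel_prod)
  also have "\<dots> = (\<integral>x. \<integral>y. gauss (x, y) * g x \<partial>(lborel::'b measure) \<partial>lborel)"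
    using lborel_pair.integral_fst'[OF i] by simp
  also have "\<dots> = (\<integral>x. (gauss x * g x) * (\<integral>y. gauss y \<partial>(lborel::'b measure)) \<partial>lborel)"
    unfolding integral_mult_right_zero[symmetric] e by (simp add: mult_ac)
  also have "\<dots> = gint g * gint (\<lambda>y::'b. 1)"
    by (simp add: gint_def)
  finally show ?thesis .
qed

section \<open>The regularised moment along the path and its two derivatives\<close>

locale cpoly_powr_moment = cpoly_powr +
  fixes s :: real
  assumes s: "s \<ge> 1"
begin

definition phi :: "complex ^ 'a \<Rightarrow> real" where "phi z = rho z powr s"

text \<open>This is L phi, read off from the general formula with u = v = 1 and exponent
  \<open>s\<close>.\<close>

definition G :: "complex ^ 'a \<Rightarrow> complex" where
  "G z = s * rho z powr (s - 1) * cnj (F z) * a z - s * (s - 1) * rho z powr (s - 2) * (cnj (F z))\<^sup>2 * q z"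

text \<open>This is L applied to \<open>cnj G\<close>. Since \<open>phi\<close> is real,
  \<open>cnj G\<close> is the conjugate operator applied to \<open>phi\<close>. The two blocks are
  the general formula for (s - 1, F, a) and (s - 2, F * F, q), left unsimplified in the exponents to
  match it.\<close>

definition H :: "complex ^ 'a \<Rightarrow> complex" where
  "H z = s * (cnj (a z) * ((s - 1) * rho z powr (s - 1 - 1) * cnj (F z) * F z * a z
      + rho z powr (s - 1) * a z
      - (s - 1) * (s - 1 - 1) * rho z powr (s - 1 - 2) * (cnj (F z))\<^sup>2 * F z * q z
      - 2 * (s - 1) * rho z powr (s - 1 - 1) * cnj (F z) * q z))
    - s * (s - 1) * (cnj (q z) * ((s - 2) * rho z powr (s - 2 - 1) * cnj (F z) * (F z * F z) * a z
      + rho z powr (s - 2) * (2 * F z * a z - 2 * q z)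
      - (s - 2) * (s - 2 - 1) * rho z powr (s - 2 - 2) * (cnj (F z))\<^sup>2 * (F z * F z) * q z
      - 2 * (s - 2) * rho z powr (s - 2 - 1) * cnj (F z) * (2 * F z * q z)))"

lemma cpoly_a: "cpoly (Suc N) a"
  unfolding a_def[abs_def] by (intro cpoly_sum cpoly_diff cpoly_var_mult dF cpoly_Suc[OF ddF])

lemma cpoly_q: "cpoly (N + N) q"
  unfolding q_def[abs_def] by (intro cpoly_sum cpoly_mult dF)

lemma cnj_G: "cnj (G z) = s * psi (s - 1) F a z - s * (s - 1) * psi (s - 2) (\<lambda>z. F z * F z) q z"
  by (simp add: G_def psi_def power2_eq_square mult_ac)

lemma tame_phi: "tame phi"
  unfolding phi_def[abs_def] by (rule tame_rho_powr)

lemma tame_aq: "tame a" "tame q"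
  by (auto intro: cpoly_tame cpoly_a cpoly_q)

lemma tame_G: "tame G"
  unfolding G_def[abs_def] by (intro tame_diff tame_mult tame_power tame_of_real tame_cnj tame_rho_powr tame_const tame_F tame_aq)

lemma tame_H: "tame H"
  unfolding H_def[abs_def] by (intro tame_diff tame_add tame_mult tame_power tame_of_real tame_cnj tame_rho_powr tame_const tame_F tame_aq)

lemma gint_phi_deriv:
  assumes t: "t > 0"
  shows "((\<lambda>t. gint (\<lambda>w. phi (zmap (al t) (be t) w))) has_real_derivative
    gint (\<lambda>w. Re (G (zmap (al t) (be t) w)))) (at t)"
proof -
  have "((\<lambda>t. gint (\<lambda>w. psi s (\<lambda>z. 1) (\<lambda>z. 1) (zmap (al t) (be t) w))) has_vector_derivative
    gint (\<lambda>w. G (zmap (al t) (be t) w))) (at t)"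
    by (rule has_vector_derivative_eq_rhs[OF psi_zmap_has_vector_derivative[OF is_cgrad_const _ _ is_cgrad_const _ is_cgrad_const _ _ t]])
       (simp_all add: G_def o_def)
  from bounded_linear.has_vector_derivative[OF bounded_linear_Re this]
  have 1: "((\<lambda>t. Re (gint (\<lambda>w. psi s (\<lambda>z. 1) (\<lambda>z. 1) (zmap (al t) (be t) w)))) has_real_derivative
    Re (gint (\<lambda>w. G (zmap (al t) (be t) w)))) (at t)"
    by (simp add: has_real_derivative_iff_has_vector_derivative)
  have "Re (gint (\<lambda>w. psi s (\<lambda>z. 1) (\<lambda>z. 1) (zmap (al t) (be t) w))) = gint (\<lambda>w. phi (zmap (al t) (be t) w))" for t
    by (subst gint_bounded_linear[OF bounded_linear_Re, symmetric])
       (auto intro!: tame_of_real tame_compose[OF tame_rho_powr tame_zmap] simp: psi_def phi_def)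
  moreover have "Re (gint (\<lambda>w. G (zmap (al t) (be t) w))) = gint (\<lambda>w. Re (G (zmap (al t) (be t) w)))"
    by (rule gint_bounded_linear[OF bounded_linear_Re tame_compose[OF tame_G tame_zmap], symmetric])
  ultimately show ?thesis using 1 by simp
qed

text \<open>Under \<open>Re\<close> the function \<open>G\<close> may be replaced by
  \<open>cnj G\<close> before differentiating again. The second derivative then applies L and its
  conjugate once each, which yields a nonnegative function (\<open>H_eq\<close>); applying L twice
  would give no sign.\<close>

lemma gint_G_deriv:
  assumes t: "t > 0"
  shows "((\<lambda>t. gint (\<lambda>w. Re (G (zmap (al t) (be t) w)))) has_real_derivative
    gint (\<lambda>w. Re (H (zmap (al t) (be t) w)))) (at t)"
proof -
  obtain da where da: "\<And>j. cpoly (Suc N) (da j)" "is_cgrad a da" using cpoly_cgrad[OF cpoly_a] by blast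
  obtain dq where dq: "\<And>j. cpoly (N + N) (dq j)" "is_cgrad q dq" using cpoly_cgrad[OF cpoly_q] by blast
  have gFF: "is_cgrad (\<lambda>z. F z * F z) (\<lambda>j z. 2 * (F z * dF j z))"
    using is_cgrad_mult[OF gF gF] by (simp add: mult_ac)
  have gdFF: "is_cgrad (\<lambda>z. 2 * (F z * dF j z)) (\<lambda>k z. 2 * (F z * ddF j k z + dF k z * dF j z))" for j
    using is_cgrad_mult[OF is_cgrad_const[of 2] is_cgrad_mult[OF gF gdF[of j]]] by simp
  have tFF: "tame (\<lambda>z. F z * F z)" "tame (\<lambda>z. 2 * (F z * dF j z))"
      "tame (\<lambda>z. 2 * (F z * ddF j k z + dF k z * dF j z))" for j k
    by (intro tame_mult tame_add tame_F tame_const)+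
  let ?Z = "\<lambda>t. zmap (al t) (be t)"
  define H1 where "H1 z = cnj (a z) * ((s - 1) * rho z powr (s - 1 - 1) * cnj (F z) * F z * a z
      + rho z powr (s - 1) * a z
      - (s - 1) * (s - 1 - 1) * rho z powr (s - 1 - 2) * (cnj (F z))\<^sup>2 * F z * q z
      - 2 * (s - 1) * rho z powr (s - 1 - 1) * cnj (F z) * q z)" for z
  define H2 where "H2 z = cnj (q z) * ((s - 2) * rho z powr (s - 2 - 1) * cnj (F z) * (F z * F z) * a z
      + rho z powr (s - 2) * (2 * F z * a z - 2 * q z)
      - (s - 2) * (s - 2 - 1) * rho z powr (s - 2 - 2) * (cnj (F z))\<^sup>2 * (F z * F z) * q z
      - 2 * (s - 2) * rho z powr (s - 2 - 1) * cnj (F z) * (2 * F z * q z))" for z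
  have tH: "tame H1" "tame H2"
    unfolding H1_def[abs_def] H2_def[abs_def]
    by (intro tame_diff tame_add tame_mult tame_power tame_of_real tame_cnj tame_rho_powr tame_const tame_F tame_aq)+
  have 1: "((\<lambda>t. gint (\<lambda>w. psi (s - 1) F a (?Z t w))) has_vector_derivative gint (\<lambda>w. H1 (?Z t w))) (at t)"
    by (rule has_vector_derivative_eq_rhs[OF psi_zmap_has_vector_derivative[OF gF tame_F(1,2) gdF tame_F(3) da(2) tame_aq(1) cpoly_tame[OF da(1)] t]])
       (simp add: H1_def o_def a_def q_def)
  have FF: "(\<Sum>j\<in>UNIV. z $ j * (2 * (F z * dF j z)) - 2 * (F z * ddF j j z + dF j z * dF j z)) = 2 * F z * a z - 2 * q z"
    "(\<Sum>j\<in>UNIV. dF j z * (2 * (F z * dF j z))) = 2 * F z * q z" for z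
    unfolding a_def q_def sum_distrib_left sum_subtractf[symmetric]
    by (intro sum.cong refl; simp add: algebra_simps)+
  have 2: "((\<lambda>t. gint (\<lambda>w. psi (s - 2) (\<lambda>z. F z * F z) q (?Z t w))) has_vector_derivative gint (\<lambda>w. H2 (?Z t w))) (at t)"
    by (rule has_vector_derivative_eq_rhs[OF psi_zmap_has_vector_derivative[OF gFF tFF(1,2) gdFF tFF(3) dq(2) tame_aq(2) cpoly_tame[OF dq(1)] t]])
       (simp only: H2_def o_def FF)
  have "((\<lambda>t. s * gint (\<lambda>w. psi (s - 1) F a (?Z t w)) - (s * (s - 1)) * gint (\<lambda>w. psi (s - 2) (\<lambda>z. F z * F z) q (?Z t w)))
      has_vector_derivative s * gint (\<lambda>w. H1 (?Z t w)) - (s * (s - 1)) * gint (\<lambda>w. H2 (?Z t w))) (at t)"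
    by (intro has_vector_derivative_diff has_vector_derivative_mult_right 1 2)
  moreover have "s * gint (\<lambda>w. psi (s - 1) F a (?Z t w)) - (s * (s - 1)) * gint (\<lambda>w. psi (s - 2) (\<lambda>z. F z * F z) q (?Z t w))
     = gint (\<lambda>w. cnj (G (?Z t w)))" for t
    unfolding cnj_G gint_cmult[symmetric]
    by (subst gint_diff) (auto intro!: tame_mult tame_compose[OF tame_psi tame_zmap] tame_F tame_aq tFF simp: mult.assoc)
  moreover have "s * gint (\<lambda>w. H1 (?Z t w)) - (s * (s - 1)) * gint (\<lambda>w. H2 (?Z t w)) = gint (\<lambda>w. H (?Z t w))"
  proof -
    have "H z = s * H1 z - (s * (s - 1)) * H2 z" for z by (simp only: H_def H1_def H2_def of_real_mult)
    moreover have "gint (\<lambda>w. s * H1 (?Z t w)) - gint (\<lambda>w. (s * (s - 1)) * H2 (?Z t w))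
        = gint (\<lambda>w. s * H1 (?Z t w) - (s * (s - 1)) * H2 (?Z t w))"
      by (rule gint_diff[symmetric]) (intro tame_mult tame_const tame_compose[OF _ tame_zmap] tH)+
    ultimately show ?thesis unfolding gint_cmult[symmetric] by (simp only:)
  qed
  ultimately have "((\<lambda>t. gint (\<lambda>w. cnj (G (?Z t w)))) has_vector_derivative gint (\<lambda>w. H (?Z t w))) (at t)"
    by simp
  from bounded_linear.has_vector_derivative[OF bounded_linear_Re this]
  have 3: "((\<lambda>t. Re (gint (\<lambda>w. cnj (G (?Z t w))))) has_real_derivative Re (gint (\<lambda>w. H (?Z t w)))) (at t)"
    by (simp add: has_real_derivative_iff_has_vector_derivative)
  have "Re (gint (\<lambda>w. cnj (G (?Z t w)))) = gint (\<lambda>w. Re (G (?Z t w)))" for t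
    by (subst gint_bounded_linear[OF bounded_linear_Re, symmetric])
       (auto intro!: tame_cnj tame_compose[OF tame_G tame_zmap])
  moreover have "Re (gint (\<lambda>w. H (?Z t w))) = gint (\<lambda>w. Re (H (?Z t w)))"
    by (rule gint_bounded_linear[OF bounded_linear_Re tame_compose[OF tame_H tame_zmap], symmetric])
  ultimately show ?thesis using 3 by simp
qed

text \<open>In a unitary frame adapted to \<open>(F z, sqrt \<delta>)\<close> the kernel \<open>(u * cnj v + \<delta>) powr s\<close> has the
  second order jet of a sum of three squares; the three terms below are their contributions.\<close>
lemma H_eq:
  "H z = complex_of_real (rho z powr (s - 4) * ((cmod (s * rho z * cnj (F z) * a z - s * (s - 1) * (cnj (F z))\<^sup>2 * q z))\<^sup>2
    + s * \<delta> * (cmod (rho z * a z - 2 * (s - 1) * q z * cnj (F z)))\<^sup>2 + 2 * s * (s - 1) * \<delta>\<^sup>2 * (cmod (q z))\<^sup>2))"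
proof -
  define P where "P = complex_of_real (rho z powr (s - 4))"
  define r where "r = complex_of_real (rho z)"
  define S where "S = complex_of_real s"
  \<comment> \<open>Values and their conjugates become independent letters. With all powers written
    as \<open>P\<close> times powers of \<open>r\<close>, and \<delta> as r - f f', the claim is a
    polynomial identity.\<close>
  define f f' A A' Q Q' where d: "f = F z" "f' = cnj (F z)" "A = a z" "A' = cnj (a z)" "Q = q z" "Q' = cnj (q z)"
  have p: "rho z powr (s - 4 + real k) = rho z powr (s - 4) * rho z ^ k" for k
    using rho_pos[of z] by (simp add: powr_add powr_realpow)
  have pw: "complex_of_real (rho z powr (s - 1)) = P * r^3" "complex_of_real (rho z powr (s - 2)) = P * r^2"
    "complex_of_real (rho z powr (s - 1 - 1)) = P * r^2" "complex_of_real (rho z powr (s - 1 - 2)) = P * r"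
    "complex_of_real (rho z powr (s - 2 - 1)) = P * r" "complex_of_real (rho z powr (s - 2 - 2)) = P"
    unfolding P_def r_def of_real_power[symmetric] of_real_mult[symmetric]
    using p[of 3] p[of 2] p[of 1] p[of 0] by simp_all
  have del: "complex_of_real \<delta> = r - f * f'"
    unfolding r_def d rho_def using complex_norm_square[of "F z"] by simp
  have cm: "(complex_of_real (cmod x))\<^sup>2 = x * cnj x" for x using complex_norm_square[of x] by simp
  show ?thesis
    unfolding H_def of_real_mult of_real_add of_real_power
    unfolding cm
    unfolding complex_cnj_diff complex_cnj_mult complex_cnj_power complex_cnj_complex_of_real complex_cnj_cnj
      of_real_diff of_real_mult of_real_1 complex_cnj_numeral of_real_numeral complex_cnj_one pw del
    unfolding P_def[symmetric] r_def[symmetric] S_def[symmetric]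
    unfolding d(2,4,6)[symmetric]
    unfolding d(1,3,5)[symmetric]
    by algebra
qed

text \<open>Discarding two nonnegative squares from \<open>H_eq\<close> leaves Re H >= P |g|^2,
  while G = P rho^2 g and phi = P rho^4; so (Re G)^2 <= Re H * phi pointwise. As a nonnegative
  quadratic in \<open>l\<close> this is linear in the three functions and can be integrated.\<close>

lemma H_lower:
  fixes l :: real
  shows "0 \<le> Re (H z) - 2 * l * Re (G z) + l\<^sup>2 * phi z"
proof -
  define P where "P = rho z powr (s - 4)"
  define g where "g = s * rho z * cnj (F z) * a z - s * (s - 1) * (cnj (F z))\<^sup>2 * q z"
  have P: "P > 0" using rho_pos[of z] by (simp add: P_def)
  have p: "rho z powr (s - 4 + real k) = P * rho z ^ k" for k
    using rho_pos[of z] by (simp add: powr_add powr_realpow P_def)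
  have G: "G z = (P * (rho z)\<^sup>2) * g" and phi: "phi z = P * rho z ^ 4"
    using p[of 3] p[of 2] p[of 4]
    by (simp_all add: G_def g_def phi_def algebra_simps power2_eq_square power3_eq_cube)
  have "Re (H z) \<ge> P * (cmod g)\<^sup>2"
    unfolding H_eq Re_complex_of_real P_def[symmetric] g_def[symmetric]
    using P s \<delta> by (intro mult_left_mono) auto
  moreover have "(cmod g)\<^sup>2 \<ge> (Re g)\<^sup>2" using abs_Re_le_cmod[of g] by (simp add: abs_le_square_iff[symmetric])
  ultimately have "Re (H z) \<ge> P * (Re g)\<^sup>2" using P by (smt (verit) mult_left_mono)
  moreover have "0 \<le> P * (Re g - l * (rho z)\<^sup>2)\<^sup>2" using P by simp
  moreover have "P * (Re g - l * (rho z)\<^sup>2)\<^sup>2 = P * (Re g)\<^sup>2 - 2 * l * Re (G z) + l\<^sup>2 * phi z"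
    unfolding G phi by (simp add: algebra_simps power2_eq_square power4_eq_xxxx)
  ultimately show ?thesis by linarith
qed

abbreviation "M t \<equiv> gint (\<lambda>w. phi (zmap (al t) (be t) w))"
abbreviation "M1 t \<equiv> gint (\<lambda>w. Re (G (zmap (al t) (be t) w)))"
abbreviation "M2 t \<equiv> gint (\<lambda>w. Re (H (zmap (al t) (be t) w)))"

lemma M_pos: "M t > 0"
proof -
  have "0 < gint (\<lambda>w::(real^'a) \<times> (real^'a). \<delta> powr s)"
    using \<delta> by (intro gint_const_pos) auto
  also have "\<dots> \<le> M t"
    using \<delta> s rho_ge by (intro gint_mono tame_const tame_compose[OF tame_phi tame_zmap]) (auto simp: phi_def intro!: powr_mono2)
  finally show ?thesis .
qed

text \<open>Integrating \<open>H_lower\<close> at the minimising l = M1 / M gives the Cauchy-Schwarz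
  inequality. For t > 0 it says that ln M is convex.\<close>

lemma M1_sq_le: "(M1 t)\<^sup>2 \<le> M2 t * M t"
proof -
  let ?l = "M1 t / M t"
  note tz = tame_compose[OF _ tame_zmap]
  have t: "tame (\<lambda>w. Re (H (zmap (al t) (be t) w)))" "tame (\<lambda>w. (2 * ?l) * Re (G (zmap (al t) (be t) w)))"
    "tame (\<lambda>w. ?l\<^sup>2 * phi (zmap (al t) (be t) w))"
    by (intro tame_mult tame_const tame_Re tz tame_H tame_G tame_phi)+
  have "0 \<le> gint (\<lambda>w. Re (H (zmap (al t) (be t) w)) - (2 * ?l) * Re (G (zmap (al t) (be t) w)) + ?l\<^sup>2 * phi (zmap (al t) (be t) w))"
    by (intro gint_nonneg) (rule H_lower)
  also have "\<dots> = M2 t - (2 * ?l) * M1 t + ?l\<^sup>2 * M t"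
    by (subst gint_add, intro tame_diff t, rule t, subst gint_diff, (rule t)+) (simp only: gint_cmult)
  also have "\<dots> = M2 t - (M1 t)\<^sup>2 / M t"
    using M_pos[of t] by (simp add: field_simps power2_eq_square)
  finally show ?thesis using M_pos[of t] by (simp add: field_simps)
qed

text \<open>From |Z| <= 2 exp (t/2) |w| one gets |F(Z)|^2 <= const * exp (N t) (1 + |w|)^(2 N), and
  the power \<open>s\<close> makes the rate N s. The shift \<delta> is absorbed because exp (N t) (1
  + |w|)^(2 N) is at least 1.\<close>

lemma M_growth: "\<exists>K. \<forall>t\<ge>0. M t \<le> K * exp (real N * s * t)"
proof -
  obtain C where C: "C \<ge> 0" "\<And>z. norm (F z) \<le> C * (1 + norm z) ^ N" using cpoly_growth[OF F] by blast
  define C' where "C' = C\<^sup>2 * 4 ^ N + \<delta>"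
  define B where "B w = C' powr s * ((1 + norm w) ^ (2 * N)) powr s" for w :: "(real^'a) \<times> (real^'a)"
  have "tame (\<lambda>w::(real^'a) \<times> (real^'a). ((1 + norm w) ^ (2 * N)) powr s)"
  proof (rule tame_powr[where \<delta>=1])
    show "tame (\<lambda>w::(real^'a) \<times> (real^'a). (1 + norm w) ^ (2 * N))"
      by (intro tame_power tame_add tame_const tame_norm tame_linear[OF bounded_linear_ident])
  qed auto
  then have tB: "tame B" unfolding B_def by (intro tame_mult tame_const)
  have "M t \<le> gint B * exp (real N * s * t)" if t: "t \<ge> 0" for t
  proof -
    have "phi (zmap (al t) (be t) w) \<le> exp (real N * s * t) * B w" for w
    proof -
      let ?z = "zmap (al t) (be t) w"
      have "norm ?z \<le> (2 * exp (t / 2)) * norm w"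
        using norm_zmap_le[of "al t" "be t" w] al_be_le[OF t] by (meson mult_right_mono norm_ge_zero order_trans)
      moreover have "1 \<le> 2 * exp (t/2)" using t one_le_exp_iff[of "t/2"] by linarith
      ultimately have "1 + norm ?z \<le> (2 * exp (t/2)) * (1 + norm w)" by (simp add: algebra_simps)
      then have "C * (1 + norm ?z) ^ N \<le> C * ((2 * exp (t/2)) * (1 + norm w)) ^ N"
        using C(1) by (intro mult_left_mono power_mono) auto
      with C(2)[of ?z] have "(cmod (F ?z))\<^sup>2 \<le> (C * ((2 * exp (t/2)) * (1 + norm w)) ^ N)\<^sup>2"
        by (intro power_mono) auto
      also have "\<dots> = C\<^sup>2 * 4 ^ N * exp (t * real N) * (1 + norm w) ^ (2 * N)"
      proof -
        have "((2 * exp (t/2)) ^ N)\<^sup>2 = 4 ^ N * exp (t * real N)"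
        proof -
          have "((2 * exp (t/2)) ^ N)\<^sup>2 = ((2 * exp (t/2))\<^sup>2) ^ N" by (simp only: power_mult[symmetric] mult.commute)
          also have "(2 * exp (t/2))\<^sup>2 = 4 * exp t" by (simp add: power2_eq_square exp_add[symmetric])
          finally show ?thesis by (simp only: power_mult_distrib exp_of_nat2_mult)
        qed
        then show ?thesis by (simp add: power_mult_distrib power_mult[symmetric] mult_ac)
      qed
      finally have "rho ?z \<le> C\<^sup>2 * 4 ^ N * (exp (t * real N) * (1 + norm w) ^ (2 * N)) + \<delta> * 1"
        by (simp add: rho_def mult_ac)
      also have "\<dots> \<le> C\<^sup>2 * 4 ^ N * (exp (t * real N) * (1 + norm w) ^ (2 * N)) + \<delta> * (exp (t * real N) * (1 + norm w) ^ (2 * N))"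
      proof -
        have "1 * 1 \<le> exp (t * real N) * (1 + norm w) ^ (2 * N)"
          using t by (intro mult_mono one_le_power) auto
        then show ?thesis using \<delta> by simp
      qed
      also have "\<dots> = C' * exp (t * real N) * (1 + norm w) ^ (2 * N)" by (simp add: C'_def algebra_simps)
      finally have "phi ?z \<le> (C' * exp (t * real N) * (1 + norm w) ^ (2 * N)) powr s"
        unfolding phi_def using s rho_pos[of ?z] by (intro powr_mono2) auto
      also have "\<dots> = exp (real N * s * t) * B w"
      proof -
        have "C' \<ge> 0" using C \<delta> by (simp add: C'_def)
        moreover have "exp (t * real N) powr s = exp (real N * s * t)" by (simp add: powr_def mult_ac)
        ultimately show ?thesis by (simp add: B_def powr_mult mult_ac)
      qed
      finally show ?thesis .
    qed
    then have "M t \<le> gint (\<lambda>w. exp (real N * s * t) * B w)"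
      by (intro gint_mono tame_mult tame_const tB tame_compose[OF tame_phi tame_zmap])
    then show ?thesis unfolding gint_cmult by (simp only: mult.commute)
  qed
  then show ?thesis by blast
qed

text \<open>\<open>ln M\<close> is convex and grows at most linearly with slope \<open>N * s\<close>.\<close>
lemma M1_le:
  assumes t: "t > 0"
  shows "M1 t \<le> real N * s * M t"
proof (rule ccontr)
  assume neg: "\<not> ?thesis"
  define R where "R t = M1 t / M t" for t
  have R0: "R t > real N * s" using neg M_pos[of t] by (simp add: R_def field_simps)
  have Rmono: "R t \<le> R u" if "t \<le> u" for u
  proof (rule DERIV_nonneg_imp_nondecreasing[OF that])
    fix x assume x: "t \<le> x" "x \<le> u"
    have "(R has_real_derivative (M2 x * M x - M1 x * M1 x) / (M x * M x)) (at x)"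
      unfolding R_def using x t M_pos[of x] by (intro DERIV_divide gint_phi_deriv gint_G_deriv) auto
    moreover have "(M2 x * M x - M1 x * M1 x) / (M x * M x) \<ge> 0"
      using M1_sq_le[of x] M_pos[of x] by (simp add: power2_eq_square)
    ultimately show "\<exists>y. (R has_real_derivative y) (at x) \<and> 0 \<le> y" by blast
  qed
  have low: "ln (M t) - R t * t \<le> ln (M u) - R t * u" if "t \<le> u" for u
  proof (rule DERIV_nonneg_imp_nondecreasing[OF that])
    fix x assume x: "t \<le> x" "x \<le> u"
    have "((\<lambda>x. ln (M x) - R t * x) has_real_derivative (1 / M x * M1 x - R t)) (at x)"
      using x t M_pos[of x] gint_phi_deriv[of x] by (auto intro!: derivative_eq_intros)
    moreover have "1 / M x * M1 x - R t \<ge> 0" using Rmono[OF x(1)] by (simp add: R_def)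
    ultimately show "\<exists>y. ((\<lambda>x. ln (M x) - R t * x) has_real_derivative y) (at x) \<and> 0 \<le> y" by blast
  qed
  obtain K where K: "\<And>t. t \<ge> 0 \<Longrightarrow> M t \<le> K * exp (real N * s * t)" using M_growth by blast
  have Kp: "K > 0" using K[of 0] M_pos[of 0] by simp
  define c where "c = ln K - ln (M t) + R t * t"
  have up: "(R t - real N * s) * u \<le> c" if "t \<le> u" for u
  proof -
    have "ln (M u) \<le> ln (K * exp (real N * s * u))" using K[of u] that t M_pos[of u] by simp
    also have "\<dots> = ln K + real N * s * u" using Kp by (simp add: ln_mult)
    finally show ?thesis using low[OF that] by (simp add: c_def algebra_simps)
  qed
  \<comment> \<open>Late enough for the tangent of ln M at t, of slope R t, to exceed the growth
    bound: (R t - N s) u is at least |c| + 1.\<close>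
  define u where "u = max t ((\<bar>c\<bar> + 1) / (R t - real N * s))"
  have "(R t - real N * s) * ((\<bar>c\<bar> + 1) / (R t - real N * s)) \<le> (R t - real N * s) * u"
    using R0 by (intro mult_left_mono) (auto simp: u_def)
  also have "\<dots> \<le> c" by (rule up) (simp add: u_def)
  finally show False using R0 by simp
qed

lemma continuous_G: "continuous_on UNIV G"
proof -
  obtain da where da: "\<And>j. cpoly (Suc N) (da j)" "is_cgrad a da" using cpoly_cgrad[OF cpoly_a] by blast
  obtain dq where dq: "\<And>j. cpoly (N + N) (dq j)" "is_cgrad q dq" using cpoly_cgrad[OF cpoly_q] by blast
  have "continuous_on UNIV (psi (s - 1) F a)"
    by (rule tame_wgrad_continuous[OF psi_tame_wgrad[OF gF tame_F(1,2) da(2) tame_aq(1) cpoly_tame[OF da(1)]]])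
  moreover have "continuous_on UNIV (psi (s - 2) (\<lambda>z. F z * F z) q)"
    by (rule tame_wgrad_continuous[OF psi_tame_wgrad[OF is_cgrad_mult[OF gF gF] _ _ dq(2) tame_aq(2) cpoly_tame[OF dq(1)]]])
       (intro tame_mult tame_add tame_F)+
  ultimately have "continuous_on UNIV (\<lambda>z. cnj (s * psi (s - 1) F a z - s * (s - 1) * psi (s - 2) (\<lambda>z. F z * F z) q z))"
    by (intro continuous_intros)
  then show ?thesis by (simp only: cnj_G[symmetric] complex_cnj_cnj)
qed

text \<open>This is \<open>M1_le\<close> in the limit t -> 0 from the right, where Z becomes the
  real vector X.\<close>

lemma gint_G_real_le:
  "gint (\<lambda>x. Re (G (cvec x))) \<le> real N * s * gint (\<lambda>x. phi (cvec x))"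
proof -
  define u where "u i = inverse (real (Suc i))" for i
  have u: "u \<longlonglongrightarrow> 0" "\<And>i. u i \<in> {0..1}" "\<And>i. u i > 0"
    unfolding u_def using LIMSEQ_inverse_real_of_nat by (auto simp: field_simps)
  have cphi: "continuous_on UNIV phi"
  proof -
    have "continuous_on UNIV rho" unfolding rho_def[abs_def]
      by (intro continuous_intros is_cgrad_continuous[OF gF])
    then show ?thesis unfolding phi_def[abs_def] using rho_pos
      by (intro continuous_on_powr continuous_on_const) (auto simp: less_imp_neq[THEN not_sym])
  qed
  have "(\<lambda>i. M1 (u i)) \<longlonglongrightarrow> gint (\<lambda>w::(real^'a) \<times> (real^'a). Re (G (cvec (fst w))))"
    by (rule gint_zmap_tendsto[of "\<lambda>z. Re (G z)", OF tame_Re[OF tame_G] _ u(1,2)]) (intro continuous_intros continuous_G)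
  moreover have "(\<lambda>i. real N * s * M (u i)) \<longlonglongrightarrow> real N * s * gint (\<lambda>w::(real^'a) \<times> (real^'a). phi (cvec (fst w)))"
    by (intro tendsto_mult_left gint_zmap_tendsto tame_phi cphi u(1,2))
  ultimately have le: "gint (\<lambda>w::(real^'a) \<times> (real^'a). Re (G (cvec (fst w)))) \<le> real N * s * gint (\<lambda>w::(real^'a) \<times> (real^'a). phi (cvec (fst w)))"
    by (rule LIMSEQ_le) (use M1_le[OF u(3)] in auto)
  have "gint (\<lambda>w::(real^'a) \<times> (real^'a). Re (G (cvec (fst w)))) = gint (\<lambda>x. Re (G (cvec x))) * gint (\<lambda>y::real^'a. 1)"
    by (rule gint_fst[of "\<lambda>x. Re (G (cvec x))"]) (intro tame_Re tame_compose[OF tame_G tame_cvec])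
  moreover have "gint (\<lambda>w::(real^'a) \<times> (real^'a). phi (cvec (fst w))) = gint (\<lambda>x. phi (cvec x)) * gint (\<lambda>y::real^'a. 1)"
    by (rule gint_fst[of "\<lambda>x. phi (cvec x)"]) (intro tame_compose[OF tame_phi tame_cvec])
  ultimately show ?thesis using le gint_const_pos[of 1, where 'a="real^'a"] by (simp add: mult.assoc[symmetric])
qed

end

section \<open>A weighted Bernstein--Markov inequality\<close>

lemma square_powr_has_real_derivative:
  assumes "(\<phi> has_real_derivative p) (at t)" "\<delta> > 0"
  shows "((\<lambda>t. ((\<phi> t)\<^sup>2 + \<delta>) powr \<sigma>) has_real_derivative
    \<sigma> * ((\<phi> t)\<^sup>2 + \<delta>) powr (\<sigma> - 1) * (2 * \<phi> t * p)) (at t)"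
proof (rule DERIV_chain2[OF has_real_derivative_powr])
  show "0 < (\<phi> t)\<^sup>2 + \<delta>" using assms(2) by (simp add: add_nonneg_pos)
  show "((\<lambda>t. (\<phi> t)\<^sup>2 + \<delta>) has_real_derivative 2 * \<phi> t * p) (at t)"
    using assms(1) by (auto intro!: derivative_eq_intros)
qed

lemma gint_coordinate_by_parts:
  fixes f f' :: "real ^ 'd \<Rightarrow> real"
  assumes "\<And>x. ((\<lambda>t. f (x + t *\<^sub>R axis j 1)) has_real_derivative f' x) (at 0)" "tame f" "tame f'"
  shows "gint (\<lambda>x. x $ j * f x) = gint f'"
  using gint_by_parts[of f "axis j 1" f'] assms
  by (simp add: has_real_derivative_iff_has_vector_derivative inner_axis)

lemma tame_square_powr:
  fixes \<sigma> :: real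
  assumes "tame f" "\<delta> > (0::real)"
  shows "tame (\<lambda>x. ((f x)\<^sup>2 + \<delta>) powr \<sigma>)"
  by (rule tame_powr[where \<delta>=\<delta>]) (auto intro!: tame_add tame_power assms)

text \<open>\<open>gint_G_real_le\<close> bounds the integral of L phi over real points. There the
  real derivative of \<open>rho\<close> is twice the holomorphic one, so integrating x_j * A j by
  parts gives \<open>A' j\<close> with coefficient 2 s (s - 1) where \<open>B j\<close> has s (s -
  1). The surplus is nonnegative, and s r powr (s - 1) |grad f|^2 remains.\<close>

theorem weighted_gradient_bound:
  fixes f :: "real ^ 'd \<Rightarrow> real"
  assumes F0: "cpoly N F" "extends_to f F" and dF0: "is_cgrad F dF" "\<And>j. cpoly N (dF j)"
    and \<delta>0: "\<delta> > 0" and s0: "s \<ge> 1"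
  shows "gint (\<lambda>x. ((f x)\<^sup>2 + \<delta>) powr (s - 1) * (\<Sum>j\<in>UNIV. (Re (dF j (cvec x)))\<^sup>2))
    \<le> real N * gint (\<lambda>x. ((f x)\<^sup>2 + \<delta>) powr s)"
proof -
  obtain ddF where ddF0: "\<And>j k. cpoly N (ddF j k)" "\<And>j. is_cgrad (dF j) (ddF j)"
    using cpoly_cgrad[OF dF0(2)] by metis
  interpret cpoly_powr_moment F dF ddF N \<delta> s
    by unfold_locales (use F0 dF0 ddF0 \<delta>0 s0 in auto)
  define g where "g j x = Re (dF j (cvec x))" for j x
  define h where "h j x = Re (ddF j j (cvec x))" for j x
  have eg: "extends_to (g j) (dF j)" for j
    unfolding g_def by (rule extends_to_grad(2)[OF F0(2) dF0(1)])
  have eh: "extends_to (h j) (ddF j j)" for j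
    unfolding h_def using extends_to_grad(2)[OF eg[of j] ddF0(2)[of j]] .
  have re: "F (cvec x) = f x" "dF j (cvec x) = g j x" "ddF j j (cvec x) = h j x" for j x
    using F0(2) eg eh by (auto simp: extends_to_def)
  have tame: "tame f" "tame (g j)" "tame (h j)" for j
    using extends_to_tame[OF F0(2,1)] extends_to_tame[OF eg dF0(2)] extends_to_tame[OF eh ddF0(1)] by auto
  define r where "r x = (f x)\<^sup>2 + \<delta>" for x
  have tr: "tame (\<lambda>x. r x powr \<sigma>)" for \<sigma> unfolding r_def using tame_square_powr[OF tame(1) \<delta>] .
  have rho: "rho (cvec x) = r x" for x by (simp add: rho_def r_def re)
  \<comment> \<open>\<open>A j\<close> and \<open>B j\<close> are the first and second holomorphic
    partials of \<open>phi\<close> on real points; \<open>A' j\<close> is the real partial of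
    \<open>A j\<close>.\<close>
  define A where "A j x = s * r x powr (s - 1) * f x * g j x" for j x
  define B where "B j x = s * (s - 1) * r x powr (s - 2) * (f x)\<^sup>2 * (g j x)\<^sup>2 + s * r x powr (s - 1) * f x * h j x" for j x
  define A' where "A' j x = s * ((s - 1) * r x powr (s - 2) * (2 * f x * g j x)) * f x * g j x
      + s * r x powr (s - 1) * (g j x)\<^sup>2 + s * r x powr (s - 1) * f x * h j x" for j x
  have tA: "tame (A j)" "tame (A' j)" "tame (B j)" for j
    unfolding A_def[abs_def] A'_def[abs_def] B_def[abs_def] by (intro tame_add tame_mult tame_power tame_const tr tame)+
  have tX: "tame (\<lambda>x::real^'d. x $ j)" for j by (rule tame_linear[OF bounded_linear_vec_nth])
  have G: "Re (G (cvec x)) = (\<Sum>j\<in>UNIV. x $ j * A j x - B j x)" for x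
  proof -
    have "a (cvec x) = complex_of_real (\<Sum>j\<in>UNIV. x $ j * g j x - h j x)"
      "q (cvec x) = complex_of_real (\<Sum>j\<in>UNIV. (g j x)\<^sup>2)"
      by (simp_all add: a_def q_def re power2_eq_square)
    then have "Re (G (cvec x)) = s * r x powr (s - 1) * f x * (\<Sum>j\<in>UNIV. x $ j * g j x - h j x)
        - s * (s - 1) * r x powr (s - 2) * (f x)\<^sup>2 * (\<Sum>j\<in>UNIV. (g j x)\<^sup>2)"
      unfolding G_def rho re by (simp add: power2_eq_square)
    also have "\<dots> = (\<Sum>j\<in>UNIV. x $ j * A j x - B j x)"
      unfolding sum_distrib_left sum_subtractf[symmetric] A_def B_def
      by (intro sum.cong refl) (simp add: algebra_simps)
    finally show ?thesis .
  qed
  have ibp: "gint (\<lambda>x. x $ j * A j x) = gint (A' j)" for j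
  proof (rule gint_coordinate_by_parts[OF _ tA(1,2)])
    fix x
    note f = extends_to_directional[OF F0(2) dF0(1), of x j, folded g_def]
    note g = extends_to_directional[OF eg[of j] ddF0(2)[of j], of x j, folded h_def]
    have "((\<lambda>t. s * (((f (x + t *\<^sub>R axis j 1))\<^sup>2 + \<delta>) powr (s - 1) * f (x + t *\<^sub>R axis j 1) * g j (x + t *\<^sub>R axis j 1)))
      has_real_derivative s * (((s - 1) * r x powr (s - 1 - 1) * (2 * f x * g j x) * f x + g j x * r x powr (s - 1)) * g j x
        + h j x * (r x powr (s - 1) * f x))) (at 0)"
      using DERIV_cmult[OF DERIV_mult[OF DERIV_mult[OF square_powr_has_real_derivative[OF f \<delta>, of "s - 1"] f] g], of s]
      by (simp add: r_def)
    moreover have "(\<lambda>t. A j (x + t *\<^sub>R axis j 1)) = (\<lambda>t. s * (((f (x + t *\<^sub>R axis j 1))\<^sup>2 + \<delta>) powr (s - 1)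
        * f (x + t *\<^sub>R axis j 1) * g j (x + t *\<^sub>R axis j 1)))"
      by (simp add: A_def r_def mult.assoc)
    moreover have "A' j x = s * (((s - 1) * r x powr (s - 1 - 1) * (2 * f x * g j x) * f x + g j x * r x powr (s - 1)) * g j x
        + h j x * (r x powr (s - 1) * f x))"
      by (simp add: A'_def algebra_simps power2_eq_square)
    ultimately show "((\<lambda>t. A j (x + t *\<^sub>R axis j 1)) has_real_derivative A' j x) (at 0)"
      by (simp only:)
  qed
  have "gint (\<lambda>x. s * (r x powr (s - 1) * (\<Sum>j\<in>UNIV. (g j x)\<^sup>2))) \<le> gint (\<lambda>x. \<Sum>j\<in>UNIV. A' j x - B j x)"
  proof (rule gint_mono)
    fix x
    have "s * (r x powr (s - 1) * (\<Sum>j\<in>UNIV. (g j x)\<^sup>2)) = (\<Sum>j\<in>UNIV. s * r x powr (s - 1) * (g j x)\<^sup>2)"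
      by (simp add: sum_distrib_left mult_ac)
    also have "\<dots> \<le> (\<Sum>j\<in>UNIV. A' j x - B j x)"
    proof (rule sum_mono)
      fix j
      have "0 \<le> s * (s - 1) * r x powr (s - 2) * (f x)\<^sup>2 * (g j x)\<^sup>2"
        using s by (intro mult_nonneg_nonneg) auto
      then show "s * r x powr (s - 1) * (g j x)\<^sup>2 \<le> A' j x - B j x"
        by (simp add: A'_def B_def algebra_simps power2_eq_square)
    qed
    finally show "s * (r x powr (s - 1) * (\<Sum>j\<in>UNIV. (g j x)\<^sup>2)) \<le> (\<Sum>j\<in>UNIV. A' j x - B j x)" .
  qed (intro tame_mult tame_const tr tame_sum tame_power tame_diff tame tA)+
  also have "\<dots> = (\<Sum>j\<in>UNIV. gint (A' j) - gint (B j))"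
    by (subst gint_sum, intro tame_diff tA, rule sum.cong[OF refl], rule gint_diff, (rule tA)+)
  also have "\<dots> = gint (\<lambda>x. Re (G (cvec x)))"
    unfolding G ibp[symmetric]
    by (subst gint_sum, intro tame_diff tame_mult tA tX, rule sum.cong[OF refl], rule gint_diff[symmetric],
        (intro tame_mult tA tX)+)
  also have "\<dots> \<le> real N * s * gint (\<lambda>x. phi (cvec x))" by (rule gint_G_real_le)
  also have "(\<lambda>x. phi (cvec x)) = (\<lambda>x. r x powr s)" by (simp add: phi_def rho)
  finally have "s * gint (\<lambda>x. r x powr (s - 1) * (\<Sum>j\<in>UNIV. (g j x)\<^sup>2)) \<le> s * (real N * gint (\<lambda>x. r x powr s))"
    by (simp add: gint_cmult mult_ac)
  then have "gint (\<lambda>x. r x powr (s - 1) * (\<Sum>j\<in>UNIV. (g j x)\<^sup>2)) \<le> real N * gint (\<lambda>x. r x powr s)"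
    by (rule mult_left_le_imp_le) (use s in auto)
  then show ?thesis unfolding r_def g_def .
qed

section \<open>The divergence of a polynomial vector field\<close>

lemma tame_norm_powr:
  fixes p :: real
  assumes "tame f" "p \<ge> 0"
  shows "tame (\<lambda>x. norm (f x) powr p)"
proof (rule tame_mono)
  show "tame (\<lambda>x. (1 + norm (f x)) ^ nat \<lceil>p\<rceil>)" by (intro tame_power tame_add tame_const tame_norm assms)
  show "(\<lambda>x. norm (f x) powr p) \<in> borel_measurable borel" using tameD[OF assms(1)] by measurable
  fix x
  have "norm (f x) powr p \<le> (1 + norm (f x)) powr p" using assms(2) by (intro powr_mono2) auto
  also have "\<dots> \<le> (1 + norm (f x)) powr real (nat \<lceil>p\<rceil>)" by (intro powr_mono) (linarith, simp)
  also have "\<dots> = (1 + norm (f x)) ^ nat \<lceil>p\<rceil>" by (simp add: powr_realpow add_pos_nonneg)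
  finally show "norm (norm (f x) powr p) \<le> norm ((1 + norm (f x)) ^ nat \<lceil>p\<rceil>)" by simp
qed

text \<open>Young's inequality with exponents s and s / (s - 1), phrased so that s = 1 is
  included.\<close>

lemma mult_powr_le_Young:
  fixes X r s :: real
  assumes "X \<ge> 0" "r > 0" "s \<ge> 1"
  shows "X * r powr (s - 1) \<le> X powr s / s + (s - 1) / s * r powr s"
proof (cases "X = 0")
  case False
  then have "(X powr s) powr (1 / s) * (r powr s) powr ((s - 1) / s) \<le> 1 / s * X powr s + (s - 1) / s * r powr s"
    using assms by (intro Youngs_inequality_0) (auto simp: field_simps)
  then show ?thesis using assms False by (simp add: powr_powr)
qed (use assms in simp)

lemma abs_powr_double: "\<bar>x::real\<bar> powr (2 * s) = (x\<^sup>2) powr s"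
proof (cases "x = 0")
  case False
  then have "\<bar>x\<bar> powr 2 = x\<^sup>2" by simp
  then show ?thesis by (simp only: powr_powr[symmetric])
qed simp

text \<open>The error is at most c \<delta> D with \<open>D\<close> the integral at \<delta> = 1,
  since the power s - 1 is nonnegative and hence monotone. So \<delta> can be sent to 0 without a
  limit under the integral.\<close>

lemma gint_powr_le_limit:
  fixes f :: "'a::euclidean_space \<Rightarrow> real"
  assumes f: "tame f" and s: "s \<ge> 1"
    and le: "\<And>\<delta>. 0 < \<delta> \<Longrightarrow> \<delta> \<le> 1 \<Longrightarrow> gint (\<lambda>x. ((f x)\<^sup>2 + \<delta>) powr s) \<le> Y + c * (\<delta> * gint (\<lambda>x. ((f x)\<^sup>2 + \<delta>) powr (s - 1)))"
    and c: "c \<ge> 0"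
  shows "gint (\<lambda>x. \<bar>f x\<bar> powr (2 * s)) \<le> Y"
proof -
  define D where "D = gint (\<lambda>x. ((f x)\<^sup>2 + 1) powr (s - 1))"
  have D: "D \<ge> 0" unfolding D_def by (rule gint_nonneg) simp
  have le': "gint (\<lambda>x. \<bar>f x\<bar> powr (2 * s)) \<le> Y + c * D * \<delta>" if \<delta>: "0 < \<delta>" "\<delta> \<le> 1" for \<delta>
  proof -
    have "gint (\<lambda>x. \<bar>f x\<bar> powr (2 * s)) \<le> gint (\<lambda>x. ((f x)\<^sup>2 + \<delta>) powr s)"
      unfolding abs_powr_double using \<delta> s tame_norm_powr[OF f, of "2 * s"]
      by (intro gint_mono tame_square_powr f powr_mono2) (auto simp: abs_powr_double)
    also have "\<dots> \<le> Y + c * (\<delta> * gint (\<lambda>x. ((f x)\<^sup>2 + \<delta>) powr (s - 1)))" by (rule le[OF \<delta>])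
    also have "c * (\<delta> * gint (\<lambda>x. ((f x)\<^sup>2 + \<delta>) powr (s - 1))) \<le> c * (\<delta> * D)"
      unfolding D_def using \<delta> s c by (intro mult_left_mono gint_mono tame_square_powr f powr_mono2) auto
    finally show ?thesis by (simp add: mult_ac)
  qed
  have "gint (\<lambda>x. \<bar>f x\<bar> powr (2 * s)) \<le> Y + e" if e: "e > 0" for e
  proof -
    define \<delta> where "\<delta> = min 1 (e / (c * D + 1))"
    have cD: "c * D \<ge> 0" using c D by simp
    have \<delta>: "0 < \<delta>" "\<delta> \<le> 1" using e cD by (auto simp: \<delta>_def add_nonneg_pos)
    have "c * D * \<delta> \<le> c * D * (e / (c * D + 1))" using cD by (intro mult_left_mono) (auto simp: \<delta>_def)
    also have "\<dots> \<le> e" using e cD by (simp add: field_simps)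
    finally show ?thesis using le'[OF \<delta>] by linarith
  qed
  then show ?thesis by (rule field_le_epsilon)
qed

section \<open>Integration by parts for the divergence\<close>

lemma gaussian_divergence_extension:
  fixes P :: "real ^ 'd \<Rightarrow> real ^ 'd"
  assumes F: "\<And>i. cpoly n (F i)" "\<And>i. extends_to (\<lambda>x. P x $ i) (F i)"
    and dF: "\<And>i j. cpoly n (dF i j)" "\<And>i. is_cgrad (F i) (dF i)"
  shows "gaussian_divergence P x = (\<Sum>i\<in>UNIV. x $ i * P x $ i - Re (dF i i (cvec x)))"
    and "cpoly (Suc n) (\<lambda>z. \<Sum>i\<in>UNIV. z $ i * F i z - dF i i z)"
    and "extends_to (gaussian_divergence P) (\<lambda>z. \<Sum>i\<in>UNIV. z $ i * F i z - dF i i z)"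
proof -
  show 1: "gaussian_divergence P x = (\<Sum>i\<in>UNIV. x $ i * P x $ i - Re (dF i i (cvec x)))" for x
    unfolding gaussian_divergence_def inner_vec_def sum_subtractf
    by (simp add: extends_to_partial_deriv[OF F(2) dF(2)])
  show "cpoly (Suc n) (\<lambda>z. \<Sum>i\<in>UNIV. z $ i * F i z - dF i i z)"
    by (intro cpoly_sum cpoly_diff cpoly_var_mult F cpoly_Suc[OF dF(1)])
  have "dF i i (cvec x) = Re (dF i i (cvec x))" for i x
    using extends_to_grad(2)[OF F(2) dF(2), of i i] by (simp add: extends_to_def)
  then show "extends_to (gaussian_divergence P) (\<lambda>z. \<Sum>i\<in>UNIV. z $ i * F i z - dF i i z)"
    using F(2) unfolding extends_to_def 1 by simp
qed

text \<open>The divergence is adjoint to the gradient under the Gaussian weight. It is tested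
  against \<eta> = f * r powr (s - 1), whose gradient is \<eta>' times the gradient of f; \<eta>' is
  the first factor on the right.\<close>

lemma gint_divergence_by_parts:
  fixes P :: "real ^ 'd \<Rightarrow> real ^ 'd"
  assumes F: "\<And>i. cpoly n (F i)" "\<And>i. extends_to (\<lambda>x. P x $ i) (F i)"
    and f: "cpoly m E" "extends_to (gaussian_divergence P) E"
    and dE: "is_cgrad E dE" "\<And>j. cpoly m (dE j)" and \<delta>: "\<delta> > 0"
  defines "f \<equiv> gaussian_divergence P"
  shows "gint (\<lambda>x. (f x)\<^sup>2 * ((f x)\<^sup>2 + \<delta>) powr (s - 1))
    = gint (\<lambda>x. (((f x)\<^sup>2 + \<delta>) powr (s - 1) + 2 * (s - 1) * (f x)\<^sup>2 * ((f x)\<^sup>2 + \<delta>) powr (s - 2))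
        * (P x \<bullet> (\<chi> i. Re (dE i (cvec x)))))"
proof -
  obtain dF where dF: "\<And>i j. cpoly n (dF i j)" "\<And>i. is_cgrad (F i) (dF i)" using cpoly_cgrad[OF F(1)] by metis
  define r where "r x = (f x)\<^sup>2 + \<delta>" for x
  define g where "g i x = Re (dE i (cvec x))" for i x
  define p where "p i x = Re (dF i i (cvec x))" for i x
  define \<eta> where "\<eta> x = f x * r x powr (s - 1)" for x
  define \<eta>' where "\<eta>' x = r x powr (s - 1) + 2 * (s - 1) * (f x)\<^sup>2 * r x powr (s - 2)" for x
  have tf: "tame f" unfolding f_def by (rule extends_to_tame[OF f(2,1)])
  have tr: "tame (\<lambda>x. r x powr \<sigma>)" for \<sigma> unfolding r_def by (rule tame_square_powr[OF tf \<delta>])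
  have tP: "tame (\<lambda>x. P x $ i)" for i by (rule extends_to_tame[OF F(2,1)])
  have tg: "tame (g i)" for i unfolding g_def
    by (rule extends_to_tame[OF extends_to_grad(2)[OF f(2) dE(1)] dE(2)])
  have tp: "tame (p i)" for i unfolding p_def
    by (rule extends_to_tame[OF extends_to_grad(2)[OF F(2) dF(2)] dF(1)])
  have t\<eta>: "tame \<eta>" "tame \<eta>'" unfolding \<eta>_def[abs_def] \<eta>'_def[abs_def]
    by (intro tame_mult tame_add tame_power tame_const tf tr)+
  have tX: "tame (\<lambda>x::real^'d. x $ j)" for j by (rule tame_linear[OF bounded_linear_vec_nth])
  have ibp: "gint (\<lambda>x. x $ i * (P x $ i * \<eta> x)) = gint (\<lambda>x. p i x * \<eta> x + \<eta>' x * g i x * P x $ i)" for i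
  proof (rule gint_coordinate_by_parts)
    fix x
    note df = extends_to_directional[OF f(2) dE(1), of x i, folded g_def f_def]
    note dp = extends_to_directional[OF F(2) dF(2), of x i i, folded p_def]
    have "((\<lambda>t. P (x + t *\<^sub>R axis i 1) $ i * (f (x + t *\<^sub>R axis i 1) * ((f (x + t *\<^sub>R axis i 1))\<^sup>2 + \<delta>) powr (s - 1)))
      has_real_derivative p i x * (f x * r x powr (s - 1))
        + (g i x * r x powr (s - 1) + (s - 1) * r x powr (s - 1 - 1) * (2 * f x * g i x) * f x) * P x $ i) (at 0)"
      using DERIV_mult[OF dp DERIV_mult[OF df square_powr_has_real_derivative[OF df \<delta>, of "s - 1"]]]
      by (simp add: r_def)
    moreover have "(\<lambda>t. P (x + t *\<^sub>R axis i 1) $ i * \<eta> (x + t *\<^sub>R axis i 1))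
      = (\<lambda>t. P (x + t *\<^sub>R axis i 1) $ i * (f (x + t *\<^sub>R axis i 1) * ((f (x + t *\<^sub>R axis i 1))\<^sup>2 + \<delta>) powr (s - 1)))"
      by (simp add: \<eta>_def r_def)
    moreover have "p i x * \<eta> x + \<eta>' x * g i x * P x $ i = p i x * (f x * r x powr (s - 1))
        + (g i x * r x powr (s - 1) + (s - 1) * r x powr (s - 1 - 1) * (2 * f x * g i x) * f x) * P x $ i"
      by (simp add: \<eta>_def \<eta>'_def algebra_simps power2_eq_square)
    ultimately show "((\<lambda>t. P (x + t *\<^sub>R axis i 1) $ i * \<eta> (x + t *\<^sub>R axis i 1))
      has_real_derivative p i x * \<eta> x + \<eta>' x * g i x * P x $ i) (at 0)" by (simp only:)
  qed (intro tame_mult tame_add tP t\<eta> tp tg)+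
  have "gint (\<lambda>x. (f x)\<^sup>2 * r x powr (s - 1)) = gint (\<lambda>x. \<Sum>i\<in>UNIV. x $ i * (P x $ i * \<eta> x) - p i x * \<eta> x)"
  proof (intro arg_cong[where f=gint] ext)
    fix x
    have "(f x)\<^sup>2 * r x powr (s - 1) = (\<Sum>i\<in>UNIV. x $ i * P x $ i - p i x) * \<eta> x"
      using gaussian_divergence_extension(1)[OF F dF, of x] by (simp add: \<eta>_def p_def f_def power2_eq_square)
    also have "\<dots> = (\<Sum>i\<in>UNIV. x $ i * (P x $ i * \<eta> x) - p i x * \<eta> x)"
      unfolding sum_distrib_right by (intro sum.cong refl) (simp add: algebra_simps)
    finally show "(f x)\<^sup>2 * r x powr (s - 1) = (\<Sum>i\<in>UNIV. x $ i * (P x $ i * \<eta> x) - p i x * \<eta> x)" .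
  qed
  also have "\<dots> = (\<Sum>i\<in>UNIV. gint (\<lambda>x. \<eta>' x * g i x * P x $ i))"
  proof -
    have "gint (\<lambda>x. x $ i * (P x $ i * \<eta> x) - p i x * \<eta> x) = gint (\<lambda>x. \<eta>' x * g i x * P x $ i)" for i
    proof -
      have "gint (\<lambda>x. x $ i * (P x $ i * \<eta> x) - p i x * \<eta> x) = gint (\<lambda>x. x $ i * (P x $ i * \<eta> x)) - gint (\<lambda>x. p i x * \<eta> x)"
        by (rule gint_diff) (intro tame_mult tX tP t\<eta> tp)+
      also have "gint (\<lambda>x. x $ i * (P x $ i * \<eta> x)) = gint (\<lambda>x. p i x * \<eta> x) + gint (\<lambda>x. \<eta>' x * g i x * P x $ i)"
        unfolding ibp by (rule gint_add) (intro tame_mult tX tP t\<eta> tp tg)+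
      finally show ?thesis by simp
    qed
    then show ?thesis by (subst gint_sum) (intro tame_diff tame_mult tX tP t\<eta> tp, simp)
  qed
  also have "\<dots> = gint (\<lambda>x. \<eta>' x * (P x \<bullet> (\<chi> i. g i x)))"
    by (subst gint_sum[symmetric], intro tame_mult t\<eta> tg tP, intro arg_cong[where f=gint] ext)
       (simp add: inner_vec_def sum_distrib_left mult_ac)
  finally show ?thesis unfolding \<eta>'_def r_def g_def .
qed

context
  fixes \<delta> s f r e :: real
  assumes d: "\<delta> > 0" and s: "s \<ge> 1" and r: "r = f\<^sup>2 + \<delta>"
    and e: "e = r powr (s - 1) + 2 * (s - 1) * f\<^sup>2 * r powr (s - 2)"
begin

text \<open>\<open>e\<close> is the derivative of y * (y^2 + \<delta>) powr (s - 1) at y = f, and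
  the upper bound is f^2 <= r. With p = 2 s the factor 2 s - 1 is p - 1.\<close>

lemma weight_deriv_bounds: "0 \<le> e" "e \<le> (2 * s - 1) * r powr (s - 1)"
proof -
  have rp: "r > 0" using d r by (simp add: add_nonneg_pos)
  show "0 \<le> e" unfolding e using s by simp
  have "f\<^sup>2 * r powr (s - 2) \<le> r * r powr (s - 2)" using d r by (intro mult_right_mono) auto
  also have "r * r powr (s - 2) = r powr (s - 1)"
    using rp powr_add[of r 1 "s - 2"] by (simp add: algebra_simps)
  finally have "2 * (s - 1) * (f\<^sup>2 * r powr (s - 2)) \<le> 2 * (s - 1) * r powr (s - 1)"
    using s by (intro mult_left_mono) auto
  then show "e \<le> (2 * s - 1) * r powr (s - 1)" unfolding e by (simp add: algebra_simps)
qed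

end

theorem gint_divergence_le:
  fixes P :: "real ^ 'd \<Rightarrow> real ^ 'd"
  assumes F: "\<And>i. cpoly n (F i)" "\<And>i. extends_to (\<lambda>x. P x $ i) (F i)" and p: "p \<ge> 2" and tP: "tame P"
  shows "gint (\<lambda>x. \<bar>gaussian_divergence P x\<bar> powr p)
    \<le> ((p - 1) * sqrt (real n + 1)) powr p * gint (\<lambda>x. norm (P x) powr p)"
proof -
  obtain dF where dF: "\<And>i j. cpoly n (dF i j)" "\<And>i. is_cgrad (F i) (dF i)" using cpoly_cgrad[OF F(1)] by metis
  obtain E where E: "cpoly (Suc n) E" "extends_to (gaussian_divergence P) E"
    using gaussian_divergence_extension(2,3)[OF F dF] by blast
  obtain dE where dE: "\<And>j. cpoly (Suc n) (dE j)" "is_cgrad E dE" using cpoly_cgrad[OF E(1)] by blast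
  define s where "s = p / 2"
  have s: "s \<ge> 1" and p2: "p = 2 * s" using p by (auto simp: s_def)
  define N where "N = real n + 1"
  have N: "N > 0" by (simp add: N_def)
  define K where "K = (p - 1) * sqrt N"
  have K: "K \<ge> 0" using p N by (simp add: K_def)
  let ?f = "gaussian_divergence P"
  have tf: "tame ?f" by (rule extends_to_tame[OF E(2,1)])
  define B where "B = gint (\<lambda>x. norm (P x) powr p)"
  have "gint (\<lambda>x. \<bar>?f x\<bar> powr (2 * s)) \<le> K powr p * B"
  proof (rule gint_powr_le_limit[OF tf s, where c="2 * s"])
    fix \<delta> :: real assume \<delta>: "0 < \<delta>" "\<delta> \<le> 1"
    define r where "r x = (?f x)\<^sup>2 + \<delta>" for x
    have rpos: "r x > 0" for x using \<delta> by (simp add: r_def add_nonneg_pos)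
    have tr: "tame (\<lambda>x. r x powr \<sigma>)" for \<sigma> unfolding r_def by (rule tame_square_powr[OF tf \<delta>(1)])
    define V where "V x = (\<chi> i. Re (dE i (cvec x)))" for x
    have nV: "(norm (V x))\<^sup>2 = (\<Sum>j\<in>UNIV. (Re (dE j (cvec x)))\<^sup>2)" for x
      unfolding V_def power2_norm_eq_inner inner_vec_def by (simp add: power2_eq_square)
    define J where "J = gint (\<lambda>x. r x powr s)"
    define D where "D = gint (\<lambda>x. r x powr (s - 1))"
    define W where "W x = r x powr (s - 1) * (norm (V x))\<^sup>2" for x
    have tW: "tame W" unfolding W_def[abs_def] nV
      by (intro tame_mult tr tame_sum tame_power extends_to_tame[OF extends_to_grad(2)[OF E(2) dE(2)] dE(1)])
    have WJ: "gint W \<le> N * J"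
      using weighted_gradient_bound[OF E dE(2,1) \<delta>(1) s] by (simp add: W_def[abs_def] nV J_def r_def N_def add.commute)
    define e where "e x = r x powr (s - 1) + 2 * (s - 1) * (?f x)\<^sup>2 * r x powr (s - 2)" for x
    have te: "tame (\<lambda>x. e x * (P x \<bullet> V x))"
    proof -
      have "tame (\<lambda>x. P x \<bullet> V x)"
        unfolding V_def inner_vec_def
        by (simp, intro tame_sum tame_mult extends_to_tame[OF extends_to_grad(2)[OF E(2) dE(2)] dE(1)] extends_to_tame[OF F(2,1)])
      then show ?thesis unfolding e_def
        by (intro tame_mult tame_add tame_const tame_power tr tf)
    qed
    \<comment> \<open>Young's inequality twice. The quadratic one is weighted so that
      \<open>WJ\<close> turns the gradient term into J / 2; the one with exponent \<open>s\<close>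
      adds (s - 1) / (2 s) J. Together they leave J / (2 s) on the left, matching the factor 1 / (2
      s) of K powr p; clearing it puts 2 s in front of the \<delta> term.\<close>
    have pw: "e x * (P x \<bullet> V x) \<le> (1 / (2 * N)) * W x + (1 / (2 * s) * K powr p) * norm (P x) powr p + (s - 1) / (2 * s) * r x powr s" for x
    proof -
      note b = weight_deriv_bounds[OF \<delta>(1) s r_def e_def, of x]
      have "e x * (P x \<bullet> V x) \<le> e x * (norm (P x) * norm (V x))"
        using b(1) norm_cauchy_schwarz[of "P x" "V x"] by (intro mult_left_mono)
      also have "\<dots> \<le> ((p - 1) * r x powr (s - 1)) * (norm (P x) * norm (V x))"
        using b(2) by (intro mult_right_mono) (auto simp: p2)
      also have "\<dots> = r x powr (s - 1) * ((p - 1) * norm (P x) * norm (V x))" by simp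
      also have "\<dots> \<le> r x powr (s - 1) * ((norm (V x))\<^sup>2 / (2 * N) + (K * norm (P x))\<^sup>2 / 2)"
      proof (rule mult_left_mono)
        have "0 \<le> (norm (V x) - (p - 1) * N * norm (P x))\<^sup>2 / (2 * N)" using N by simp
        also have "\<dots> = (norm (V x))\<^sup>2 / (2 * N) - (p - 1) * norm (P x) * norm (V x) + ((p - 1)\<^sup>2 * N * (norm (P x))\<^sup>2) / 2"
          using N by (simp add: power2_eq_square divide_simps) (simp add: algebra_simps)
        also have "(p - 1)\<^sup>2 * N * (norm (P x))\<^sup>2 = (K * norm (P x))\<^sup>2"
          using N by (simp add: K_def power_mult_distrib)
        finally show "(p - 1) * norm (P x) * norm (V x) \<le> (norm (V x))\<^sup>2 / (2 * N) + (K * norm (P x))\<^sup>2 / 2"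
          by simp
      qed simp
      also have "\<dots> = (1 / (2 * N)) * W x + (1/2) * ((K * norm (P x))\<^sup>2 * r x powr (s - 1))"
        by (simp add: W_def algebra_simps)
      also have "(K * norm (P x))\<^sup>2 * r x powr (s - 1) \<le> ((K * norm (P x))\<^sup>2) powr s / s + (s - 1) / s * r x powr s"
        by (rule mult_powr_le_Young) (use rpos s in auto)
      also have "((K * norm (P x))\<^sup>2) powr s = K powr p * norm (P x) powr p"
        using abs_powr_double[of "K * norm (P x)" s] K by (simp add: p2 abs_mult powr_mult)
      finally show ?thesis using s by (simp add: algebra_simps) (simp add: field_simps)
    qed
    have "J - \<delta> * D = gint (\<lambda>x. (?f x)\<^sup>2 * r x powr (s - 1))"
    proof -
      have "J - \<delta> * D = gint (\<lambda>x. r x powr s - \<delta> * r x powr (s - 1))"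
        unfolding J_def D_def gint_cmult[symmetric] by (rule gint_diff[symmetric]) (intro tame_mult tame_const tr)+
      moreover have "r x powr s - \<delta> * r x powr (s - 1) = (?f x)\<^sup>2 * r x powr (s - 1)" for x
      proof -
        have "r x powr s = r x * r x powr (s - 1)" using rpos[of x] powr_add[of "r x" 1 "s - 1"] by simp
        then show ?thesis by (simp add: r_def algebra_simps)
      qed
      ultimately show ?thesis by simp
    qed
    also have "\<dots> = gint (\<lambda>x. e x * (P x \<bullet> V x))"
      using gint_divergence_by_parts[OF F E dE(2,1) \<delta>(1), of s] by (simp add: r_def e_def V_def)
    also have "\<dots> \<le> gint (\<lambda>x. (1 / (2 * N)) * W x + (1 / (2 * s) * K powr p) * norm (P x) powr p + (s - 1) / (2 * s) * r x powr s)"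
      using p by (intro gint_mono pw te tame_add tame_mult tame_const tW tr tame_norm_powr tP) auto
    also have "\<dots> = (1 / (2 * N)) * gint W + (1 / (2 * s) * K powr p) * B + (s - 1) / (2 * s) * J"
    proof -
      have t: "tame (\<lambda>x. (1 / (2 * N)) * W x)" "tame (\<lambda>x. (1 / (2 * s) * K powr p) * norm (P x) powr p)"
        "tame (\<lambda>x. (s - 1) / (2 * s) * r x powr s)"
        using p by (auto intro!: tame_mult tW tr tame_norm_powr tP simp del: times_divide_eq_left)
      show ?thesis unfolding B_def J_def
        by (subst gint_add, intro tame_add t, rule t, subst gint_add, (rule t)+) (simp only: gint_cmult)
    qed
    also have "(1 / (2 * N)) * gint W \<le> (1 / (2 * N)) * (N * J)" using WJ N by (intro mult_left_mono) auto
    also have "(1 / (2 * N)) * (N * J) = J / 2" using N by simp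
    finally have "J - \<delta> * D \<le> J / 2 + 1 / (2 * s) * K powr p * B + (s - 1) / (2 * s) * J" by simp
    then have "2 * s * (J - \<delta> * D) \<le> 2 * s * (J / 2 + 1 / (2 * s) * K powr p * B + (s - 1) / (2 * s) * J)"
      using s by (intro mult_left_mono) auto
    also have "\<dots> = s * J + K powr p * B + (s - 1) * J" using s by (simp add: field_simps)
    finally have "J \<le> K powr p * B + 2 * s * (\<delta> * D)" by (simp add: algebra_simps)
    then show "gint (\<lambda>x. ((?f x)\<^sup>2 + \<delta>) powr s) \<le> K powr p * B + 2 * s * (\<delta> * gint (\<lambda>x. ((?f x)\<^sup>2 + \<delta>) powr (s - 1)))"
      by (simp only: J_def D_def r_def)
  qed (use s in auto)
  then show ?thesis by (simp add: p2 K_def N_def B_def)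
qed

section \<open>Norms with respect to the standard Gaussian measure\<close>

lemma
  fixes h :: "'d::finite \<Rightarrow> real \<Rightarrow> 'b::{real_normed_field, banach, second_countable_topology}"
  assumes h: "\<And>i. integrable lborel (h i)"
  shows integrable_lborel_prod_vec: "integrable lborel (\<lambda>x::real^'d. \<Prod>i\<in>UNIV. h i (x $ i))"
    and integral_lborel_prod_vec: "(\<integral>x. (\<Prod>i\<in>UNIV. h i (x $ i)) \<partial>(lborel :: (real^'d) measure)) = (\<Prod>i\<in>UNIV. \<integral>y. h i y \<partial>lborel)"
proof -
  interpret product_sigma_finite "\<lambda>b::real^'d. lborel :: real measure" ..
  define H where "H b = h (axis_index b)" for b :: "real^'d"
  have B: "(Basis :: (real^'d) set) = range (\<lambda>i. axis i 1)" by (auto simp: Basis_vec_def)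
  have re: "(\<Prod>b\<in>Basis. G b) = (\<Prod>i\<in>UNIV. G (axis i 1))" for G :: "real^'d \<Rightarrow> 'b"
    unfolding B by (subst prod.reindex) (auto simp: inj_on_def axis_eq_axis)
  have H: "integrable lborel (H b)" for b unfolding H_def by (rule h)
  let ?T = "\<lambda>f. \<Sum>b\<in>Basis. f b *\<^sub>R (b :: real^'d)"
  have T: "?T f $ i = f (axis i 1)" for f i
    using inner_sum_left_Basis[of "axis i 1" f] by (simp add: inner_axis axis_in_Basis_iff)
  have meas: "(\<lambda>x::real^'d. \<Prod>i\<in>UNIV. h i (x $ i)) \<in> borel_measurable borel"
    using h[THEN borel_measurable_integrable] by measurable
  have Tm: "?T \<in> measurable (\<Pi>\<^sub>M b\<in>Basis. lborel) borel" by measurable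
  have eq: "(\<Prod>i\<in>UNIV. h i (?T f $ i)) = (\<Prod>b\<in>Basis. H b (f b))" for f
    unfolding T re by (simp add: H_def axis_index_axis)
  show "integrable lborel (\<lambda>x::real^'d. \<Prod>i\<in>UNIV. h i (x $ i))"
    by (subst lborel_eq, subst integrable_distr_eq[OF Tm meas], unfold eq)
       (rule product_integrable_prod[OF finite_Basis H])
  show "(\<integral>x. (\<Prod>i\<in>UNIV. h i (x $ i)) \<partial>(lborel :: (real^'d) measure)) = (\<Prod>i\<in>UNIV. \<integral>y. h i y \<partial>lborel)"
    by (subst lborel_eq, subst integral_distr[OF Tm meas], unfold eq,
        subst product_integral_prod[OF finite_Basis H], unfold re) (simp add: H_def axis_index_axis)
qed

lemma std_normal_density_eq_gauss: "std_normal_density x = 1 / sqrt (2 * pi) * gauss x"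
  by (simp add: std_normal_density_def gauss_def)

lemma integral_std_normal_eq_gint:
  fixes h :: "real \<Rightarrow> real"
  assumes "h \<in> borel_measurable borel"
  shows "(\<integral>x. h x \<partial>density lborel std_normal_density) = 1 / sqrt (2 * pi) * gint h"
  unfolding gint_def using assms
  by (subst integral_density) (auto simp: std_normal_density_eq_gauss mult.assoc)

lemma prod_std_normal_density:
  "(\<Prod>i\<in>UNIV. std_normal_density (x $ i)) = (1 / sqrt (2 * pi)) ^ CARD('d) * gauss (x :: real^'d)"
proof -
  have n: "(norm x)\<^sup>2 = (\<Sum>i\<in>UNIV. (x $ i)\<^sup>2)"
    unfolding power2_norm_eq_inner inner_vec_def by (simp add: power2_eq_square)
  have "(\<Prod>i\<in>UNIV. gauss (x $ i)) = gauss x"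
    unfolding gauss_def n exp_sum[OF finite, symmetric] by (simp add: sum_negf sum_divide_distrib)
  then show ?thesis by (simp only: std_normal_density_eq_gauss prod.distrib prod_constant)
qed

lemma integral_std_gaussian_eq_gint:
  fixes h :: "real ^ 'd \<Rightarrow> 'b::{banach, second_countable_topology}"
  assumes "h \<in> borel_measurable borel"
  shows "(\<integral>x. h x \<partial>std_gaussian) = (1 / sqrt (2 * pi)) ^ CARD('d) *\<^sub>R gint h"
  unfolding std_gaussian_def gint_def prod_std_normal_density using assms
  by (subst integral_density) (auto simp: scaleR_scaleR[symmetric] simp del: scaleR_scaleR power_one_over)

lemma sets_std_gaussian [simp, measurable_cong]: "sets std_gaussian = sets borel"
  by (simp add: std_gaussian_def)

lemma space_std_gaussian [simp]: "space std_gaussian = UNIV"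
  by (simp add: std_gaussian_def)

lemma integrable_std_gaussian_tame:
  fixes h :: "real ^ 'd \<Rightarrow> 'b::{banach, second_countable_topology}"
  assumes "tame h"
  shows "integrable std_gaussian h"
  unfolding std_gaussian_def prod_std_normal_density using tameD[OF assms] integrable_tame_gauss[OF assms]
  by (subst integrable_density) (auto simp: scaleR_scaleR[symmetric] simp del: scaleR_scaleR power_one_over)

lemma prob_space_std_gaussian: "prob_space (std_gaussian :: (real^'d) measure)"
proof
  let ?g = "\<lambda>x::real^'d. \<Prod>i\<in>UNIV. std_normal_density (x $ i)"
  have "emeasure (std_gaussian :: (real^'d) measure) (space std_gaussian) = (\<integral>\<^sup>+x. ennreal (?g x) \<partial>lborel)"
    by (simp add: std_gaussian_def emeasure_density)
  also have "\<dots> = ennreal (\<integral>x. ?g x \<partial>lborel)"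
    by (intro nn_integral_eq_integral integrable_lborel_prod_vec) (auto intro!: prod_nonneg)
  also have "(\<integral>x. ?g x \<partial>lborel) = 1"
    by (subst integral_lborel_prod_vec) auto
  finally show "emeasure (std_gaussian :: (real^'d) measure) (space std_gaussian) = 1" by simp
qed

text \<open>The law of \<open>v \<bullet> x\<close> is identified through its characteristic function.\<close>
lemma integral_std_gaussian_inner:
  fixes v :: "real ^ 'd" and h :: "real \<Rightarrow> real"
  assumes h: "h \<in> borel_measurable borel"
  shows "(\<integral>x. h (v \<bullet> x) \<partial>std_gaussian) = (\<integral>y. h (norm v * y) \<partial>density lborel std_normal_density)"
proof -
  interpret G: prob_space "std_gaussian :: (real^'d) measure" by (rule prob_space_std_gaussian)
  interpret N: real_distribution std_normal_distribution by (rule real_dist_normal_dist)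
  have m: "(\<lambda>x. v \<bullet> x) \<in> borel_measurable std_gaussian" by measurable
  have m': "(\<lambda>y. norm v * y) \<in> borel_measurable std_normal_distribution" by measurable
  have "distr std_gaussian borel (\<lambda>x. v \<bullet> x) = distr std_normal_distribution borel (\<lambda>y. norm v * y)"
  proof (rule Levy_uniqueness)
    show "real_distribution (distr std_gaussian borel (\<lambda>x. v \<bullet> x))"
      by (rule G.real_distribution_distr[OF m])
    show "real_distribution (distr std_normal_distribution borel (\<lambda>y. norm v * y))"
      by (rule N.real_distribution_distr[OF m'])
    show "char (distr std_gaussian borel (\<lambda>x. v \<bullet> x)) = char (distr std_normal_distribution borel (\<lambda>y. norm v * y))"
    proof
      fix t
      have N: "(CLINT y|std_normal_distribution. iexp (u * y)) = exp (- u\<^sup>2 / 2)" for u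
        using fun_cong[OF char_std_normal_distribution, of u] by (simp add: char_def)
      have N': "(CLINT y|lborel. std_normal_density y *\<^sub>R iexp (u * y)) = exp (- u\<^sup>2 / 2)" for u
        unfolding N[symmetric] by (subst integral_density) auto
      have i: "integrable lborel (\<lambda>y. std_normal_density y *\<^sub>R iexp (u * y))" for u
        by (rule Bochner_Integration.integrable_bound[of lborel std_normal_density]) auto
      have "char (distr std_gaussian borel (\<lambda>x. v \<bullet> x)) t = (CLINT x|std_gaussian. iexp (t * (v \<bullet> x)))"
        unfolding char_def by (subst integral_distr[OF m]) auto
      also have "\<dots> = (CLINT x|lborel. (\<Prod>i\<in>UNIV. std_normal_density (x $ i)) *\<^sub>R iexp (t * (v \<bullet> x)))"
        unfolding std_gaussian_def by (subst integral_density) (auto intro!: prod_nonneg)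
      \<comment> \<open>The exponential of the inner product factors over the coordinates, so the
        integral becomes a product of one-dimensional characteristic functions.\<close>
      also have "\<dots> = (CLINT x|lborel. (\<Prod>i\<in>UNIV. std_normal_density (x $ i) *\<^sub>R iexp ((t * v $ i) * x $ i)))"
        by (intro Bochner_Integration.integral_cong refl)
           (simp add: scaleR_conv_of_real prod.distrib exp_sum[symmetric] inner_vec_def sum_distrib_left mult_ac)
      also have "\<dots> = (\<Prod>i\<in>UNIV. exp (- (t * v $ i)\<^sup>2 / 2))"
        by (subst integral_lborel_prod_vec[OF i]) (simp only: N' of_real_prod)
      also have "(\<Prod>i\<in>UNIV. exp (- (t * v $ i)\<^sup>2 / 2)) = exp (- (t * norm v)\<^sup>2 / 2)"
        by (simp add: exp_sum[symmetric] power_mult_distrib power2_norm_eq_inner inner_vec_def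
            sum_distrib_left sum_negf sum_divide_distrib power2_eq_square[of "v $ _"])
      also have "complex_of_real (exp (- (t * norm v)\<^sup>2 / 2)) = (CLINT y|std_normal_distribution. iexp ((t * norm v) * y))"
        by (rule N[symmetric])
      also have "\<dots> = char (distr std_normal_distribution borel (\<lambda>y. norm v * y)) t"
        unfolding char_def by (subst integral_distr[OF m']) (auto simp: mult_ac)
      finally show "char (distr std_gaussian borel (\<lambda>x. v \<bullet> x)) t = char (distr std_normal_distribution borel (\<lambda>y. norm v * y)) t" .
    qed
  qed
  then have "(\<integral>z. h z \<partial>distr std_gaussian borel (\<lambda>x. v \<bullet> x)) = (\<integral>z. h z \<partial>distr std_normal_distribution borel (\<lambda>y. norm v * y))"
    by simp
  then show ?thesis using h by (simp add: integral_distr[OF m] integral_distr[OF m'])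
qed

lemma Lp_norm_inner:
  assumes "p > 0"
  shows "Lp_norm std_gaussian p (\<lambda>x. v \<bullet> x) = gaussian_moment p * norm v"
proof -
  have "(\<integral>x. norm (v \<bullet> x) powr p \<partial>std_gaussian) = (\<integral>y. norm (norm v * y) powr p \<partial>density lborel std_normal_density)"
    by (rule integral_std_gaussian_inner[of "\<lambda>y. norm y powr p"]) measurable
  also have "\<dots> = norm v powr p * (\<integral>y. norm y powr p \<partial>density lborel std_normal_density)"
    by (simp add: abs_mult powr_mult)
  finally show ?thesis
    unfolding Lp_norm_def gaussian_moment_def using assms
    by (simp add: powr_mult powr_powr integral_nonneg_AE)
qed

text \<open>By \<open>Lp_norm_inner\<close> constant fields reduce to dimension one. There f x = x
  has derivative 1, so one integration by parts and Young's inequality with X = p - 1 give E |x|^p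
  <= (p - 1)^(p/2).\<close>

lemma gaussian_moment_le:
  assumes p: "p \<ge> 2"
  shows "gaussian_moment p \<le> sqrt p"
proof -
  define s where "s = p / 2"
  have s: "s \<ge> 1" and p2: "p = 2 * s" using p by (auto simp: s_def)
  have tid: "tame (\<lambda>x::real. x)" by (rule tame_linear[OF bounded_linear_ident])
  define Y where "Y = (p - 1) powr s * gint (\<lambda>x::real. 1)"
  have "gint (\<lambda>x::real. \<bar>x\<bar> powr (2 * s)) \<le> Y"
  proof (rule gint_powr_le_limit[OF tid s, where c=s])
    fix \<delta> :: real assume \<delta>: "0 < \<delta>" "\<delta> \<le> 1"
    define r where "r x = x\<^sup>2 + \<delta>" for x :: real
    have rpos: "r x > 0" for x using \<delta> by (simp add: r_def add_nonneg_pos)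
    have tr: "tame (\<lambda>x. r x powr \<sigma>)" for \<sigma> unfolding r_def by (rule tame_square_powr[OF tid \<delta>(1)])
    define J where "J = gint (\<lambda>x. r x powr s)"
    define D where "D = gint (\<lambda>x. r x powr (s - 1))"
    define e where "e x = r x powr (s - 1) + 2 * (s - 1) * x\<^sup>2 * r x powr (s - 2)" for x
    have te: "tame e" unfolding e_def[abs_def] by (intro tame_mult tame_add tame_const tame_power tr tid)
    have "J - \<delta> * D = gint (\<lambda>x. r x powr s - \<delta> * r x powr (s - 1))"
      unfolding J_def D_def gint_cmult[symmetric] by (rule gint_diff[symmetric]) (intro tame_mult tame_const tr)+
    also have "\<dots> = gint (\<lambda>x. (x \<bullet> 1) *\<^sub>R (x * r x powr (s - 1)))"
    proof (intro arg_cong[where f=gint] ext)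
      fix x
      have "r x powr s = r x * r x powr (s - 1)" using rpos[of x] powr_add[of "r x" 1 "s - 1"] by simp
      then show "r x powr s - \<delta> * r x powr (s - 1) = (x \<bullet> 1) *\<^sub>R (x * r x powr (s - 1))"
        by (simp add: r_def algebra_simps power2_eq_square)
    qed
    also have "\<dots> = gint e"
    proof (rule gint_by_parts)
      fix x :: real
      have "((\<lambda>t. x + t) has_real_derivative 1) (at 0)" by (auto intro!: derivative_eq_intros)
      from DERIV_mult[OF this square_powr_has_real_derivative[OF this \<delta>(1), of "s - 1"]]
      show "((\<lambda>t. (x + t *\<^sub>R 1) * r (x + t *\<^sub>R 1) powr (s - 1)) has_vector_derivative e x) (at 0)"
        by (simp add: has_real_derivative_iff_has_vector_derivative[symmetric] r_def e_def algebra_simps power2_eq_square)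
    qed (intro tame_mult tid tr te)+
    also have "\<dots> \<le> gint (\<lambda>x. ((p - 1) powr s / s) * 1 + (s - 1) / s * r x powr s)"
    proof (rule gint_mono)
      fix x
      have "e x \<le> (p - 1) * r x powr (s - 1)"
        using weight_deriv_bounds(2)[OF \<delta>(1) s r_def e_def, of x] by (simp add: p2)
      also have "\<dots> \<le> (p - 1) powr s / s + (s - 1) / s * r x powr s"
        by (rule mult_powr_le_Young) (use rpos s p in auto)
      finally show "e x \<le> ((p - 1) powr s / s) * 1 + (s - 1) / s * r x powr s" by simp
    qed (intro te tame_add tame_mult tame_const tr)+
    also have "\<dots> = (p - 1) powr s / s * gint (\<lambda>x::real. 1) + (s - 1) / s * J"
      unfolding J_def gint_cmult[symmetric] by (rule gint_add) (intro tame_mult tame_const tr)+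
    also have "\<dots> = Y / s + (s - 1) / s * J" by (simp add: Y_def)
    finally have "s * (J - \<delta> * D) \<le> s * (Y / s + (s - 1) / s * J)" using s by (intro mult_left_mono) auto
    also have "\<dots> = Y + (s - 1) * J" using s by (simp add: field_simps)
    finally show "gint (\<lambda>x. (x\<^sup>2 + \<delta>) powr s) \<le> Y + s * (\<delta> * gint (\<lambda>x. (x\<^sup>2 + \<delta>) powr (s - 1)))"
      by (simp add: J_def D_def r_def algebra_simps)
  qed (use s in auto)
  then have "(1 / sqrt (2 * pi)) * gint (\<lambda>x::real. \<bar>x\<bar> powr p) \<le> (1 / sqrt (2 * pi)) * Y"
    unfolding p2 by (intro mult_left_mono) auto
  moreover have "(1 / sqrt (2 * pi)) * Y = (p - 1) powr s"
  proof -
    interpret prob_space "density lborel std_normal_density" by (rule prob_space_normal_density) simp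
    have "(\<integral>x. (1::real) \<partial>density lborel std_normal_density) = 1"
      using prob_space by simp
    then have "1 / sqrt (2 * pi) * gint (\<lambda>x::real. 1) = 1"
      by (subst (asm) integral_std_normal_eq_gint) auto
    then show ?thesis unfolding Y_def by (metis mult.left_commute mult.right_neutral)
  qed
  ultimately have "(\<integral>x. norm x powr p \<partial>density lborel std_normal_density) \<le> (p - 1) powr s"
    by (subst integral_std_normal_eq_gint) auto
  then have "gaussian_moment p \<le> ((p - 1) powr s) powr (1 / p)"
    unfolding gaussian_moment_def Lp_norm_def using p by (intro powr_mono2) (auto intro: integral_nonneg_AE)
  also have "\<dots> = sqrt (p - 1)" using p by (simp add: powr_powr s_def powr_half_sqrt)
  also have "\<dots> \<le> sqrt p" by simp
  finally show ?thesis .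
qed

section \<open>Minkowski's inequality\<close>

lemma convex_powr_nonneg:
  fixes x y p l :: real
  assumes "p \<ge> 1" "0 \<le> l" "l \<le> 1" "x \<ge> 0" "y \<ge> 0"
  shows "(l * x + (1 - l) * y) powr p \<le> l * x powr p + (1 - l) * y powr p"
proof -
  have a: "k powr p \<le> k" if "0 \<le> k" "k \<le> 1" for k :: real
    using powr_mono'[of 1 p k] that assms(1) by simp
  consider "x = 0" | "y = 0" | "x > 0" "y > 0" using assms by linarith
  then show ?thesis
  proof cases
    case 1
    then show ?thesis using a[of "1 - l"] assms by (simp add: powr_mult mult_right_mono)
  next
    case 2
    then show ?thesis using a[of l] assms by (simp add: powr_mult mult_right_mono)
  next
    case 3
    then show ?thesis using convex_onD[OF powr_convex[OF assms(1)], of "1 - l" x y] assms by simp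
  qed
qed

text \<open>Convexity of the power, applied to |u| / a and |v| / b with weights a / (a + b) and b /
  (a + b). Adding \<epsilon> / 2 to each norm keeps \<open>a\<close> and \<open>b\<close> positive
  when a norm vanishes.\<close>

lemma Lp_norm_triangle:
  fixes u v :: "'a \<Rightarrow> real"
  assumes p: "p \<ge> 1" and i: "integrable M (\<lambda>x. \<bar>u x\<bar> powr p)" "integrable M (\<lambda>x. \<bar>v x\<bar> powr p)"
    "integrable M (\<lambda>x. \<bar>u x + v x\<bar> powr p)"
  shows "Lp_norm M p (\<lambda>x. u x + v x) \<le> Lp_norm M p u + Lp_norm M p v"
proof (rule field_le_epsilon)
  fix \<epsilon> :: real assume e: "\<epsilon> > 0"
  define a where "a = Lp_norm M p u + \<epsilon> / 2"
  define b where "b = Lp_norm M p v + \<epsilon> / 2"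
  define A where "A = (\<integral>x. \<bar>u x\<bar> powr p \<partial>M)"
  define B where "B = (\<integral>x. \<bar>v x\<bar> powr p \<partial>M)"
  have AB: "A \<ge> 0" "B \<ge> 0" unfolding A_def B_def by (intro integral_nonneg_AE; simp)+
  have L: "Lp_norm M p u = A powr (1/p)" "Lp_norm M p v = B powr (1/p)"
    by (simp_all add: Lp_norm_def A_def B_def)
  have ab: "a > 0" "b > 0" using e unfolding a_def b_def L by (auto intro: add_nonneg_pos)
  have Aa: "A \<le> a powr p"
  proof -
    have "(A powr (1/p)) powr p \<le> a powr p" using e p unfolding a_def L by (intro powr_mono2) auto
    then show ?thesis using p AB by (simp add: powr_powr)
  qed
  have Bb: "B \<le> b powr p"
  proof -
    have "(B powr (1/p)) powr p \<le> b powr p" using e p unfolding b_def L by (intro powr_mono2) auto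
    then show ?thesis using p AB by (simp add: powr_powr)
  qed
  define l where "l = a / (a + b)"
  have l: "0 \<le> l" "l \<le> 1" "1 - l = b / (a + b)" using ab by (auto simp: l_def field_simps)
  have pw: "\<bar>u x + v x\<bar> powr p \<le> (a + b) powr p * (l / a powr p * \<bar>u x\<bar> powr p + (1 - l) / b powr p * \<bar>v x\<bar> powr p)" for x
  proof -
    have "\<bar>u x + v x\<bar> powr p \<le> (\<bar>u x\<bar> + \<bar>v x\<bar>) powr p" using p by (intro powr_mono2) auto
    also have "\<bar>u x\<bar> + \<bar>v x\<bar> = (a + b) * (l * (\<bar>u x\<bar> / a) + (1 - l) * (\<bar>v x\<bar> / b))"
      unfolding l(3) using ab by (simp add: l_def distrib_left)
    also have "\<dots> powr p = (a + b) powr p * (l * (\<bar>u x\<bar> / a) + (1 - l) * (\<bar>v x\<bar> / b)) powr p"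
      by (rule powr_mult)
    also have "\<dots> \<le> (a + b) powr p * (l * (\<bar>u x\<bar> / a) powr p + (1 - l) * (\<bar>v x\<bar> / b) powr p)"
      using ab l p by (intro mult_left_mono convex_powr_nonneg) auto
    finally show ?thesis using ab by (simp add: powr_divide)
  qed
  have "(\<integral>x. \<bar>u x + v x\<bar> powr p \<partial>M) \<le> (\<integral>x. (a + b) powr p * (l / a powr p * \<bar>u x\<bar> powr p + (1 - l) / b powr p * \<bar>v x\<bar> powr p) \<partial>M)"
    using i by (intro integral_mono pw) auto
  also have "\<dots> = (a + b) powr p * (l / a powr p * A + (1 - l) / b powr p * B)"
    using i by (simp add: A_def B_def)
  also have "\<dots> \<le> (a + b) powr p * (l / a powr p * a powr p + (1 - l) / b powr p * b powr p)"
    using l(1,2) ab by (intro mult_left_mono add_mono Aa Bb) auto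
  also have "\<dots> = (a + b) powr p" using ab by simp
  finally have "(\<integral>x. \<bar>u x + v x\<bar> powr p \<partial>M) powr (1/p) \<le> ((a + b) powr p) powr (1/p)"
    using p by (intro powr_mono2) (auto intro: integral_nonneg_AE)
  also have "\<dots> = a + b" using p ab by (simp add: powr_powr)
  finally show "Lp_norm M p (\<lambda>x. u x + v x) \<le> Lp_norm M p u + Lp_norm M p v + \<epsilon>"
    by (simp add: Lp_norm_def[of M p "\<lambda>x. u x + v x"] a_def b_def)
qed

theorem Lp_norm_divergence_le:
  fixes P :: "real ^ 'd \<Rightarrow> real ^ 'd"
  assumes F: "\<And>i. cpoly n (F i)" "\<And>i. extends_to (\<lambda>x. P x $ i) (F i)" and p: "p \<ge> 2" and tP: "tame P"
  shows "Lp_norm std_gaussian p (gaussian_divergence P) \<le> (p - 1) * sqrt (real n + 1) * Lp_norm std_gaussian p P"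
proof -
  define c where "c = (1 / sqrt (2 * pi)) ^ CARD('d)"
  have c: "c \<ge> 0" by (simp add: c_def)
  define K where "K = (p - 1) * sqrt (real n + 1)"
  have K: "K \<ge> 0" using p by (simp add: K_def)
  obtain dF where dF: "\<And>i j. cpoly n (dF i j)" "\<And>i. is_cgrad (F i) (dF i)" using cpoly_cgrad[OF F(1)] by metis
  have tf: "tame (gaussian_divergence P)"
    by (rule extends_to_tame[OF gaussian_divergence_extension(3,2)[OF F dF]])
  have pw: "tame (\<lambda>x. norm (gaussian_divergence P x) powr p)" "tame (\<lambda>x. norm (P x) powr p)"
    using p tame_norm_powr[OF tf, of p] tame_norm_powr[OF tP, of p] by auto
  have "(\<integral>x. norm (gaussian_divergence P x) powr p \<partial>std_gaussian) \<le> K powr p * (\<integral>x. norm (P x) powr p \<partial>std_gaussian)"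
  proof -
    have "c * gint (\<lambda>x. norm (gaussian_divergence P x) powr p) \<le> c * (K powr p * gint (\<lambda>x. norm (P x) powr p))"
      using gint_divergence_le[OF F p tP] c unfolding K_def by (intro mult_left_mono) auto
    then show ?thesis
      using tameD[OF pw(1)] tameD[OF pw(2)] by (simp add: integral_std_gaussian_eq_gint c_def mult_ac)
  qed
  then have "(\<integral>x. norm (gaussian_divergence P x) powr p \<partial>std_gaussian) powr (1/p)
      \<le> (K powr p * (\<integral>x. norm (P x) powr p \<partial>std_gaussian)) powr (1/p)"
    using p by (intro powr_mono2) (auto intro: integral_nonneg_AE)
  also have "\<dots> = K * Lp_norm std_gaussian p P"
    unfolding Lp_norm_def using p K by (simp add: powr_mult powr_powr integral_nonneg_AE)
  finally show ?thesis by (simp add: Lp_norm_def K_def)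
qed

theorem corollary1p7:
  fixes P :: "real ^ 'd \<Rightarrow> real ^ 'd" and n :: nat and p :: real
  assumes "p \<ge> 2"
    and "\<And>i. polynomial_degree_le n (\<lambda>x. P x $ i)"
  shows
    "(n \<ge> 1 \<longrightarrow>
        Lp_norm std_gaussian p (gaussian_divergence P)
          \<le> sqrt p * norm (\<integral>x. P x \<partial>std_gaussian)
            + 96 * sqrt (2 * exp 1) * p * sqrt (real n)
                * Lp_norm std_gaussian p (\<lambda>x. P x - (\<integral>y. P y \<partial>std_gaussian))
      \<and> Lp_norm std_gaussian p (gaussian_divergence P)
          \<le> (1 + 192 * sqrt (2 * exp 1)) * p * sqrt (real n) * Lp_norm std_gaussian p P)
   \<and> (n = 0 \<longrightarrow>
        (\<exists>c. P = (\<lambda>_. c)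
           \<and> Lp_norm std_gaussian p (gaussian_divergence P) = gaussian_moment p * norm c
           \<and> gaussian_moment p * norm c \<le> sqrt p * norm c))"
proof (intro conjI impI)
  have p: "p \<ge> 2" by (rule assms(1))
  obtain F where F: "\<And>i. cpoly n (F i)" "\<And>i. extends_to (\<lambda>x. P x $ i) (F i)"
  proof -
    have "\<exists>F. cpoly n F \<and> extends_to (\<lambda>x. P x $ i) F" for i
      by (rule polynomial_degree_le_extension[OF assms(2)[of i]]) blast
    then obtain F where "\<And>i. cpoly n (F i) \<and> extends_to (\<lambda>x. P x $ i) (F i)" by metis
    then show ?thesis using that by blast
  qed
  have tP: "tame P"
  proof -
    have "P = (\<lambda>x. \<Sum>i\<in>UNIV. P x $ i *\<^sub>R axis i 1)"
      by (rule ext) (simp only: basis_expansion scalar_mult_eq_scaleR[symmetric])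
    moreover have "tame (\<lambda>x. \<Sum>i\<in>UNIV. P x $ i *\<^sub>R axis i (1::real))"
      by (intro tame_sum tame_scaleR tame_const extends_to_tame[OF F(2,1)])
    ultimately show ?thesis by simp
  qed
  have moment: "gaussian_moment p * norm c \<le> sqrt p * norm c" for c :: "real^'d"
    using gaussian_moment_le[OF p] by (intro mult_right_mono) auto
  {
    assume "n \<ge> 1"
    \<comment> \<open>Here n >= 1 enters, as n + 1 <= 2 n. The resulting factor sqrt 2 lies below
      both stated constants because sqrt 2 <= sqrt (2 e).\<close>
    have const: "(p - 1) * sqrt (real n + 1) \<le> sqrt 2 * p * sqrt (real n)"
    proof -
      have "sqrt (real n + 1) \<le> sqrt (2 * real n)" using \<open>n \<ge> 1\<close> by simp
      then have "(p - 1) * sqrt (real n + 1) \<le> p * sqrt (2 * real n)" using p by (intro mult_mono) auto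
      then show ?thesis by (simp add: real_sqrt_mult mult_ac)
    qed
    have e: "sqrt 2 \<le> sqrt (2 * exp 1)" by simp
    have bound: "(p - 1) * sqrt (real n + 1) * L \<le> C * p * sqrt (real n) * L" if "sqrt 2 \<le> C" "L \<ge> 0" for C L
    proof -
      have "sqrt 2 * (p * sqrt (real n)) \<le> C * (p * sqrt (real n))" using that p by (intro mult_right_mono) auto
      then show ?thesis using const that(2) by (intro mult_right_mono) auto
    qed
    have L0: "Lp_norm M p f \<ge> 0" for M and f :: "real^'d \<Rightarrow> real^'d" by (simp add: Lp_norm_def)
    \<comment> \<open>The field bound is applied to \<open>P\<close> itself, without splitting off
      the mean.\<close>
    show "Lp_norm std_gaussian p (gaussian_divergence P)
          \<le> (1 + 192 * sqrt (2 * exp 1)) * p * sqrt (real n) * Lp_norm std_gaussian p P"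
    proof (rule order_trans[OF Lp_norm_divergence_le[OF F p tP] bound[OF _ L0]])
      have "0 \<le> sqrt (2 * exp 1)" by simp
      then show "sqrt 2 \<le> 1 + 192 * sqrt (2 * exp 1)" using e by linarith
    qed
    \<comment> \<open>Subtracting the mean \<open>v\<close> leaves the partials \<open>dF\<close>
      unchanged and removes v \<bullet> x from the divergence. The linear form is controlled by the
      Gaussian moment, the centred field \<open>Q\<close> by the field bound.\<close>
    define v where "v = (\<integral>x. P x \<partial>std_gaussian)"
    define Q where "Q x = P x - v" for x
    define F' where "F' i z = F i z - complex_of_real (v $ i)" for i z
    have F': "\<And>i. cpoly n (F' i)" "\<And>i. extends_to (\<lambda>x. Q x $ i) (F' i)"
      using F by (auto simp: F'_def[abs_def] Q_def extends_to_def intro: cpoly_diff cpoly_const)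
    have tQ: "tame Q" unfolding Q_def[abs_def] by (intro tame_diff tame_const tP)
    obtain dF where dF: "\<And>i j. cpoly n (dF i j)" "\<And>i. is_cgrad (F i) (dF i)" using cpoly_cgrad[OF F(1)] by metis
    have dF': "is_cgrad (F' i) (dF i)" for i
      using has_derivative_diff[OF _ has_derivative_const, of "F i"] dF(2)[of i]
      unfolding is_cgrad_def F'_def[abs_def] by fastforce
    have div: "gaussian_divergence P = (\<lambda>x. v \<bullet> x + gaussian_divergence Q x)"
      unfolding gaussian_divergence_extension(1)[OF F dF] gaussian_divergence_extension(1)[OF F' dF(1) dF']
      by (simp add: fun_eq_iff Q_def inner_vec_def sum.distrib[symmetric] algebra_simps)
    have tdQ: "tame (gaussian_divergence Q)"
      by (rule extends_to_tame[OF gaussian_divergence_extension(3,2)[OF F' dF(1) dF']])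
    have tv: "tame (\<lambda>x. v \<bullet> x)" by (rule tame_linear[OF bounded_linear_inner_right])
    have "Lp_norm std_gaussian p (gaussian_divergence P)
      \<le> Lp_norm std_gaussian p (\<lambda>x. v \<bullet> x) + Lp_norm std_gaussian p (gaussian_divergence Q)"
      unfolding div using p tame_norm_powr[OF tv, of p] tame_norm_powr[OF tdQ, of p] tame_norm_powr[OF tame_add[OF tv tdQ], of p]
      by (intro Lp_norm_triangle integrable_std_gaussian_tame) auto
    also have "Lp_norm std_gaussian p (\<lambda>x. v \<bullet> x) \<le> sqrt p * norm v"
      using moment p by (simp add: Lp_norm_inner)
    also have "Lp_norm std_gaussian p (gaussian_divergence Q) \<le> 96 * sqrt (2 * exp 1) * p * sqrt (real n) * Lp_norm std_gaussian p Q"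
    proof (rule order_trans[OF Lp_norm_divergence_le[OF F' p tQ] bound[OF _ L0]])
      have "0 \<le> sqrt (2 * exp 1)" by simp
      then show "sqrt 2 \<le> 96 * sqrt (2 * exp 1)" using e by linarith
    qed
    finally show "Lp_norm std_gaussian p (gaussian_divergence P)
          \<le> sqrt p * norm (\<integral>x. P x \<partial>std_gaussian)
            + 96 * sqrt (2 * exp 1) * p * sqrt (real n)
                * Lp_norm std_gaussian p (\<lambda>x. P x - (\<integral>y. P y \<partial>std_gaussian))"
      by (simp add: v_def Q_def[abs_def])
  }
  assume n: "n = 0"
  have "\<exists>k. \<forall>x. P x $ i = k" for i
  proof -
    obtain c where c: "\<And>x. P x $ i = (\<Sum>\<alpha> | (\<Sum>j\<in>UNIV. \<alpha> j) \<le> n. c \<alpha> * (\<Prod>j\<in>UNIV. x $ j ^ \<alpha> j))"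
      using assms(2)[of i] unfolding polynomial_degree_le_def by blast
    \<comment> \<open>Only the zero multi-index has order 0, so each component equals its constant
      coefficient; the divergence of \<open>P\<close> is then a linear form.\<close>
    have "{\<alpha>::'d \<Rightarrow> nat. (\<Sum>j\<in>UNIV. \<alpha> j) \<le> n} = {\<lambda>_. 0}" using n by auto
    then show ?thesis using c by auto
  qed
  then obtain k where k: "\<And>i x. P x $ i = k i" by metis
  define c where "c = (\<chi> i. k i)"
  have P: "P = (\<lambda>_. c)" by (auto simp: vec_eq_iff k c_def)
  have "gaussian_divergence P = (\<lambda>x. c \<bullet> x)"
    by (simp add: P gaussian_divergence_def partial_deriv_def inner_commute fun_eq_iff)
  then show "\<exists>c. P = (\<lambda>_. c)
           \<and> Lp_norm std_gaussian p (gaussian_divergence P) = gaussian_moment p * norm c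
           \<and> gaussian_moment p * norm c \<le> sqrt p * norm c"
    using P moment[of c] p by (intro exI[of _ c]) (simp add: Lp_norm_inner)
qed

end
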